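(* Let $L\to M$ be a spin bundle over a Riemann surface $M$, with Dirac structure $\bar\partial$ and complex structure $J$, and let $\psi\in\Gamma(L^\times)$ be a nowhere vanishing section of $L$. Then the conformal $1$-form $(\psi,\psi)\in\Gamma(\operatorname{Conf}(TM,\mathbb{R}^3))$ is closed if and only if $\psi$ solves the non-linear Dirac equation \[ \bar\partial\psi+\tfrac12 HJ\psi(\psi,\psi)=0 \] for some real valued function $H\colon M\to\mathbb{R}$. The resulting conformal immersion $f\colon\tilde M\to\mathbb{R}^3$ on the universal cover with translation periods satisfying $df=(\psi,\psi)$ has Gauss normal map $N\colon M\to S^2$ given by $J\psi=-\psi N$. The induced spin bundle $L_f$ is isomorphic to $L$, and the induced quaternionic holomorphic spin structure $d^{\,0,1}$ on $L_f$ corresponds, under this isomorphism, to the quaternionic holomorphic spin structure $D=\bar\partial+\frac12HJ\psi(\psi,\cdot)$. In particular, $H$ is the mean curvature of $f$ calculated with respect to the induced conformal metric $|df|^2=|\psi|^4$.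
   Context: All objects are smooth. $\mathbb{H}$ denotes the quaternions, $\mathbb{R}^3=\operatorname{Im}\mathbb{H}$, $S^2\subset\operatorname{Im}\mathbb{H}$ the unit sphere. $M$ is a Riemann surface; $*$ is precomposition of $1$-forms with the complex structure of $TM$ (the negative of the Hodge star). $\operatorname{Conf}(TM,\mathbb{R}^3)$ is the bundle of injective conformal linear maps $T_xM\to\mathbb{R}^3$. Spin bundle. A spin bundle over the Riemann surface $M$ is a right quaternionic line bundle $L\to M$ together with a spin pairing $(\cdot,\cdot)\colon L\times L\to\operatorname{Hom}(TM,\mathbb{H})$, i.e. real bilinear with $(\psi\lambda,\varphi\mu)=\bar\lambda(\psi,\varphi)\mu$ for $\lambda,\mu\in\mathbb{H}$, $\overline{(\psi,\varphi)}=-(\varphi,\psi)$, and $(\psi,\psi)_X\neq0$ for all non-zero $\psi\in L$, $X\in TM$; it is compatible with the Riemann surface: the metrics $|(\psi,\psi)|^2$ are in the conformal class of $M$ for $\psi$ nowhere vanishing, and $J\in\Gamma(\operatorname{End}(L))$ denotes the unique quaternionic linear complex structure with $*(\psi,\varphi)=(J\psi,\varphi)=(\psi,J\varphi)$. Isomorphisms of spin bundles are quaternionic linear bundle isomorphisms over the identity of $M$ intertwining the spin pairings. For $L$-valued $1$-forms $\mu$ the pairing is extended by $(\mu,\psi)_{X,Y}=(\mu_X,\psi)_Y-(\mu_Y,\psi)_X$ and $(\psi,\mu)_{X,Y}=(\psi,\mu_X)_Y-(\psi,\mu_Y)_X$. $\bar KL$ is the bundle of $L$-valued $1$-forms $\mu$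 with $*\mu=-J\mu$, and $\mu^{0,1}=\frac12(\mu+J*\mu)$. $|\psi|^2:=|(\psi,\psi)|$, so that $|\psi|^4$ is the metric $X\mapsto|(\psi,\psi)_X|^2$. The $L$-valued $1$-forms $J\psi(\psi,\varphi)$ are $X\mapsto J\psi\,(\psi,\varphi)_X$. Quaternionic holomorphic spin structure. This is a real linear operator $D\colon\Gamma(L)\to\Gamma(\bar KL)$ with $D(\psi\lambda)=(D\psi)\lambda+(\psi\,d\lambda)^{0,1}$ for $\lambda\in C^\infty(M,\mathbb{H})$ and $d(\psi,\varphi)=(D\psi,\varphi)+(\psi,D\varphi)$ for all $\psi,\varphi\in\Gamma(L)$. The Dirac structure $\bar\partial$ is the unique one commuting with $J$. Immersions with translation periods. This means an immersion $f\colon\tilde M\to\mathbb{R}^3$ of the universal cover such that for every deck transformation $\gamma$ the difference $f\circ\gamma-f$ is constant; then $df$ and the Gauss map descend to $M$. For such a conformal $f$, the Gauss normal map $N\colon M\to S^2$ satisfies $*df=N\,df=-df\,N$; the induced spin bundle is $L_f:=M\times\mathbb{H}$ with pairing $(\psi,\varphi)=\bar\psi\,df\,\varphi$ and complex structure $J\varphi=-N\varphi$; its induced quaternionic holomorphic spin structure is $d^{\,0,1}\varphi=\frac12(d\varphi+J*d\varphi)$. The mean curvature of $f$ is the usual one, half the trace of the shape operator with respect to the metric $|df|^2$; no sign convention for the shape operator is fixed here. *)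

theory Defs
  imports "HOL-Analysis.Analysis"
begin

section \<open>Quaternions\<close>

datatype quat = Quat (qr: real) (qi: real) (qj: real) (qk: real)

lemma quat_eq_iff: "x = y \<longleftrightarrow> qr x = qr y \<and> qi x = qi y \<and> qj x = qj y \<and> qk x = qk y"
  by (cases x; cases y) simp

instantiation quat :: ab_group_add
begin

definition "0 = Quat 0 0 0 0"
definition "x + y = Quat (qr x + qr y) (qi x + qi y) (qj x + qj y) (qk x + qk y)"
definition "- x = Quat (- qr x) (- qi x) (- qj x) (- qk x)"
definition "x - y = Quat (qr x - qr y) (qi x - qi y) (qj x - qj y) (qk x - qk y)"

instance
  by standard (simp_all add: quat_eq_iff zero_quat_def plus_quat_def uminus_quat_def minus_quat_def)

end

lemma quat_sel_zero [simp]: "qr 0 = 0" "qi 0 = 0" "qj 0 = 0" "qk 0 = 0"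
  by (simp_all add: zero_quat_def)

lemma quat_sel_add [simp]:
  "qr (x + y) = qr x + qr y" "qi (x + y) = qi x + qi y"
  "qj (x + y) = qj x + qj y" "qk (x + y) = qk x + qk y"
  by (simp_all add: plus_quat_def)

lemma quat_sel_uminus [simp]:
  "qr (- x) = - qr x" "qi (- x) = - qi x" "qj (- x) = - qj x" "qk (- x) = - qk x"
  by (simp_all add: uminus_quat_def)

lemma quat_sel_diff [simp]:
  "qr (x - y) = qr x - qr y" "qi (x - y) = qi x - qi y"
  "qj (x - y) = qj x - qj y" "qk (x - y) = qk x - qk y"
  by (simp_all add: minus_quat_def)

instantiation quat :: ring_1
begin

definition "1 = Quat 1 0 0 0"
definition "x * y = Quat
  (qr x * qr y - qi x * qi y - qj x * qj y - qk x * qk y)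
  (qr x * qi y + qi x * qr y + qj x * qk y - qk x * qj y)
  (qr x * qj y - qi x * qk y + qj x * qr y + qk x * qi y)
  (qr x * qk y + qi x * qj y - qj x * qi y + qk x * qr y)"

instance
  by standard (simp_all add: quat_eq_iff one_quat_def times_quat_def algebra_simps)

end

lemma quat_sel_one [simp]: "qr 1 = 1" "qi 1 = 0" "qj 1 = 0" "qk 1 = 0"
  by (simp_all add: one_quat_def)

lemma quat_sel_mult [simp]:
  "qr (x * y) = qr x * qr y - qi x * qi y - qj x * qj y - qk x * qk y"
  "qi (x * y) = qr x * qi y + qi x * qr y + qj x * qk y - qk x * qj y"
  "qj (x * y) = qr x * qj y - qi x * qk y + qj x * qr y + qk x * qi y"
  "qk (x * y) = qr x * qk y + qi x * qj y - qj x * qi y + qk x * qr y"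
  by (simp_all add: times_quat_def)

instantiation quat :: real_algebra_1
begin

definition "r *\<^sub>R x = Quat (r * qr x) (r * qi x) (r * qj x) (r * qk x)"

instance
  by standard (simp_all add: quat_eq_iff scaleR_quat_def algebra_simps)

end

lemma quat_sel_scaleR [simp]:
  "qr (r *\<^sub>R x) = r * qr x" "qi (r *\<^sub>R x) = r * qi x"
  "qj (r *\<^sub>R x) = r * qj x" "qk (r *\<^sub>R x) = r * qk x"
  by (simp_all add: scaleR_quat_def)

definition qcnj :: "quat \<Rightarrow> quat" where
  "qcnj x = Quat (qr x) (- qi x) (- qj x) (- qk x)"

lemma quat_sel_cnj [simp]:
  "qr (qcnj x) = qr x" "qi (qcnj x) = - qi x" "qj (qcnj x) = - qj x" "qk (qcnj x) = - qk x"
  by (simp_all add: qcnj_def)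

instantiation quat :: real_inner
begin

definition "inner x y = qr x * qr y + qi x * qi y + qj x * qj y + qk x * qk y"
definition "norm x = sqrt (inner x (x::quat))"
definition "sgn x = x /\<^sub>R norm (x::quat)"
definition "dist x y = norm (x - y :: quat)"
definition [code del]: "(uniformity :: (quat \<times> quat) filter) = (INF e\<in>{0<..}. principal {(x, y). dist x y < e})"
definition [code del]: "open (U :: quat set) \<longleftrightarrow> (\<forall>x\<in>U. eventually (\<lambda>(x', y). x' = x \<longrightarrow> y \<in> U) uniformity)"

instance
proof
  fix x y z :: quat and r :: real
  show "inner x y = inner y x"
    by (simp add: inner_quat_def mult.commute)
  show "inner (x + y) z = inner x z + inner y z" "inner (r *\<^sub>R x) y = r * inner x y"
    by (simp_all add: inner_quat_def algebra_simps)
  show "0 \<le> inner x x"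
    by (simp add: inner_quat_def)
  show "inner x x = 0 \<longleftrightarrow> x = 0"
    by (simp add: inner_quat_def quat_eq_iff add_nonneg_eq_0_iff)
qed (rule norm_quat_def sgn_quat_def dist_quat_def uniformity_quat_def open_quat_def)+

end

instance quat :: real_normed_algebra_1
proof
  fix x y :: quat
  have "inner (x * y) (x * y) = inner x x * inner y y"
    by (simp add: inner_quat_def algebra_simps)
  then show "norm (x * y) \<le> norm x * norm y"
    by (simp add: norm_quat_def real_sqrt_mult)
  show "norm (1 :: quat) = 1"
    by (simp add: norm_quat_def inner_quat_def)
qed

instantiation quat :: real_normed_div_algebra
begin

definition "inverse x = qcnj x /\<^sub>R inner x (x::quat)"
definition "x div y = x * inverse (y::quat)"

instance
proof
  fix x y :: quat
  have "qcnj x * x = inner x x *\<^sub>R 1" "x * qcnj x = inner x x *\<^sub>R 1"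
    by (simp_all add: quat_eq_iff inner_quat_def algebra_simps)
  then show "x \<noteq> 0 \<Longrightarrow> inverse x * x = 1" "x \<noteq> 0 \<Longrightarrow> x * inverse x = 1"
    by (simp_all add: inverse_quat_def)
  show "x div y = x * inverse y"
    by (rule divide_quat_def)
  show "inverse (0::quat) = 0"
    by (simp add: inverse_quat_def)
  have "inner (x * y) (x * y) = inner x x * inner y y"
    by (simp add: inner_quat_def algebra_simps)
  then show "norm (x * y) = norm x * norm y"
    by (simp add: norm_quat_def real_sqrt_mult)
qed

end

instantiation quat :: euclidean_space
begin

definition "Basis = {Quat 1 0 0 0, Quat 0 1 0 0, Quat 0 0 1 0, Quat 0 0 0 1}"

instance
proof
  show "(Basis :: quat set) \<noteq> {}" "finite (Basis :: quat set)"
    by (simp_all add: Basis_quat_def)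
  show "inner u v = (if u = v then 1 else 0)" if "u \<in> Basis" "v \<in> Basis" for u v :: quat
    using that unfolding Basis_quat_def by (elim insertE emptyE; simp add: inner_quat_def)
  show "(\<forall>u\<in>Basis. inner x u = 0) \<longleftrightarrow> x = 0" for x :: quat
    by (auto simp: Basis_quat_def inner_quat_def quat_eq_iff [of x])
qed

end

definition Im_quat :: "quat set" where
  "Im_quat = {q. qr q = 0}"


section \<open>Riemann surfaces\<close>

primrec Ck_on :: "nat \<Rightarrow> 'a::real_normed_vector set \<Rightarrow> ('a \<Rightarrow> 'b::real_normed_vector) \<Rightarrow> bool" where
  "Ck_on 0 S f \<longleftrightarrow> continuous_on S f"
| "Ck_on (Suc k) S f \<longleftrightarrow>
     (\<forall>x\<in>S. f differentiable (at x)) \<and> (\<forall>v. Ck_on k S (\<lambda>x. frechet_derivative f (at x) v))"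

text \<open>Only used for open subsets \<open>S\<close> of a Euclidean space.\<close>

definition smooth_on :: "'a::euclidean_space set \<Rightarrow> ('a \<Rightarrow> 'b::real_normed_vector) \<Rightarrow> bool" where
  "smooth_on S f \<longleftrightarrow> (\<forall>k. Ck_on k S f)"

type_synonym 'm chart = "'m set \<times> ('m \<Rightarrow> complex)"

definition chart_inv :: "'m chart \<Rightarrow> complex \<Rightarrow> 'm" where
  "chart_inv c = inv_into (fst c) (snd c)"

text \<open>
  The surface is the whole type. Hausdorffness comes from the type class where it is needed;
  second countability of a connected Riemann surface is automatic (Rado).
\<close>

definition riemann_surface :: "'m::topological_space chart set \<Rightarrow> bool" where
  "riemann_surface A \<longleftrightarrow>
     connected (UNIV :: 'm set) \<and>
     (\<Union>c\<in>A. fst c) = UNIV \<and>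
     (\<forall>c\<in>A. open (fst c) \<and> open (snd c ` fst c) \<and>
            homeomorphism (fst c) (snd c ` fst c) (snd c) (chart_inv c)) \<and>
     (\<forall>c\<in>A. \<forall>d\<in>A. (snd d \<circ> chart_inv c) holomorphic_on (snd c ` (fst c \<inter> fst d)))"

text \<open>
  Each tangent space \<open>T\<^sub>xM\<close> is identified with \<open>\<complex>\<close> by means of one chart around \<open>x\<close>, selected once and
  for all; multiplication by \<open>\<i>\<close> is then the complex structure of \<open>TM\<close>, whichever chart was selected,
  since coordinate changes have complex linear derivatives. A 1-form with values in \<open>V\<close> is thus
  a function \<open>\<omega> :: 'm \<Rightarrow> complex \<Rightarrow> V\<close>, and \<open>*\<omega>\<close> is \<open>\<lambda>x X. \<omega> x (\<i> * X)\<close>.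
\<close>

definition chart_at :: "'m chart set \<Rightarrow> 'm \<Rightarrow> 'm chart" where
  "chart_at A x = (SOME c. c \<in> A \<and> x \<in> fst c)"

definition differential ::
  "'m chart set \<Rightarrow> ('m \<Rightarrow> 'v::real_normed_vector) \<Rightarrow> 'm \<Rightarrow> complex \<Rightarrow> 'v" where
  "differential A f x =
     frechet_derivative (f \<circ> chart_inv (chart_at A x)) (at (snd (chart_at A x) x))"

definition tangent_map ::
  "'u chart set \<Rightarrow> 'm chart set \<Rightarrow> ('u \<Rightarrow> 'm) \<Rightarrow> 'u \<Rightarrow> complex \<Rightarrow> complex" where
  "tangent_map B A p y = differential B (snd (chart_at A (p y)) \<circ> p) y"

text \<open>The element of \<open>T\<^sub>xM\<close> whose coordinate in the chart \<open>c\<close> is \<open>v\<close>.\<close>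

definition chart_vector :: "'m chart set \<Rightarrow> 'm chart \<Rightarrow> 'm \<Rightarrow> complex \<Rightarrow> complex" where
  "chart_vector A c x v = frechet_derivative (snd (chart_at A x) \<circ> chart_inv c) (at (snd c x)) v"

definition form_coord ::
  "'m chart set \<Rightarrow> 'm chart \<Rightarrow> ('m \<Rightarrow> complex \<Rightarrow> 'v) \<Rightarrow> complex \<Rightarrow> complex \<Rightarrow> 'v" where
  "form_coord A c \<omega> z v = \<omega> (chart_inv c z) (chart_vector A c (chart_inv c z) v)"

definition smooth_map_on ::
  "'m chart set \<Rightarrow> 'm set \<Rightarrow> ('m \<Rightarrow> 'v::real_normed_vector) \<Rightarrow> bool" where
  "smooth_map_on A U f \<longleftrightarrow> (\<forall>c\<in>A. smooth_on (snd c ` (U \<inter> fst c)) (f \<circ> chart_inv c))"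

definition smooth_form_on ::
  "'m chart set \<Rightarrow> 'm set \<Rightarrow> ('m \<Rightarrow> complex \<Rightarrow> 'v::real_normed_vector) \<Rightarrow> bool" where
  "smooth_form_on A U \<omega> \<longleftrightarrow>
     (\<forall>x\<in>U. linear (\<omega> x)) \<and>
     (\<forall>c\<in>A. \<forall>v. smooth_on (snd c ` (U \<inter> fst c)) (\<lambda>z. form_coord A c \<omega> z v))"

text \<open>
  \<open>d\<omega>(X,Y) = X(\<omega>(Y)) - Y(\<omega>(X)) - \<omega>([X,Y])\<close>, evaluated on coordinate fields of the chart at \<open>x\<close>.
\<close>

definition ext_deriv ::
  "'m chart set \<Rightarrow> ('m \<Rightarrow> complex \<Rightarrow> 'v::real_normed_vector) \<Rightarrow> 'm \<Rightarrow> complex \<Rightarrow> complex \<Rightarrow> 'v" where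
  "ext_deriv A \<omega> x X Y =
     (let c = chart_at A x in
        frechet_derivative (\<lambda>z. form_coord A c \<omega> z Y) (at (snd c x)) X
      - frechet_derivative (\<lambda>z. form_coord A c \<omega> z X) (at (snd c x)) Y)"

definition closed_form ::
  "'m chart set \<Rightarrow> ('m \<Rightarrow> complex \<Rightarrow> 'v::real_normed_vector) \<Rightarrow> bool" where
  "closed_form A \<omega> \<longleftrightarrow> (\<forall>x X Y. ext_deriv A \<omega> x X Y = 0)"

definition conformal_linear :: "(complex \<Rightarrow> quat) \<Rightarrow> bool" where
  "conformal_linear T \<longleftrightarrow>
     linear T \<and> inj T \<and> (\<exists>r>0. \<forall>v w. inner (T v) (T w) = r * inner v w)"

definition conformal_forms :: "'m chart set \<Rightarrow> ('m \<Rightarrow> complex \<Rightarrow> quat) set" where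
  "conformal_forms A =
     {\<omega>. smooth_form_on A UNIV \<omega> \<and> (\<forall>x. conformal_linear (\<omega> x) \<and> range (\<omega> x) \<subseteq> Im_quat)}"


section \<open>Spin bundles\<close>

text \<open>
  The total space is the whole type \<open>'l\<close>; its smooth structure is the one induced by the local
  trivialisations \<open>(U, \<tau>)\<close>, where \<open>\<tau>\<close> is the fibre coordinate over \<open>U\<close>.
\<close>

record ('m, 'l) qline_bundle =
  proj :: "'l \<Rightarrow> 'm"
  fadd :: "'l \<Rightarrow> 'l \<Rightarrow> 'l"
  fscale :: "'l \<Rightarrow> quat \<Rightarrow> 'l"
  trivs :: "('m set \<times> ('l \<Rightarrow> quat)) set"

record ('m, 'l) pairing_bundle = "('m, 'l) qline_bundle" +
  pairing :: "'l \<Rightarrow> 'l \<Rightarrow> complex \<Rightarrow> quat"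

text \<open>The vector space axioms hold in every fibre because the trivialisations transport them from the quaternions.\<close>

definition qline_bundle ::
  "'m::topological_space chart set \<Rightarrow> ('m, 'l, 'z) qline_bundle_scheme \<Rightarrow> bool" where
  "qline_bundle A L \<longleftrightarrow>
     (\<forall>a b. proj L a = proj L b \<longrightarrow> proj L (fadd L a b) = proj L a) \<and>
     (\<forall>a q. proj L (fscale L a q) = proj L a) \<and>
     (\<Union>t\<in>trivs L. fst t) = UNIV \<and>
     (\<forall>(U, \<tau>)\<in>trivs L. open U \<and>
        (\<forall>x\<in>U. bij_betw \<tau> {a. proj L a = x} UNIV) \<and>
        (\<forall>a b. proj L a \<in> U \<and> proj L a = proj L b \<longrightarrow> \<tau> (fadd L a b) = \<tau> a + \<tau> b) \<and>
        (\<forall>a q. proj L a \<in> U \<longrightarrow> \<tau> (fscale L a q) = \<tau> a * q)) \<and>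
     (\<forall>(U, \<tau>)\<in>trivs L. \<forall>(V, \<sigma>)\<in>trivs L.
        \<exists>g. smooth_map_on A (U \<inter> V) g \<and>
            (\<forall>a. proj L a \<in> U \<inter> V \<longrightarrow> \<sigma> a = g (proj L a) * \<tau> a))"

definition smooth_section_on ::
  "'m chart set \<Rightarrow> ('m, 'l, 'z) qline_bundle_scheme \<Rightarrow> 'm set \<Rightarrow> ('m \<Rightarrow> 'l) \<Rightarrow> bool" where
  "smooth_section_on A L U s \<longleftrightarrow>
     (\<forall>x\<in>U. proj L (s x) = x) \<and> (\<forall>(V, \<tau>)\<in>trivs L. smooth_map_on A (U \<inter> V) (\<tau> \<circ> s))"

definition sections ::
  "'m chart set \<Rightarrow> ('m, 'l, 'z) qline_bundle_scheme \<Rightarrow> ('m \<Rightarrow> 'l) set" where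
  "sections A L = {s. smooth_section_on A L UNIV s}"

text \<open>\<open>a\<cdot>0\<close> is the zero vector of the fibre through \<open>a\<close>.\<close>

definition fzero :: "('m, 'l, 'z) qline_bundle_scheme \<Rightarrow> 'l \<Rightarrow> bool" where
  "fzero L a \<longleftrightarrow> fscale L a 0 = a"

definition smooth_lform ::
  "'m chart set \<Rightarrow> ('m, 'l, 'z) qline_bundle_scheme \<Rightarrow> ('m \<Rightarrow> complex \<Rightarrow> 'l) \<Rightarrow> bool" where
  "smooth_lform A L \<mu> \<longleftrightarrow>
     (\<forall>x X. proj L (\<mu> x X) = x) \<and>
     (\<forall>(V, \<tau>)\<in>trivs L. smooth_form_on A V (\<lambda>x X. \<tau> (\<mu> x X)))"

definition spin_bundle ::
  "'m::topological_space chart set \<Rightarrow> ('m, 'l, 'z) pairing_bundle_scheme \<Rightarrow> bool" where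
  "spin_bundle A L \<longleftrightarrow>
     qline_bundle A L \<and>
     (\<forall>U s t. open U \<and> smooth_section_on A L U s \<and> smooth_section_on A L U t \<longrightarrow>
        smooth_form_on A U (\<lambda>x. pairing L (s x) (t x))) \<and>
     (\<forall>a b. proj L a = proj L b \<longrightarrow> linear (pairing L a b)) \<and>
     (\<forall>a b c X. proj L a = proj L b \<and> proj L b = proj L c \<longrightarrow>
        pairing L (fadd L a b) c X = pairing L a c X + pairing L b c X \<and>
        pairing L c (fadd L a b) X = pairing L c a X + pairing L c b X) \<and>
     (\<forall>a b \<alpha> \<beta> X. proj L a = proj L b \<longrightarrow>
        pairing L (fscale L a \<alpha>) (fscale L b \<beta>) X = qcnj \<alpha> * pairing L a b X * \<beta>) \<and>
     (\<forall>a b X. proj L a = proj L b \<longrightarrow> qcnj (pairing L a b X) = - pairing L b a X) \<and>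
     (\<forall>a X. \<not> fzero L a \<and> X \<noteq> 0 \<longrightarrow> pairing L a a X \<noteq> 0) \<and>
     (\<forall>a. \<not> fzero L a \<longrightarrow> (\<exists>r>0. \<forall>X. (norm (pairing L a a X))\<^sup>2 = r * (norm X)\<^sup>2))"

definition spin_complex_structure ::
  "'m::topological_space chart set \<Rightarrow> ('m, 'l, 'z) pairing_bundle_scheme \<Rightarrow> ('l \<Rightarrow> 'l) \<Rightarrow> bool" where
  "spin_complex_structure A L J \<longleftrightarrow>
     (\<forall>a. proj L (J a) = proj L a) \<and>
     (\<forall>a b. proj L a = proj L b \<longrightarrow> J (fadd L a b) = fadd L (J a) (J b)) \<and>
     (\<forall>a q. J (fscale L a q) = fscale L (J a) q) \<and>
     (\<forall>U s. open U \<and> smooth_section_on A L U s \<longrightarrow> smooth_section_on A L U (J \<circ> s)) \<and>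
     (\<forall>a. J (J a) = fscale L a (- 1)) \<and>
     (\<forall>a b X. proj L a = proj L b \<longrightarrow>
        pairing L a b (\<i> * X) = pairing L (J a) b X \<and>
        pairing L a b (\<i> * X) = pairing L a (J b) X)"

definition spin_bundle_iso ::
  "'m::topological_space chart set \<Rightarrow> ('m, 'k, 'y) pairing_bundle_scheme \<Rightarrow>
   ('m, 'l, 'z) pairing_bundle_scheme \<Rightarrow> ('k \<Rightarrow> 'l) \<Rightarrow> bool" where
  "spin_bundle_iso A K L \<Phi> \<longleftrightarrow>
     bij \<Phi> \<and>
     (\<forall>a. proj L (\<Phi> a) = proj K a) \<and>
     (\<forall>a b. proj K a = proj K b \<longrightarrow> \<Phi> (fadd K a b) = fadd L (\<Phi> a) (\<Phi> b)) \<and>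
     (\<forall>a q. \<Phi> (fscale K a q) = fscale L (\<Phi> a) q) \<and>
     (\<forall>U s. open U \<longrightarrow> smooth_section_on A K U s = smooth_section_on A L U (\<Phi> \<circ> s)) \<and>
     (\<forall>a b X. proj K a = proj K b \<longrightarrow> pairing L (\<Phi> a) (\<Phi> b) X = pairing K a b X)"


section \<open>Quaternionic holomorphic spin structures\<close>

definition Kbar_forms ::
  "'m chart set \<Rightarrow> ('m, 'l, 'z) qline_bundle_scheme \<Rightarrow> ('l \<Rightarrow> 'l) \<Rightarrow> ('m \<Rightarrow> complex \<Rightarrow> 'l) set" where
  "Kbar_forms A L J =
     {\<mu>. smooth_lform A L \<mu> \<and> (\<forall>x X. \<mu> x (\<i> * X) = fscale L (J (\<mu> x X)) (- 1))}"

definition part01 ::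
  "('m, 'l, 'z) qline_bundle_scheme \<Rightarrow> ('l \<Rightarrow> 'l) \<Rightarrow> ('m \<Rightarrow> complex \<Rightarrow> 'l) \<Rightarrow> 'm \<Rightarrow> complex \<Rightarrow> 'l" where
  "part01 L J \<mu> x X = fscale L (fadd L (\<mu> x X) (J (\<mu> x (\<i> * X)))) (1 / 2)"

definition form_pairing ::
  "('m, 'l, 'z) pairing_bundle_scheme \<Rightarrow> ('m \<Rightarrow> complex \<Rightarrow> 'l) \<Rightarrow> ('m \<Rightarrow> 'l) \<Rightarrow>
   'm \<Rightarrow> complex \<Rightarrow> complex \<Rightarrow> quat" where
  "form_pairing L \<mu> \<phi> x X Y = pairing L (\<mu> x X) (\<phi> x) Y - pairing L (\<mu> x Y) (\<phi> x) X"

definition pairing_form ::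
  "('m, 'l, 'z) pairing_bundle_scheme \<Rightarrow> ('m \<Rightarrow> 'l) \<Rightarrow> ('m \<Rightarrow> complex \<Rightarrow> 'l) \<Rightarrow>
   'm \<Rightarrow> complex \<Rightarrow> complex \<Rightarrow> quat" where
  "pairing_form L \<psi> \<mu> x X Y = pairing L (\<psi> x) (\<mu> x X) Y - pairing L (\<psi> x) (\<mu> x Y) X"

text \<open>Operators \<open>D\<close> are only meaningful, and only constrained, on smooth sections.\<close>

definition qh_spin_structure ::
  "'m chart set \<Rightarrow> ('m, 'l, 'z) pairing_bundle_scheme \<Rightarrow> ('l \<Rightarrow> 'l) \<Rightarrow>
   (('m \<Rightarrow> 'l) \<Rightarrow> 'm \<Rightarrow> complex \<Rightarrow> 'l) \<Rightarrow> bool" where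
  "qh_spin_structure A L J D \<longleftrightarrow>
     (\<forall>\<psi>\<in>sections A L. D \<psi> \<in> Kbar_forms A L J) \<and>
     (\<forall>\<psi>\<in>sections A L. \<forall>\<phi>\<in>sections A L. \<forall>x X.
        D (\<lambda>x. fadd L (\<psi> x) (\<phi> x)) x X = fadd L (D \<psi> x X) (D \<phi> x X)) \<and>
     (\<forall>\<psi>\<in>sections A L. \<forall>r::real. \<forall>x X.
        D (\<lambda>x. fscale L (\<psi> x) (of_real r)) x X = fscale L (D \<psi> x X) (of_real r)) \<and>
     (\<forall>\<psi>\<in>sections A L. \<forall>q. smooth_map_on A UNIV q \<longrightarrow> (\<forall>x X.
        D (\<lambda>x. fscale L (\<psi> x) (q x)) x X =
        fadd L (fscale L (D \<psi> x X) (q x))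
               (part01 L J (\<lambda>x X. fscale L (\<psi> x) (differential A q x X)) x X))) \<and>
     (\<forall>\<psi>\<in>sections A L. \<forall>\<phi>\<in>sections A L. \<forall>x X Y.
        ext_deriv A (\<lambda>x. pairing L (\<psi> x) (\<phi> x)) x X Y =
        form_pairing L (D \<psi>) \<phi> x X Y + pairing_form L \<psi> (D \<phi>) x X Y)"

definition dirac_structure ::
  "'m chart set \<Rightarrow> ('m, 'l, 'z) pairing_bundle_scheme \<Rightarrow> ('l \<Rightarrow> 'l) \<Rightarrow>
   (('m \<Rightarrow> 'l) \<Rightarrow> 'm \<Rightarrow> complex \<Rightarrow> 'l) \<Rightarrow> bool" where
  "dirac_structure A L J D \<longleftrightarrow>
     qh_spin_structure A L J D \<and>
     (\<forall>\<psi>\<in>sections A L. \<forall>x X. D (J \<circ> \<psi>) x X = J (D \<psi> x X))"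

text \<open>\<open>dirac_potential L J dbar H \<psi>\<close> is the operator \<open>dbar + \<onehalf> H J\<psi>(\<psi>,\<cdot>)\<close>.\<close>

definition dirac_potential ::
  "('m, 'l, 'z) pairing_bundle_scheme \<Rightarrow> ('l \<Rightarrow> 'l) \<Rightarrow> (('m \<Rightarrow> 'l) \<Rightarrow> 'm \<Rightarrow> complex \<Rightarrow> 'l) \<Rightarrow>
   ('m \<Rightarrow> real) \<Rightarrow> ('m \<Rightarrow> 'l) \<Rightarrow> ('m \<Rightarrow> 'l) \<Rightarrow> 'm \<Rightarrow> complex \<Rightarrow> 'l" where
  "dirac_potential L J dbar H \<psi> \<phi> x X =
     fadd L (dbar \<phi> x X) (fscale L (J (\<psi> x)) ((H x / 2) *\<^sub>R pairing L (\<psi> x) (\<phi> x) X))"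

definition nonlinear_dirac_equation ::
  "('m, 'l, 'z) pairing_bundle_scheme \<Rightarrow> ('l \<Rightarrow> 'l) \<Rightarrow> (('m \<Rightarrow> 'l) \<Rightarrow> 'm \<Rightarrow> complex \<Rightarrow> 'l) \<Rightarrow>
   ('m \<Rightarrow> real) \<Rightarrow> ('m \<Rightarrow> 'l) \<Rightarrow> bool" where
  "nonlinear_dirac_equation L J dbar H \<psi> \<longleftrightarrow>
     (\<forall>x X. fzero L (dirac_potential L J dbar H \<psi> \<psi> x X))"


section \<open>Conformal immersions with translation periods\<close>

definition universal_cover :: "('u::topological_space \<Rightarrow> 'm::topological_space) \<Rightarrow> bool" where
  "universal_cover p \<longleftrightarrow> covering_space UNIV p UNIV \<and> simply_connected (UNIV :: 'u set)"

definition cover_atlas :: "'m chart set \<Rightarrow> ('u::topological_space \<Rightarrow> 'm) \<Rightarrow> 'u chart set" where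
  "cover_atlas A p = {(V, snd c \<circ> p) | V c. c \<in> A \<and> open V \<and> inj_on p V \<and> p ` V \<subseteq> fst c}"

definition deck_transformation :: "('u::topological_space \<Rightarrow> 'm) \<Rightarrow> ('u \<Rightarrow> 'u) \<Rightarrow> bool" where
  "deck_transformation p \<gamma> \<longleftrightarrow> (\<exists>\<gamma>'. homeomorphism UNIV UNIV \<gamma> \<gamma>') \<and> p \<circ> \<gamma> = p"

definition conformal_immersion_with_periods ::
  "'m chart set \<Rightarrow> ('u::topological_space \<Rightarrow> 'm) \<Rightarrow> ('u \<Rightarrow> quat) \<Rightarrow> bool" where
  "conformal_immersion_with_periods A p f \<longleftrightarrow>
     range f \<subseteq> Im_quat \<and>
     smooth_map_on (cover_atlas A p) UNIV f \<and>
     (\<forall>y. conformal_linear (differential (cover_atlas A p) f y)) \<and>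
     (\<forall>\<gamma>. deck_transformation p \<gamma> \<longrightarrow> (\<exists>c. \<forall>y. f (\<gamma> y) - f y = c))"

definition pullback_form ::
  "'m chart set \<Rightarrow> ('u::topological_space \<Rightarrow> 'm) \<Rightarrow> ('m \<Rightarrow> complex \<Rightarrow> 'v) \<Rightarrow> 'u \<Rightarrow> complex \<Rightarrow> 'v" where
  "pullback_form A p \<omega> y X = \<omega> (p y) (tangent_map (cover_atlas A p) A p y X)"

text \<open>\<open>df\<close> as a 1-form on \<open>M\<close>; the value is independent of \<open>y\<close> if \<open>f\<close> has translation periods.\<close>

definition descended_differential ::
  "'m chart set \<Rightarrow> ('u::topological_space \<Rightarrow> 'm) \<Rightarrow> ('u \<Rightarrow> quat) \<Rightarrow> 'm \<Rightarrow> complex \<Rightarrow> quat" where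
  "descended_differential A p f x X =
     (THE q. \<exists>y Y. p y = x \<and> tangent_map (cover_atlas A p) A p y Y = X \<and>
                   q = differential (cover_atlas A p) f y Y)"

text \<open>The equation \<open>*df = N df\<close> selects one of the two unit normals by the orientation of \<open>M\<close>.\<close>

definition gauss_normal_map ::
  "'m chart set \<Rightarrow> ('u::topological_space \<Rightarrow> 'm) \<Rightarrow> ('u \<Rightarrow> quat) \<Rightarrow> ('m \<Rightarrow> quat) \<Rightarrow> bool" where
  "gauss_normal_map A p f N \<longleftrightarrow>
     smooth_map_on A UNIV N \<and>
     (\<forall>x. N x \<in> Im_quat \<and> norm (N x) = 1) \<and>
     (\<forall>y X. let df = differential (cover_atlas A p) f y in
        inner (N (p y)) (df X) = 0 \<and>
        df (\<i> * X) = N (p y) * df X \<and>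
        df (\<i> * X) = - (df X * N (p y)))"

definition induced_bundle ::
  "'m chart set \<Rightarrow> ('u::topological_space \<Rightarrow> 'm) \<Rightarrow> ('u \<Rightarrow> quat) \<Rightarrow> ('m, 'm \<times> quat) pairing_bundle" where
  "induced_bundle A p f =
     \<lparr> proj = fst,
       fadd = (\<lambda>a b. (fst a, snd a + snd b)),
       fscale = (\<lambda>a q. (fst a, snd a * q)),
       trivs = {(UNIV, snd)},
       pairing = (\<lambda>a b X. qcnj (snd a) * descended_differential A p f (fst a) X * snd b) \<rparr>"

definition induced_J :: "('m \<Rightarrow> quat) \<Rightarrow> 'm \<times> quat \<Rightarrow> 'm \<times> quat" where
  "induced_J N a = (fst a, - (N (fst a) * snd a))"

definition induced_structure ::
  "'m chart set \<Rightarrow> ('u::topological_space \<Rightarrow> 'm) \<Rightarrow> ('u \<Rightarrow> quat) \<Rightarrow> ('m \<Rightarrow> quat) \<Rightarrow>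
   ('m \<Rightarrow> 'm \<times> quat) \<Rightarrow> 'm \<Rightarrow> complex \<Rightarrow> 'm \<times> quat" where
  "induced_structure A p f N \<phi> =
     part01 (induced_bundle A p f) (induced_J N) (\<lambda>x X. (x, differential A (snd \<circ> \<phi>) x X))"

text \<open>
  In the following, \<open>f\<close> is an immersion of a surface with atlas \<open>B\<close> and \<open>n\<close> a unit normal field of \<open>f\<close>.
  The sign of the shape operator \<open>S\<close> is fixed by \<open>dn = - df \<circ> S\<close>.
\<close>

definition first_fundamental_form ::
  "'u chart set \<Rightarrow> ('u \<Rightarrow> quat) \<Rightarrow> 'u \<Rightarrow> complex \<Rightarrow> complex \<Rightarrow> real" where
  "first_fundamental_form B f y X Y = inner (differential B f y X) (differential B f y Y)"

definition second_fundamental_form ::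
  "'u chart set \<Rightarrow> ('u \<Rightarrow> quat) \<Rightarrow> ('u \<Rightarrow> quat) \<Rightarrow> 'u \<Rightarrow> complex \<Rightarrow> complex \<Rightarrow> real" where
  "second_fundamental_form B f n y X Y = - inner (differential B n y X) (differential B f y Y)"

definition shape_operator ::
  "'u chart set \<Rightarrow> ('u \<Rightarrow> quat) \<Rightarrow> ('u \<Rightarrow> quat) \<Rightarrow> 'u \<Rightarrow> complex \<Rightarrow> complex" where
  "shape_operator B f n y =
     (THE S. linear S \<and>
        (\<forall>X Y. first_fundamental_form B f y (S X) Y = second_fundamental_form B f n y X Y))"

definition mean_curvature ::
  "'u chart set \<Rightarrow> ('u \<Rightarrow> quat) \<Rightarrow> ('u \<Rightarrow> quat) \<Rightarrow> 'u \<Rightarrow> real" where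
  "mean_curvature B f n y = (\<Sum>b\<in>Basis. inner (shape_operator B f n y b) b) / 2"

end

theory Submission
  imports Defs "HOL-Complex_Analysis.Complex_Analysis"
begin

text \<open>
  The section \<open>\<psi>\<close> is a global frame, so every section is \<open>\<psi> b\<close> with a quaternion valued function \<open>b\<close>.
  Write \<open>\<omega> = (\<psi>,\<psi>)\<close>, \<open>J\<psi> = -\<psi>N\<close> and \<open>dbar \<psi> = \<psi>\<alpha>\<close>; then \<open>*\<omega> = N\<omega> = -\<omega>N\<close> and \<open>*\<alpha> = N\<alpha>\<close>, and
  \<open>d\<omega>(X, *X)\<close> is four times the imaginary part of \<open>qcnj (\<alpha> X) N \<omega>(X)\<close>. It vanishes if and only if
  \<open>\<alpha> = \<onehalf> H N \<omega>\<close> with a real function \<open>H\<close>, which is the nonlinear Dirac equation.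
  The closed form \<open>\<omega>\<close> is integrated on the universal cover by continuing local primitives along paths
  and homotopies. In the frame \<open>\<psi>\<close> the operator \<open>dbar + \<onehalf> H J\<psi>(\<psi>,\<cdot>)\<close> annihilates \<open>\<psi>\<close> and hence becomes
  \<open>d\<^sup>0\<^sup>1\<close>. Finally \<open>dbar (J\<psi>) = J dbar \<psi>\<close> reads \<open>dN - N *dN = -2 H \<omega>\<close>, and the trace of this identity
  is the mean curvature.
\<close>

subsection \<open>Primitives on simply connected spaces\<close>

text \<open>One tangent vector per point suffices to compare \<alpha> with N\<omega>, because both
  forms are multiplied by N from the left when their argument is multiplied by \<i>. For u =
  N\<omega>(X), which is nonzero, the product qcnj a * u is real exactly when a is a real multiple
  of u; the function H is this multiple, doubled. The factor 1/2 is the normalisation that makes H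
  the mean curvature: comparing dbar (J\<psi>) with J dbar \<psi> gives 1/2 (dN - N *dN) = N\<alpha>
  - \<alpha>N, and for \<alpha> = 1/2 H N\<omega> the right-hand side is -H\<omega>, since N and
  \<omega> anticommute. Closedness yields H; it is the commutation of dbar with J that gives H its
  geometric meaning. Operators with the same Leibniz rule that agree on a frame agree on all
  sections, which is why annihilating \<psi> identifies the operator with potential. On M a closed
  form has only local primitives, determined up to constants; hence the object that is continued is
  a family of functions with locally constant differences.\<close>

lemma simply_connected_imp_path:
  fixes x y :: "'u::topological_space"
  assumes "simply_connected (UNIV :: 'u set)"
  shows "\<exists>\<gamma>. path \<gamma> \<and> pathstart \<gamma> = x \<and> pathfinish \<gamma> = y"
proof -
  \<comment> \<open>\<open>simply_connected\<close> makes any two loops freely homotopic, in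
    particular the constant loops at \<open>x\<close> and \<open>y\<close>; the track of the base
    point during this homotopy is the path.\<close>
  have "homotopic_loops UNIV (\<lambda>t::real. x) (\<lambda>t. y)"
    using assms unfolding simply_connected_def
    by (simp add: pathfinish_def pathstart_def path_def)
  then obtain h :: "real \<times> real \<Rightarrow> 'u" where h: "continuous_on ({0..1} \<times> {0..1}) h"
    "\<forall>t\<in>{0..1}. h (0, t) = x" "\<forall>t\<in>{0..1}. h (1, t) = y"
    unfolding homotopic_loops by blast
  have "path (\<lambda>s. h (s, 0))"
    unfolding path_def
    by (rule continuous_on_compose2[OF h(1)]) (auto intro!: continuous_intros)
  then show ?thesis using h(2,3) by (auto simp: pathstart_def pathfinish_def)
qed

text \<open>The members of \<open>\<G>\<close> stand for local primitives of one closed form. Only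
  their values up to locally constant errors matter, and no derivative occurs, so that merely
  continuous paths and homotopies can be treated.\<close>

locale primitive_system =
  fixes \<G> :: "('u::topological_space set \<times> ('u \<Rightarrow> 'v::ab_group_add)) set"
  assumes open_dom: "(V, g) \<in> \<G> \<Longrightarrow> open V"
    and covers: "\<exists>V g. (V, g) \<in> \<G> \<and> x \<in> V"
    and compatible: "(V, g) \<in> \<G> \<Longrightarrow> (V', g') \<in> \<G> \<Longrightarrow> x \<in> V \<Longrightarrow> x \<in> V' \<Longrightarrow>
      \<exists>W k. open W \<and> x \<in> W \<and> (\<forall>y\<in>W. g y = g' y + k)"
begin

text \<open>A primitive of the form pulled back by \<open>h\<close>, meaningful without
  differentiating \<open>h\<close>. For continuous \<open>h\<close> one local function around each
  point would suffice, by \<open>compatible\<close>; quantifying over all of them spares that change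
  in every later use.\<close>

definition lifts :: "('a::topological_space \<Rightarrow> 'u) \<Rightarrow> 'a set \<Rightarrow> ('a \<Rightarrow> 'v) \<Rightarrow> bool" where
  "lifts h S F \<longleftrightarrow> (\<forall>x\<in>S. \<forall>V g. (V, g) \<in> \<G> \<longrightarrow> h x \<in> V \<longrightarrow>
     (\<exists>W k. open W \<and> x \<in> W \<and> (\<forall>y\<in>W \<inter> S. F y = g (h y) + k)))"

lemma liftsD:
  assumes "lifts h S F" "x \<in> S" "(V, g) \<in> \<G>" "h x \<in> V"
  obtains W k where "open W" "x \<in> W" "\<And>y. y \<in> W \<Longrightarrow> y \<in> S \<Longrightarrow> F y = g (h y) + k"
  using assms unfolding lifts_def by (metis IntI)

lemma liftsI:
  assumes "\<And>x V g. x \<in> S \<Longrightarrow> (V, g) \<in> \<G> \<Longrightarrow> h x \<in> V \<Longrightarrow>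
    \<exists>W k. open W \<and> x \<in> W \<and> (\<forall>y\<in>W \<inter> S. F y = g (h y) + k)"
  shows "lifts h S F"
  using assms unfolding lifts_def by blast

lemma lifts_subset:
  assumes "lifts h S F" "T \<subseteq> S"
  shows "lifts h T F"
proof (rule liftsI)
  fix x V g assume *: "x \<in> T" "(V, g) \<in> \<G>" "h x \<in> V"
  then have "x \<in> S" using assms(2) by blast
  from liftsD[OF assms(1) this *(2,3)]
  show "\<exists>W k. open W \<and> x \<in> W \<and> (\<forall>y\<in>W \<inter> T. F y = g (h y) + k)"
    by (metis IntE assms(2) subsetD)
qed

lemma lifts_cong:
  assumes "lifts h S F" "\<And>x. x \<in> S \<Longrightarrow> h x = h' x" "\<And>x. x \<in> S \<Longrightarrow> F x = F' x"
  shows "lifts h' S F'"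
proof (rule liftsI)
  fix x V g assume *: "x \<in> S" "(V, g) \<in> \<G>" "h' x \<in> V"
  then have "h x \<in> V" using assms(2) by simp
  from liftsD[OF assms(1) *(1,2) this]
  show "\<exists>W k. open W \<and> x \<in> W \<and> (\<forall>y\<in>W \<inter> S. F' y = g (h' y) + k)"
    by (metis IntE assms(2,3))
qed

lemma lifts_add_const:
  assumes "lifts h S F"
  shows "lifts h S (\<lambda>x. F x + k)"
proof (rule liftsI)
  fix x V g assume *: "x \<in> S" "(V, g) \<in> \<G>" "h x \<in> V"
  from liftsD[OF assms *] show "\<exists>W k'. open W \<and> x \<in> W \<and> (\<forall>y\<in>W \<inter> S. F y + k = g (h y) + k')"
    by (metis IntE add.assoc)
qed

lemma lifts_compose:
  assumes "lifts h S F" "continuous_on T \<phi>" "\<phi> ` T \<subseteq> S"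
  shows "lifts (\<lambda>x. h (\<phi> x)) T (\<lambda>x. F (\<phi> x))"
proof (rule liftsI)
  fix x V g assume *: "x \<in> T" "(V, g) \<in> \<G>" "h (\<phi> x) \<in> V"
  obtain W k where W: "open W" "\<phi> x \<in> W" "\<And>y. y \<in> W \<Longrightarrow> y \<in> S \<Longrightarrow> F y = g (h y) + k"
    using liftsD[OF assms(1) _ *(2,3)] * assms(3) by blast
  obtain W' where "open W'" "W' \<inter> T = \<phi> -` W \<inter> T"
    using assms(2) W(1) unfolding continuous_on_open_invariant by blast
  then show "\<exists>W k. open W \<and> x \<in> W \<and> (\<forall>y\<in>W \<inter> T. F (\<phi> y) = g (h (\<phi> y)) + k)"
    using W(2,3) *(1) assms(3) by (intro exI[of _ W'] exI[of _ k]) blast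
qed

lemma lifts_unique:
  assumes "lifts h S F" "lifts h S F'" "connected S" "a \<in> S" "b \<in> S"
  shows "F b - F' b = F a - F' a"
proof -
  have "F a - F' a = F b - F' b"
  proof (rule connected_local_const[OF assms(3-5), of "\<lambda>x. F x - F' x"], intro ballI)
    fix x assume x: "x \<in> S"
    obtain V g where Vg: "(V, g) \<in> \<G>" "h x \<in> V" using covers by blast
    obtain W k where W: "open W" "x \<in> W" "\<And>y. y \<in> W \<Longrightarrow> y \<in> S \<Longrightarrow> F y = g (h y) + k"
      using liftsD[OF assms(1) x Vg] by blast
    obtain W' k' where W': "open W'" "x \<in> W'" "\<And>y. y \<in> W' \<Longrightarrow> y \<in> S \<Longrightarrow> F' y = g (h y) + k'"
      using liftsD[OF assms(2) x Vg] by blast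
    show "\<forall>\<^sub>F y in at x within S. F x - F' x = F y - F' y"
      unfolding eventually_at_topological
      by (rule exI[of _ "W \<inter> W'"]) (use W W' x in auto)
  qed
  then show ?thesis by simp
qed

lemma lifts_local:
  assumes "(V, g) \<in> \<G>" "continuous_on S h" "h ` S \<subseteq> V"
  shows "lifts h S (\<lambda>x. g (h x))"
proof (rule liftsI)
  fix x V' g' assume *: "x \<in> S" "(V', g') \<in> \<G>" "h x \<in> V'"
  have "h x \<in> V" using assms(3) *(1) by blast
  from compatible[OF assms(1) *(2) this *(3)]
  obtain W k where W: "open W" "h x \<in> W" "\<forall>y\<in>W. g y = g' y + k" by (elim exE conjE)
  obtain W' where W': "open W'" "W' \<inter> S = h -` W \<inter> S"
    using assms(2) W(1) unfolding continuous_on_open_invariant by blast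
  show "\<exists>W k. open W \<and> x \<in> W \<and> (\<forall>y\<in>W \<inter> S. g (h y) = g' (h y) + k)"
  proof (intro exI[of _ W'] exI[of _ k] conjI ballI)
    show "x \<in> W'" using W'(2) W(2) *(1) by blast
    show "g (h y) = g' (h y) + k" if "y \<in> W' \<inter> S" for y
      using that W'(2) by (intro bspec[OF W(3)]) blast
  qed (rule W')
qed

text \<open>On the connected overlap the lifts differ by a single constant, which is absorbed into
  the second one. A point outside one of the closed pieces has a neighbourhood that avoids this
  piece.\<close>

lemma lifts_glue:
  assumes F1: "lifts h S1 F1" and F2: "lifts h S2 F2"
    and cl: "closed S1" "closed S2" and conn: "connected (S1 \<inter> S2)"
  shows "\<exists>F. lifts h (S1 \<union> S2) F"
proof -
  obtain k where k: "\<And>x. x \<in> S1 \<inter> S2 \<Longrightarrow> F1 x = F2 x + k"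
  proof (cases "S1 \<inter> S2 = {}")
    case False
    then obtain a where a: "a \<in> S1 \<inter> S2" by blast
    have "F1 x = F2 x + (F1 a - F2 a)" if "x \<in> S1 \<inter> S2" for x
      using lifts_unique[OF lifts_subset[OF F1] lifts_subset[OF F2] conn a that]
      by (simp add: algebra_simps)
    then show ?thesis using that by blast
  qed (use that in blast)
  define F where "F x = (if x \<in> S1 then F1 x else F2 x + k)" for x
  have L1: "lifts h S1 F" using F1 by (rule lifts_cong) (auto simp: F_def)
  have L2: "lifts h S2 F"
    using lifts_add_const[OF F2, of k] by (rule lifts_cong) (use k in \<open>auto simp: F_def\<close>)
  \<comment> \<open>The constant \<open>F x - g (h x)\<close> does not depend on \<open>S\<close>,
    so the neighbourhoods found for the two pieces come with the same constant.\<close>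
  have part: "\<exists>W. open W \<and> x \<in> W \<and> (\<forall>y\<in>W \<inter> S. F y = g (h y) + (F x - g (h x)))"
    if L: "lifts h S F" and "closed S" and Vg: "(V, g) \<in> \<G>" "h x \<in> V" for S x V g
  proof (cases "x \<in> S")
    case True
    obtain W k' where W: "open W" "x \<in> W" "\<And>y. y \<in> W \<Longrightarrow> y \<in> S \<Longrightarrow> F y = g (h y) + k'"
      using liftsD[OF L True Vg] by blast
    then have "k' = F x - g (h x)" using True by simp
    with W show ?thesis by blast
  next
    case False
    then show ?thesis using \<open>closed S\<close> by (intro exI[of _ "- S"]) auto
  qed
  have "lifts h (S1 \<union> S2) F"
  proof (rule liftsI)
    fix x V g assume *: "x \<in> S1 \<union> S2" "(V, g) \<in> \<G>" "h x \<in> V"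
    obtain W1 where "open W1" "x \<in> W1" "\<forall>y\<in>W1 \<inter> S1. F y = g (h y) + (F x - g (h x))"
      using part[OF L1 cl(1) *(2,3)] by blast
    moreover obtain W2 where "open W2" "x \<in> W2" "\<forall>y\<in>W2 \<inter> S2. F y = g (h y) + (F x - g (h x))"
      using part[OF L2 cl(2) *(2,3)] by blast
    ultimately show "\<exists>W k. open W \<and> x \<in> W \<and> (\<forall>y\<in>W \<inter> (S1 \<union> S2). F y = g (h y) + k)"
      by (intro exI[of _ "W1 \<inter> W2"] exI[of _ "F x - g (h x)"] conjI ballI open_Int IntI) (assumption | blast)+
  qed
  then show ?thesis by blast
qed

text \<open>Small boxes are mapped into the domain of one local function, and lifts on the two
  halves of a box are glued along their convex common face. A division that is fine for a gauge of
  such small neighbourhoods carries this over to the whole box.\<close>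

lemma lifts_exists_cbox:
  fixes h :: "'a::euclidean_space \<Rightarrow> 'u"
  assumes h: "continuous_on (cbox a b) h" and ne: "box a b \<noteq> {}"
  shows "\<exists>F. lifts h (cbox a b) F"
proof -
  \<comment> \<open>An \<open>operative\<close> function must send degenerate boxes to the neutral
    element \<open>True\<close>, hence the alternative of an empty interior; \<open>ne\<close>
    excludes it at the end.\<close>
  define P where "P S \<longleftrightarrow> interior S = {} \<or> (\<exists>F. lifts h S F)" for S
  interpret operative conj True P
  proof
    fix a b :: 'a
    show "P (cbox a b) = True" if "box a b = {}"
      using that by (simp add: P_def)
  next
    fix a b k :: 'a and c :: real
    assume k: "k \<in> Basis"
    let ?l = "cbox a b \<inter> {x. x \<bullet> k \<le> c}" and ?r = "cbox a b \<inter> {x. c \<le> x \<bullet> k}"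
    have U: "cbox a b = ?l \<union> ?r" by auto
    show "P (cbox a b) = (P ?l \<and> P ?r)"
    proof (cases "box a b = {}")
      case True
      then have "interior (cbox a b) = {}" by simp
      then have "interior ?l = {}" "interior ?r = {}"
        by (metis Int_lower1 interior_mono subset_empty)+
      with True show ?thesis by (simp add: P_def)
    next
      case False
      then have ab: "a \<bullet> i < b \<bullet> i" if "i \<in> Basis" for i using that by (auto simp: box_ne_empty)
      \<comment> \<open>A proper half must have interior points for \<open>P\<close> to provide an
        actual lift on it. The witness has coordinate \<open>t\<close> in direction \<open>k\<close>
        and the midpoint in every other direction.\<close>
      have half: "interior ?l \<noteq> {}" if ac: "a \<bullet> k < c"
      proof -
        obtain t where t: "a \<bullet> k < t" "t < c" "t < b \<bullet> k" 
          using dense[of "a \<bullet> k" "min c (b \<bullet> k)"] ac ab[OF k] by auto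
        have "(\<Sum>i\<in>Basis. (if i = k then t else (a \<bullet> i + b \<bullet> i) / 2) *\<^sub>R i)
            \<in> box a b \<inter> {x. x \<bullet> k < c}" (is "?m \<in> _")
          using t ab k by (auto simp: mem_box)
        moreover have op: "open (box a b \<inter> {x. x \<bullet> k < c})"
          by (intro open_Int open_box open_halfspace_component_lt)
        moreover have sub: "box a b \<inter> {x. x \<bullet> k < c} \<subseteq> ?l" using box_subset_cbox by force
        ultimately show ?thesis using interior_maximal[OF sub op] by blast
      qed
      have half': "interior ?r \<noteq> {}" if cb: "c < b \<bullet> k"
      proof -
        obtain t where t: "a \<bullet> k < t" "c < t" "t < b \<bullet> k" 
          using dense[of "max c (a \<bullet> k)" "b \<bullet> k"] cb ab[OF k] by auto
        have "(\<Sum>i\<in>Basis. (if i = k then t else (a \<bullet> i + b \<bullet> i) / 2) *\<^sub>R i)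
            \<in> box a b \<inter> {x. c < x \<bullet> k}" (is "?m \<in> _")
          using t ab k by (auto simp: mem_box)
        moreover have op: "open (box a b \<inter> {x. c < x \<bullet> k})"
          by (intro open_Int open_box open_halfspace_component_gt)
        moreover have sub: "box a b \<inter> {x. c < x \<bullet> k} \<subseteq> ?r" using box_subset_cbox by force
        ultimately show ?thesis using interior_maximal[OF sub op] by blast
      qed
      show ?thesis
      proof
        assume "P (cbox a b)"
        then obtain F where F: "lifts h (cbox a b) F" using False by (auto simp: P_def)
        then show "P ?l \<and> P ?r"
          unfolding P_def by (metis Int_lower1 lifts_subset)
      next
        assume lr: "P ?l \<and> P ?r"
        consider "c \<le> a \<bullet> k" | "b \<bullet> k \<le> c" | "a \<bullet> k < c" "c < b \<bullet> k" by linarith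
        then show "P (cbox a b)"
        proof cases
          case 1
          then have "?r = cbox a b" using k by (force simp: mem_box)
          with lr show ?thesis by simp
        next
          case 2
          then have "?l = cbox a b" using k by (force simp: mem_box)
          with lr show ?thesis by simp
        next
          case 3
          with half half' lr obtain F1 F2 where "lifts h ?l F1" "lifts h ?r F2"
            by (auto simp: P_def)
          moreover have "closed ?l" "closed ?r"
            by (auto intro!: closed_Int closed_halfspace_component_le closed_halfspace_component_ge)
          moreover have "convex (?l \<inter> ?r)"
            using convex_halfspace_le[of k c] convex_halfspace_ge[of c k]
            by (intro convex_Int convex_box(1)) (auto simp: inner_commute)
          then have "connected (?l \<inter> ?r)" by (rule convex_connected)
          ultimately have "\<exists>F. lifts h (?l \<union> ?r) F" by (rule lifts_glue)
          then show ?thesis using U by (simp add: P_def)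
        qed
      qed
    qed
  qed
  have "\<exists>W. open W \<and> x \<in> W \<and> (\<forall>S. S \<subseteq> W \<inter> cbox a b \<longrightarrow> P S)" for x
  proof (cases "x \<in> cbox a b")
    case True
    obtain V g where Vg: "(V, g) \<in> \<G>" "h x \<in> V" using covers by blast
    obtain W where W: "open W" "W \<inter> cbox a b = h -` V \<inter> cbox a b"
      using h open_dom[OF Vg(1)] unfolding continuous_on_open_invariant by blast
    have "P S" if "S \<subseteq> W \<inter> cbox a b" for S
    proof -
      have "continuous_on S h" "h ` S \<subseteq> V" using that W h continuous_on_subset by blast+
      from lifts_local[OF Vg(1) this] show ?thesis by (auto simp: P_def)
    qed
    then show ?thesis using W True Vg by (intro exI[of _ W]) auto
  next
    case False
    have "P {}" by (simp add: P_def)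
    then show ?thesis using False by (intro exI[of _ "- cbox a b"]) auto
  qed
  then obtain W where W: "\<And>x. open (W x)" "\<And>x. x \<in> W x" "\<And>x S. S \<subseteq> W x \<inter> cbox a b \<Longrightarrow> P S"
    by metis
  have "gauge W" using W unfolding gauge_def by auto
  then obtain p where p: "p tagged_division_of cbox a b" "W fine p"
    by (rule fine_division_exists)
  have "P i" if "i \<in> snd ` p" for i
  proof -
    obtain x where x: "(x, i) \<in> p" using \<open>i \<in> snd ` p\<close> by auto
    have "i \<subseteq> W x" using p(2) x by (rule fineD)
    moreover have "i \<subseteq> cbox a b" using p(1) x by (rule tagged_division_ofD(3))
    ultimately show ?thesis using W(3) by blast
  qed
  moreover have "snd ` p division_of cbox a b" using p(1) by (rule division_of_tagged_division)
  ultimately have "P (cbox a b)"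
    using local.division[of "snd ` p" a b] by (simp add: comm_monoid_set_F_and)
  then show ?thesis using ne by (simp add: P_def)
qed

section \<open>Integration along continuous paths\<close>

definition path_lift :: "(real \<Rightarrow> 'u) \<Rightarrow> real \<Rightarrow> 'v" where
  "path_lift \<gamma> = (SOME F. lifts \<gamma> {0..1} F)"

text \<open>The integral of the underlying closed form along \<open>\<gamma>\<close>, as the
  increment of a lift; \<open>lifts_unique\<close> makes it independent of the lift
  selected.\<close>

definition path_int :: "(real \<Rightarrow> 'u) \<Rightarrow> 'v" where
  "path_int \<gamma> = path_lift \<gamma> 1 - path_lift \<gamma> 0"

lemma path_int_eq:
  assumes "lifts \<gamma> {0..1} F"
  shows "path_int \<gamma> = F 1 - F 0"
proof -
  have "lifts \<gamma> {0..1} (path_lift \<gamma>)" unfolding path_lift_def by (rule someI[of "lifts \<gamma> {0..1}", OF assms])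
  from lifts_unique[OF this assms, of 0 1] show ?thesis
    by (simp add: path_int_def algebra_simps)
qed

lemma path_lifts_exists: "path \<gamma> \<Longrightarrow> \<exists>F. lifts \<gamma> {0..1} F"
  using lifts_exists_cbox[of 0 1 \<gamma>] by (auto simp: path_def)

lemma path_int_join:
  assumes "path \<gamma>1" "path \<gamma>2" "pathfinish \<gamma>1 = pathstart \<gamma>2"
  shows "path_int (\<gamma>1 +++ \<gamma>2) = path_int \<gamma>1 + path_int \<gamma>2"
proof -
  obtain F where F: "lifts (\<gamma>1 +++ \<gamma>2) {0..1} F" using path_lifts_exists assms by (meson path_join_imp)
  have "lifts (\<lambda>t. (\<gamma>1 +++ \<gamma>2) (t / 2)) {0..1} (\<lambda>t. F (t / 2))"
    by (rule lifts_compose[OF F]) (auto intro!: continuous_intros)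
  then have "lifts \<gamma>1 {0..1} (\<lambda>t. F (t / 2))"
    by (rule lifts_cong) (auto simp: joinpaths_def)
  then have 1: "path_int \<gamma>1 = F (1 / 2) - F 0" using path_int_eq by fastforce
  have "lifts (\<lambda>t. (\<gamma>1 +++ \<gamma>2) ((t + 1) / 2)) {0..1} (\<lambda>t. F ((t + 1) / 2))"
    by (rule lifts_compose[OF F]) (auto intro!: continuous_intros)
  then have "lifts \<gamma>2 {0..1} (\<lambda>t. F ((t + 1) / 2))"
    by (rule lifts_cong) (use assms(3) in \<open>auto simp: joinpaths_def pathfinish_def pathstart_def add_divide_distrib\<close>)
  then have 2: "path_int \<gamma>2 = F 1 - F (1 / 2)" using path_int_eq by fastforce
  show ?thesis using path_int_eq[OF F] 1 2 by simp
qed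

lemma path_int_reverse:
  assumes "path \<gamma>"
  shows "path_int (reversepath \<gamma>) = - path_int \<gamma>"
proof -
  obtain F where F: "lifts \<gamma> {0..1} F" using path_lifts_exists assms by blast
  have "lifts (\<lambda>t. \<gamma> (1 - t)) {0..1} (\<lambda>t. F (1 - t))"
    by (rule lifts_compose[OF F]) (auto intro!: continuous_intros)
  then have "path_int (reversepath \<gamma>) = F 0 - F 1"
    using path_int_eq[of "reversepath \<gamma>"] unfolding reversepath_def by fastforce
  then show ?thesis using path_int_eq[OF F] by simp
qed

lemma path_int_local:
  assumes "(V, g) \<in> \<G>" "path \<gamma>" "path_image \<gamma> \<subseteq> V"
  shows "path_int \<gamma> = g (pathfinish \<gamma>) - g (pathstart \<gamma>)"
  using path_int_eq[OF lifts_local[of V g "{0..1}" \<gamma>]] assms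
  by (simp add: path_def path_image_def pathfinish_def pathstart_def)

text \<open>Only a free homotopy to a constant loop is available; the difference of the lift along the two
  identified sides of the square is constant, and it vanishes on the constant side.\<close>

lemma path_int_loop:
  assumes "simply_connected (UNIV :: 'u set)" "path \<gamma>" "pathfinish \<gamma> = pathstart \<gamma>"
  shows "path_int \<gamma> = 0"
proof -
  define q where "q = (\<lambda>t::real. pathstart \<gamma>)"
  have "path q" by (simp add: q_def path_def)
  then have "homotopic_loops UNIV \<gamma> q"
    using assms unfolding simply_connected_def by (simp add: q_def pathfinish_def pathstart_def)
  then obtain h :: "real \<times> real \<Rightarrow> 'u" where h: "continuous_on ({0..1} \<times> {0..1}) h"
    "\<forall>x\<in>{0..1}. h (0, x) = \<gamma> x" "\<forall>x\<in>{0..1}. h (1, x) = q x" "\<forall>t\<in>{0..1}. h (t, 1) = h (t, 0)"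
    unfolding homotopic_loops pathfinish_def pathstart_def comp_def by (elim exE conjE)
  have sq: "{0..1} \<times> {0..1} = cbox (0::real, 0::real) (1, 1)"
    by (auto simp: cbox_Pair_eq)
  have "box (0::real, 0::real) (1, 1) \<noteq> {}"
    by (simp add: box_ne_empty Basis_prod_def)
  then obtain F where F: "lifts h ({0..1} \<times> {0..1}) F"
    using lifts_exists_cbox[of "(0,0)" "(1,1)" h] h(1) unfolding sq by blast
  have *: "lifts (\<lambda>t. h (\<phi> t)) {0..1::real} (\<lambda>t. F (\<phi> t))"
    if "continuous_on {0..1} \<phi>" "\<phi> ` {0..1} \<subseteq> {0..1} \<times> {0..1}" for \<phi>
    by (rule lifts_compose[OF F that])
  have "lifts (\<lambda>t. h (0, t)) {0..1} (\<lambda>t. F (0, t))"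
    by (rule *) (auto intro!: continuous_intros)
  then have "lifts \<gamma> {0..1} (\<lambda>t. F (0, t))" by (rule lifts_cong) (use h in auto)
  then have 1: "path_int \<gamma> = F (0, 1) - F (0, 0)" using path_int_eq by fastforce
  have "lifts (\<lambda>t. h (1, t)) {0..1} (\<lambda>t. F (1, t))"
    by (rule *) (auto intro!: continuous_intros)
  then have "lifts q {0..1} (\<lambda>t. F (1, t))" by (rule lifts_cong) (use h in auto)
  then have 2: "path_int q = F (1, 1) - F (1, 0)" using path_int_eq by fastforce
  obtain V g where Vg: "(V, g) \<in> \<G>" "pathstart \<gamma> \<in> V" using covers by blast
  have 3: "path_int q = 0"
    using path_int_local[OF Vg(1) \<open>path q\<close>] Vg(2)
    by (auto simp: q_def path_image_def pathfinish_def pathstart_def)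
  have "lifts (\<lambda>t. h (t, 0)) {0..1} (\<lambda>t. F (t, 0))"
    by (rule *) (auto intro!: continuous_intros)
  moreover have "lifts (\<lambda>t. h (t, 1)) {0..1} (\<lambda>t. F (t, 1))"
    by (rule *) (auto intro!: continuous_intros)
  then have "lifts (\<lambda>t. h (t, 0)) {0..1} (\<lambda>t. F (t, 1))"
    by (rule lifts_cong) (use h in auto)
  ultimately have "F (0, 1) - F (0, 0) = F (1, 1) - F (1, 0)"
    using lifts_unique[of "\<lambda>t. h (t, 0)" "{0..1}" "\<lambda>t. F (t, 1)" "\<lambda>t. F (t, 0)" 1 0] by simp
  then show ?thesis using 1 2 3 by simp
qed

text \<open>The value at \<open>y\<close> is the integral along a chosen path from an arbitrary base
  point. Integrals over loops vanish, so within a path-connected \<open>V\<close> it changes exactly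
  by the increment of the local function.\<close>

theorem global_primitive:
  assumes sc: "simply_connected (UNIV :: 'u set)"
  shows "\<exists>f. \<forall>V g. (V, g) \<in> \<G> \<and> path_connected V \<longrightarrow> (\<exists>k. \<forall>x\<in>V. f x = g x + k)"
proof -
  define o' :: 'u where "o' = undefined"
  from simply_connected_imp_path[OF sc, of o'] obtain \<Gamma> where \<Gamma>: "\<And>y. path (\<Gamma> y)" "\<And>y. pathstart (\<Gamma> y) = o'" "\<And>y. pathfinish (\<Gamma> y) = y"
    by metis
  have "path_int (\<Gamma> y) = g y + (path_int (\<Gamma> x) - g x)"
    if Vg: "(V, g) \<in> \<G>" "path_connected V" "x \<in> V" "y \<in> V" for V g x y
  proof -
    obtain \<delta> where \<delta>: "path \<delta>" "path_image \<delta> \<subseteq> V" "pathstart \<delta> = x" "pathfinish \<delta> = y"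
      using Vg unfolding path_connected_def by blast
    have "path_int (\<Gamma> x +++ (\<delta> +++ reversepath (\<Gamma> y))) = 0"
      by (rule path_int_loop[OF sc]) (simp_all add: \<Gamma> \<delta>)
    then show ?thesis
      using path_int_local[OF Vg(1) \<delta>(1,2)]
      by (simp add: path_int_join path_int_reverse \<Gamma> \<delta> algebra_simps)
  qed
  then have "\<exists>k. \<forall>y\<in>V. path_int (\<Gamma> y) = g y + k" if "(V, g) \<in> \<G>" "path_connected V" for V g
    using that by (cases "V = {}") blast+
  then show ?thesis by (intro exI[of _ "\<lambda>y. path_int (\<Gamma> y)"]) simp
qed

end

subsection \<open>Smooth functions\<close>

text \<open>On an open set, equal functions have equal derivatives, and these are what the recursion
  compares at the next level.\<close>

lemma Ck_on_cong:
  assumes "open S" "\<And>x. x \<in> S \<Longrightarrow> f x = g x"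
  shows "Ck_on k S f = Ck_on k S g"
  using assms(2)
proof (induction k arbitrary: f g)
  case 0
  then show ?case by (simp cong: continuous_on_cong)
next
  case (Suc k)
  have d: "(f has_derivative D) (at x) \<longleftrightarrow> (g has_derivative D) (at x)" if "x \<in> S" for x D
    using has_derivative_transform_within_open[OF _ \<open>open S\<close> that, of f D UNIV g]
      has_derivative_transform_within_open[OF _ \<open>open S\<close> that, of g D UNIV f] Suc.prems by auto
  then have "frechet_derivative f (at x) = frechet_derivative g (at x)" if "x \<in> S" for x
    using that by (simp add: frechet_derivative_def)
  then have "Ck_on k S (\<lambda>x. frechet_derivative f (at x) v) = Ck_on k S (\<lambda>x. frechet_derivative g (at x) v)" for v
    by (intro Suc.IH) simp
  then show ?case using d by (simp add: differentiable_def)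
qed

lemma Ck_on_subset: "Ck_on k S f \<Longrightarrow> T \<subseteq> S \<Longrightarrow> Ck_on k T f"
  by (induction k arbitrary: f) (auto intro: continuous_on_subset)

lemma Ck_on_UN:
  "(\<And>i. i \<in> I \<Longrightarrow> open (S i)) \<Longrightarrow> (\<And>i. i \<in> I \<Longrightarrow> Ck_on k (S i) f) \<Longrightarrow> Ck_on k (\<Union>i\<in>I. S i) f"
  by (induction k arbitrary: f) (auto intro!: continuous_on_open_UN)

lemma Ck_on_Suc_imp: "Ck_on (Suc k) S f \<Longrightarrow> Ck_on k S f"
proof (induction k arbitrary: f)
  case 0
  have "continuous (at x within S) f" if "x \<in> S" for x
  proof -
    have "f differentiable (at x)" using 0 that by simp
    then show ?thesis by (rule differentiable_imp_continuous_within[OF differentiable_at_withinI])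
  qed
  then show ?case by (simp add: continuous_on_eq_continuous_within)
next
  case (Suc k)
  have "\<forall>x\<in>S. f differentiable (at x)" and "\<And>v. Ck_on (Suc k) S (\<lambda>x. frechet_derivative f (at x) v)"
    using Suc.prems by simp_all
  then show ?case using Suc.IH by simp
qed

text \<open>Trades the choice term \<open>frechet_derivative\<close> for an explicit derivative; the
  closure rules that follow are inductions through this rule.\<close>

lemma Ck_on_SucI:
  assumes "open S" "\<And>x. x \<in> S \<Longrightarrow> (f has_derivative f' x) (at x)" "\<And>v. Ck_on k S (\<lambda>x. f' x v)"
  shows "Ck_on (Suc k) S f"
proof -
  have "frechet_derivative f (at x) = f' x" if "x \<in> S" for x
    using assms(2)[OF that] by (metis frechet_derivative_at)
  then have "Ck_on k S (\<lambda>x. frechet_derivative f (at x) v)" for v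
    using assms(3)[of v] by (subst Ck_on_cong[OF assms(1), where g = "\<lambda>x. f' x v"]) auto
  then show ?thesis using assms(2) by (auto simp: differentiable_def)
qed

lemma Ck_on_SucD:
  assumes "Ck_on (Suc k) S f" "x \<in> S"
  shows "(f has_derivative frechet_derivative f (at x)) (at x)"
  using assms by (auto simp: frechet_derivative_works)

lemma Ck_on_const: "open S \<Longrightarrow> Ck_on k S (\<lambda>x. c)"
proof (induction k arbitrary: c)
  case (Suc k)
  show ?case by (rule Ck_on_SucI[OF Suc.prems has_derivative_const Suc.IH[OF Suc.prems]])
qed simp

lemma Ck_on_add: "open S \<Longrightarrow> Ck_on k S f \<Longrightarrow> Ck_on k S g \<Longrightarrow> Ck_on k S (\<lambda>x. f x + g x)"
proof (induction k arbitrary: f g)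
  case (Suc k)
  show ?case
    by (rule Ck_on_SucI[OF Suc.prems(1)])
      (auto intro!: has_derivative_add Ck_on_SucD[OF Suc.prems(2)] Ck_on_SucD[OF Suc.prems(3)] Suc.IH
        simp del: Ck_on.simps(2) simp: Suc.prems(2,3)[unfolded Ck_on.simps] Suc.prems(1))
qed (simp add: continuous_on_add)

lemma (in bounded_linear) Ck_on_linear: "open S \<Longrightarrow> Ck_on k S g \<Longrightarrow> Ck_on k S (\<lambda>x. f (g x))"
proof (induction k arbitrary: g)
  case 0
  then show ?case by (simp add: continuous_on)
next
  case (Suc k)
  show ?case
    by (rule Ck_on_SucI[OF Suc.prems(1) has_derivative[OF Ck_on_SucD[OF Suc.prems(2)]]])
      (use Suc.prems in \<open>auto intro!: Suc.IH\<close>)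
qed

lemma (in bounded_bilinear) Ck_on_bilinear:
  "open S \<Longrightarrow> Ck_on k S f \<Longrightarrow> Ck_on k S g \<Longrightarrow> Ck_on k S (\<lambda>x. prod (f x) (g x))"
proof (induction k arbitrary: f g)
  case 0
  then show ?case by (simp add: continuous_on)
next
  case (Suc k)
  show ?case
  proof (rule Ck_on_SucI[OF Suc.prems(1) FDERIV[OF Ck_on_SucD[OF Suc.prems(2)] Ck_on_SucD[OF Suc.prems(3)]]])
    show "Ck_on k S (\<lambda>x. prod (f x) (frechet_derivative g (at x) v) + prod (frechet_derivative f (at x) v) (g x))" for v
      by (intro Ck_on_add Suc.IH Suc.prems Ck_on_Suc_imp[OF Suc.prems(2)] Ck_on_Suc_imp[OF Suc.prems(3)])
        (use Suc.prems in auto)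
  qed
qed

text \<open>The derivative -f^-1 f' f^-1 is built from f' and the inverse itself, so the induction
  can stay with the same f. The order of the factors matters for quaternions.\<close>

lemma Ck_on_inverse:
  fixes f :: "'a::real_normed_vector \<Rightarrow> 'b::real_normed_div_algebra"
  shows "open S \<Longrightarrow> Ck_on k S f \<Longrightarrow> (\<And>x. x \<in> S \<Longrightarrow> f x \<noteq> 0) \<Longrightarrow> Ck_on k S (\<lambda>x. inverse (f x))"
proof (induction k)
  case 0
  then show ?case by (simp add: continuous_on_inverse)
next
  case (Suc k)
  have IH: "Ck_on k S (\<lambda>x. inverse (f x))"
    by (rule Suc.IH[OF Suc.prems(1) Ck_on_Suc_imp[OF Suc.prems(2)] Suc.prems(3)])
  have D: "Ck_on k S (\<lambda>x. frechet_derivative f (at x) v)" for v using Suc.prems(2) by simp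
  show ?case
  proof (rule Ck_on_SucI[OF Suc.prems(1) Deriv.has_derivative_inverse[OF Suc.prems(3) Ck_on_SucD[OF Suc.prems(2)]]])
    show "Ck_on k S (\<lambda>x. - (inverse (f x) * frechet_derivative f (at x) v * inverse (f x)))" for v
      by (intro bounded_linear.Ck_on_linear[OF bounded_linear_minus[OF bounded_linear_ident]]
          bounded_bilinear.Ck_on_bilinear[OF bounded_bilinear_mult] IH D Suc.prems(1))
  qed
qed

lemma smooth_on_cong: "open S \<Longrightarrow> (\<And>x. x \<in> S \<Longrightarrow> f x = g x) \<Longrightarrow> smooth_on S f = smooth_on S g"
  unfolding smooth_on_def using Ck_on_cong by blast

lemma smooth_on_subset: "smooth_on S f \<Longrightarrow> T \<subseteq> S \<Longrightarrow> smooth_on T f"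
  unfolding smooth_on_def using Ck_on_subset by blast

lemma smooth_on_UN:
  "(\<And>i. i \<in> I \<Longrightarrow> open (S i)) \<Longrightarrow> (\<And>i. i \<in> I \<Longrightarrow> smooth_on (S i) f) \<Longrightarrow> smooth_on (\<Union>i\<in>I. S i) f"
  unfolding smooth_on_def using Ck_on_UN[of I S _ f] by blast

lemma smooth_on_const: "open S \<Longrightarrow> smooth_on S (\<lambda>x. c)"
  unfolding smooth_on_def using Ck_on_const by blast

lemma smooth_on_add: "open S \<Longrightarrow> smooth_on S f \<Longrightarrow> smooth_on S g \<Longrightarrow> smooth_on S (\<lambda>x. f x + g x)"
  unfolding smooth_on_def using Ck_on_add by blast

lemma (in bounded_linear) smooth_on_linear: "open S \<Longrightarrow> smooth_on S g \<Longrightarrow> smooth_on S (\<lambda>x. f (g x))"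
  unfolding smooth_on_def using Ck_on_linear by blast

lemma (in bounded_bilinear) smooth_on_bilinear:
  "open S \<Longrightarrow> smooth_on S f \<Longrightarrow> smooth_on S g \<Longrightarrow> smooth_on S (\<lambda>x. prod (f x) (g x))"
  unfolding smooth_on_def using Ck_on_bilinear by blast

lemma smooth_on_inverse:
  fixes f :: "'a::euclidean_space \<Rightarrow> 'b::real_normed_div_algebra"
  shows "open S \<Longrightarrow> smooth_on S f \<Longrightarrow> (\<And>x. x \<in> S \<Longrightarrow> f x \<noteq> 0) \<Longrightarrow> smooth_on S (\<lambda>x. inverse (f x))"
  unfolding smooth_on_def using Ck_on_inverse by blast

lemma smooth_on_has_derivative:
  "smooth_on S f \<Longrightarrow> x \<in> S \<Longrightarrow> (f has_derivative frechet_derivative f (at x)) (at x)"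
  unfolding smooth_on_def using Ck_on_SucD by blast

lemma smooth_on_derivative: "smooth_on S f \<Longrightarrow> smooth_on S (\<lambda>x. frechet_derivative f (at x) v)"
  unfolding smooth_on_def by (metis Ck_on.simps(2))

lemma smooth_on_imp_continuous_on: "smooth_on S f \<Longrightarrow> continuous_on S f"
  unfolding smooth_on_def by (metis Ck_on.simps(1))

lemma smooth_onI_derivative:
  assumes "open S" "\<And>x. x \<in> S \<Longrightarrow> (f has_derivative f' x) (at x)" "\<And>v. smooth_on S (\<lambda>x. f' x v)"
  shows "smooth_on S f"
  unfolding smooth_on_def
proof
  fix k
  have "Ck_on (Suc k) S f"
    using assms by (intro Ck_on_SucI[of S f f']) (auto simp: smooth_on_def)
  then show "Ck_on k S f" by (rule Ck_on_Suc_imp)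
qed

lemma bounded_linear_quat:
  "bounded_linear qr" "bounded_linear qi" "bounded_linear qj" "bounded_linear qk" "bounded_linear qcnj"
  by (auto intro!: linear_conv_bounded_linear[THEN iffD1] linearI simp: quat_eq_iff)

subsection \<open>The Poincare lemma on a disc\<close>

text \<open>The primitive is the line integral of P dx + Q dy along the segment from
  \<open>z0\<close> to \<open>z\<close>, differentiated under the integral sign.\<close>

lemma poincare_ball:
  fixes P Q :: "complex \<Rightarrow> 'v::euclidean_space"
  assumes P: "\<And>z. z \<in> ball z0 r \<Longrightarrow> (P has_derivative DP z) (at z)"
    and Q: "\<And>z. z \<in> ball z0 r \<Longrightarrow> (Q has_derivative DQ z) (at z)"
    and cP: "\<And>v. continuous_on (ball z0 r) (\<lambda>z. DP z v)"
    and cQ: "\<And>v. continuous_on (ball z0 r) (\<lambda>z. DQ z v)"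
    and sym: "\<And>z. z \<in> ball z0 r \<Longrightarrow> DP z \<i> = DQ z 1"
  shows "\<exists>g. \<forall>z\<in>ball z0 r. (g has_derivative (\<lambda>v. Re v *\<^sub>R P z + Im v *\<^sub>R Q z)) (at z)"
proof -
  define \<gamma> where "\<gamma> z t = z0 + t *\<^sub>R (z - z0)" for z and t :: real
  have \<gamma>: "\<gamma> z t \<in> ball z0 r" if "z \<in> ball z0 r" "t \<in> cbox 0 1" for z t
  proof -
    have "convex (ball z0 r)" "z0 \<in> ball z0 r" using that by (auto simp: dist_norm intro: le_less_trans[OF norm_ge_zero])
    from convexD_alt[OF this(1) this(2) that(1), of t] that(2) show ?thesis
      by (simp add: \<gamma>_def algebra_simps)
  qed
  \<comment> \<open>\<open>f\<close> is the integrand of the radial integral and \<open>fx\<close>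
    its derivative in \<open>z\<close> in direction \<open>v\<close>; the factor \<open>t\<close> is
    the derivative of \<open>\<gamma> z t\<close> in \<open>z\<close>.\<close>
  define f where "f z t = Re (z - z0) *\<^sub>R P (\<gamma> z t) + Im (z - z0) *\<^sub>R Q (\<gamma> z t)" for z t
  define fx where "fx z t v = Re v *\<^sub>R P (\<gamma> z t) + Im v *\<^sub>R Q (\<gamma> z t)
     + t *\<^sub>R (Re (z - z0) *\<^sub>R DP (\<gamma> z t) v + Im (z - z0) *\<^sub>R DQ (\<gamma> z t) v)" for z t v
  have blP: "bounded_linear (DP z)" and blQ: "bounded_linear (DQ z)" if "z \<in> ball z0 r" for z
    using P[OF that] Q[OF that] has_derivative_bounded_linear by blast+
  have bl: "bounded_linear (fx z t)" if "z \<in> ball z0 r" "t \<in> cbox 0 1" for z t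
    unfolding fx_def using blP[OF \<gamma>[OF that]] blQ[OF \<gamma>[OF that]]
    by (intro bounded_linear_add bounded_linear_const_scaleR bounded_linear_scaleR_const
        bounded_linear_Re bounded_linear_Im)
  have P\<gamma>: "((\<lambda>z. P (\<gamma> z t)) has_derivative (\<lambda>v. DP (\<gamma> z t) (t *\<^sub>R v))) (at z within S)"
    and Q\<gamma>: "((\<lambda>z. Q (\<gamma> z t)) has_derivative (\<lambda>v. DQ (\<gamma> z t) (t *\<^sub>R v))) (at z within S)"
    if "z \<in> ball z0 r" "t \<in> cbox 0 1" for z t S
  proof -
    have 0: "((\<lambda>z. \<gamma> z t) has_derivative (\<lambda>v. t *\<^sub>R v)) (at z within S)"
      unfolding \<gamma>_def by (auto intro!: derivative_eq_intros)
    show "((\<lambda>z. P (\<gamma> z t)) has_derivative (\<lambda>v. DP (\<gamma> z t) (t *\<^sub>R v))) (at z within S)"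
      by (rule has_derivative_compose[OF 0 P[OF \<gamma>[OF that]]])
    show "((\<lambda>z. Q (\<gamma> z t)) has_derivative (\<lambda>v. DQ (\<gamma> z t) (t *\<^sub>R v))) (at z within S)"
      by (rule has_derivative_compose[OF 0 Q[OF \<gamma>[OF that]]])
  qed
  have df: "((\<lambda>z. f z t) has_derivative fx z t) (at z within S)"
    if zt: "z \<in> ball z0 r" "t \<in> cbox 0 1" for z t S
  proof -
    have lin: "linear (DP (\<gamma> z t))" "linear (DQ (\<gamma> z t))"
      using blP[OF \<gamma>[OF zt]] blQ[OF \<gamma>[OF zt]] by (auto intro: bounded_linear.linear)
    have "((\<lambda>z. f z t) has_derivative (\<lambda>v. (Re (z - z0) *\<^sub>R DP (\<gamma> z t) (t *\<^sub>R v) + Re v *\<^sub>R P (\<gamma> z t))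
        + (Im (z - z0) *\<^sub>R DQ (\<gamma> z t) (t *\<^sub>R v) + Im v *\<^sub>R Q (\<gamma> z t)))) (at z within S)"
      unfolding f_def
      by (intro has_derivative_add has_derivative_scaleR P\<gamma>[OF zt] Q\<gamma>[OF zt])
        (auto intro!: derivative_eq_intros)
    moreover have "(\<lambda>v. (Re (z - z0) *\<^sub>R DP (\<gamma> z t) (t *\<^sub>R v) + Re v *\<^sub>R P (\<gamma> z t))
        + (Im (z - z0) *\<^sub>R DQ (\<gamma> z t) (t *\<^sub>R v) + Im v *\<^sub>R Q (\<gamma> z t))) = fx z t"
      by (rule ext) (simp add: fx_def linear_scale[OF lin(1)] linear_scale[OF lin(2)] scaleR_add_right mult.commute)
    ultimately show ?thesis by simp
  qed
  define g where "g z = integral (cbox 0 1) (f z)" for z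
  define U where "U = ball z0 r"
  have cont\<gamma>: "continuous_on (U \<times> cbox 0 1) (\<lambda>x. \<gamma> (fst x) (snd x))"
    unfolding \<gamma>_def by (intro continuous_intros)
  have im\<gamma>: "(\<lambda>x. \<gamma> (fst x) (snd x)) ` (U \<times> cbox 0 1) \<subseteq> U" using \<gamma> by (auto simp: U_def)
  have cont0: "continuous_on U P" "continuous_on U Q"
    unfolding U_def
    by (rule has_derivative_continuous_on[OF has_derivative_at_withinI[OF P]], assumption)
      (rule has_derivative_continuous_on[OF has_derivative_at_withinI[OF Q]], assumption)
  have "continuous_on (U \<times> cbox 0 1) (\<lambda>x. P (\<gamma> (fst x) (snd x)))"
       "continuous_on (U \<times> cbox 0 1) (\<lambda>x. Q (\<gamma> (fst x) (snd x)))"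
       "continuous_on (U \<times> cbox 0 1) (\<lambda>x. DP (\<gamma> (fst x) (snd x)) v)"
       "continuous_on (U \<times> cbox 0 1) (\<lambda>x. DQ (\<gamma> (fst x) (snd x)) v)" for v
    using continuous_on_compose2[OF cont0(1) cont\<gamma> im\<gamma>] continuous_on_compose2[OF cont0(2) cont\<gamma> im\<gamma>]
      continuous_on_compose2[OF cP[folded U_def] cont\<gamma> im\<gamma>]
      continuous_on_compose2[OF cQ[folded U_def] cont\<gamma> im\<gamma>] by simp_all
  note cont = this
  have cfx: "continuous_on (U \<times> cbox 0 1) (\<lambda>x. fx (fst x) (snd x) v)" for v
    unfolding fx_def by (intro continuous_intros cont)
  have cf: "continuous_on (U \<times> cbox 0 1) (\<lambda>x. f (fst x) (snd x))"
    unfolding f_def by (intro continuous_intros cont)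
  \<comment> \<open>\<open>leibniz_rule\<close> asks for derivatives that are bounded linear
    functions and depend continuously on both variables. In finite dimension this continuity can be
    checked on one vector at a time.\<close>
  define B where "B z t = Blinfun (fx z t)" for z t
  have B: "blinfun_apply (B z t) = fx z t" if "z \<in> U" "t \<in> cbox 0 1" for z t
    using bl that unfolding B_def U_def by (simp add: bounded_linear_Blinfun_apply)
  have cB: "continuous_on (U \<times> cbox 0 1) (\<lambda>(z, t). B z t)"
  proof (rule continuous_on_blinfun_componentwise)
    fix i :: complex
    show "continuous_on (U \<times> cbox 0 1) (\<lambda>x. blinfun_apply (case x of (z, t) \<Rightarrow> B z t) i)"
      using cfx[of i] by (rule continuous_on_eq) (auto simp: B)
  qed
  have "(g has_derivative (\<lambda>v. Re v *\<^sub>R P z + Im v *\<^sub>R Q z)) (at z)" if z: "z \<in> U" for z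
  proof -
    have fz: "continuous_on (cbox 0 1) (f x)" if "x \<in> U" for x
    proof -
      have "continuous_on (cbox 0 1) (\<lambda>t. (x, t))" by (intro continuous_intros)
      moreover have "(\<lambda>t. (x, t)) ` cbox 0 1 \<subseteq> U \<times> cbox 0 1" using that by auto
      ultimately show ?thesis using continuous_on_compose2[OF cf] by fastforce
    qed
    have Bz: "continuous_on (cbox 0 1) (B z)"
    proof -
      have "continuous_on (cbox 0 1) (\<lambda>t. (z, t))" by (intro continuous_intros)
      moreover have "(\<lambda>t. (z, t)) ` cbox 0 1 \<subseteq> U \<times> cbox 0 1" using z by auto
      ultimately show ?thesis using continuous_on_compose2[OF cB] by fastforce
    qed
    have "(g has_derivative integral (cbox 0 1) (B z)) (at z within U)"
      unfolding g_def
    proof (rule leibniz_rule[OF _ _ cB z])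
      show "((\<lambda>x. f x t) has_derivative blinfun_apply (B x t)) (at x within U)"
        if "x \<in> U" "t \<in> cbox 0 1" for x t
        unfolding B[OF that] using df[of x t U] that by (simp add: U_def)
      show "f x integrable_on cbox 0 1" if "x \<in> U" for x
        by (rule integrable_continuous[OF fz[OF that]])
    qed (simp add: U_def)
    moreover have "blinfun_apply (integral (cbox 0 1) (B z)) v = Re v *\<^sub>R P z + Im v *\<^sub>R Q z" for v
    proof -
      have "blinfun_apply (integral (cbox 0 1) (B z)) v = integral (cbox 0 1) (\<lambda>t. blinfun_apply (B z t) v)"
        using integral_linear[OF integrable_continuous[OF Bz] blinfun.bounded_linear_left[of v]]
        by (simp add: comp_def)
      also have "\<dots> = integral (cbox 0 1) (\<lambda>t. fx z t v)"
        by (rule integral_cong) (simp add: B[OF z])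
      \<comment> \<open>By \<open>sym\<close>, the integrand \<open>fx z t v\<close> is the
        t-derivative of \<open>t\<close> times the value on \<open>v\<close> of the form at
        \<open>\<gamma> z t\<close>. The upper limit contributes the form at \<open>z\<close>, and
        the factor \<open>0\<close> removes the lower limit.\<close>
      also have "\<dots> = 1 *\<^sub>R (Re v *\<^sub>R P (\<gamma> z 1) + Im v *\<^sub>R Q (\<gamma> z 1)) - 0 *\<^sub>R (Re v *\<^sub>R P (\<gamma> z 0) + Im v *\<^sub>R Q (\<gamma> z 0))"
      proof (rule integral_unique, unfold cbox_interval, rule fundamental_theorem_of_calculus)
        fix t :: real assume t: "t \<in> {0..1}"
        then have w: "\<gamma> z t \<in> ball z0 r" using \<gamma> z by (auto simp: U_def)
        have lin: "linear (DP (\<gamma> z t))" "linear (DQ (\<gamma> z t))"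
          using blP[OF w] blQ[OF w] by (auto intro: bounded_linear.linear)
        have eP: "DP (\<gamma> z t) u = Re u *\<^sub>R DP (\<gamma> z t) 1 + Im u *\<^sub>R DP (\<gamma> z t) \<i>"
          and eQ: "DQ (\<gamma> z t) u = Re u *\<^sub>R DQ (\<gamma> z t) 1 + Im u *\<^sub>R DQ (\<gamma> z t) \<i>" for u
        proof -
          have u: "u = Re u *\<^sub>R 1 + Im u *\<^sub>R \<i>" by (simp add: complex_eq_iff)
          show "DP (\<gamma> z t) u = Re u *\<^sub>R DP (\<gamma> z t) 1 + Im u *\<^sub>R DP (\<gamma> z t) \<i>"
            by (subst u) (simp only: linear_add[OF lin(1)] linear_scale[OF lin(1)])
          show "DQ (\<gamma> z t) u = Re u *\<^sub>R DQ (\<gamma> z t) 1 + Im u *\<^sub>R DQ (\<gamma> z t) \<i>"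
            by (subst u) (simp only: linear_add[OF lin(2)] linear_scale[OF lin(2)])
        qed
        have 0: "((\<lambda>t. \<gamma> z t) has_derivative (\<lambda>s. s *\<^sub>R (z - z0))) (at t within {0..1})"
          unfolding \<gamma>_def by (auto intro!: derivative_eq_intros)
        have 1: "((\<lambda>t. P (\<gamma> z t)) has_derivative (\<lambda>s. DP (\<gamma> z t) (s *\<^sub>R (z - z0)))) (at t within {0..1})"
          by (rule has_derivative_compose[OF 0 P[OF w]])
        have 2: "((\<lambda>t. Q (\<gamma> z t)) has_derivative (\<lambda>s. DQ (\<gamma> z t) (s *\<^sub>R (z - z0)))) (at t within {0..1})"
          by (rule has_derivative_compose[OF 0 Q[OF w]])
        have "((\<lambda>t. t *\<^sub>R (Re v *\<^sub>R P (\<gamma> z t) + Im v *\<^sub>R Q (\<gamma> z t))) has_derivative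
           (\<lambda>s. t *\<^sub>R (Re v *\<^sub>R DP (\<gamma> z t) (s *\<^sub>R (z - z0)) + Im v *\<^sub>R DQ (\<gamma> z t) (s *\<^sub>R (z - z0)))
             + s *\<^sub>R (Re v *\<^sub>R P (\<gamma> z t) + Im v *\<^sub>R Q (\<gamma> z t)))) (at t within {0..1})"
          by (intro has_derivative_scaleR has_derivative_add has_derivative_scaleR_right 1 2 has_derivative_ident)
        moreover have "(\<lambda>s. t *\<^sub>R (Re v *\<^sub>R DP (\<gamma> z t) (s *\<^sub>R (z - z0)) + Im v *\<^sub>R DQ (\<gamma> z t) (s *\<^sub>R (z - z0)))
             + s *\<^sub>R (Re v *\<^sub>R P (\<gamma> z t) + Im v *\<^sub>R Q (\<gamma> z t))) = (\<lambda>s. s *\<^sub>R fx z t v)"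
        proof
          fix s :: real
          show "t *\<^sub>R (Re v *\<^sub>R DP (\<gamma> z t) (s *\<^sub>R (z - z0)) + Im v *\<^sub>R DQ (\<gamma> z t) (s *\<^sub>R (z - z0)))
             + s *\<^sub>R (Re v *\<^sub>R P (\<gamma> z t) + Im v *\<^sub>R Q (\<gamma> z t)) = s *\<^sub>R fx z t v"
            unfolding fx_def eP[of v] eQ[of v] linear_scale[OF lin(1)] linear_scale[OF lin(2)] eP[of "z - z0"] eQ[of "z - z0"]
            using sym[OF w] by (simp add: algebra_simps)
        qed
        ultimately show "((\<lambda>t. t *\<^sub>R (Re v *\<^sub>R P (\<gamma> z t) + Im v *\<^sub>R Q (\<gamma> z t))) has_vector_derivative fx z t v) (at t within {0..1})"
          unfolding has_vector_derivative_def by simp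
      qed simp
      finally show ?thesis by (simp add: \<gamma>_def)
    qed
    ultimately have "(g has_derivative (\<lambda>v. Re v *\<^sub>R P z + Im v *\<^sub>R Q z)) (at z within U)"
      by (rule has_derivative_eq_rhs[OF _ ext])
    then show ?thesis using z by (simp add: U_def at_within_open[OF _ open_ball])
  qed
  then show ?thesis unfolding U_def by blast
qed

subsection \<open>Calculus on a Riemann surface\<close>

lemma linear_complex_expand:
  assumes "linear (T :: complex \<Rightarrow> 'v::real_vector)"
  shows "T v = Re v *\<^sub>R T 1 + Im v *\<^sub>R T \<i>"
proof -
  have "v = Re v *\<^sub>R 1 + Im v *\<^sub>R \<i>" by (simp add: complex_eq_iff)
  then have "T v = T (Re v *\<^sub>R 1 + Im v *\<^sub>R \<i>)" by simp
  then show ?thesis by (simp only: linear_add[OF assms] linear_scale[OF assms])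
qed

text \<open>Connectedness of the surface is left out, so that the atlas of an arbitrary covering
  space is again an instance.\<close>

locale atlas =
  fixes A :: "'m::topological_space chart set"
  assumes charts_cover: "(\<Union>c\<in>A. fst c) = UNIV"
    and open_chart: "c \<in> A \<Longrightarrow> open (fst c)"
    and open_chart_image: "c \<in> A \<Longrightarrow> open (snd c ` fst c)"
    and chart_homeomorphism: "c \<in> A \<Longrightarrow> homeomorphism (fst c) (snd c ` fst c) (snd c) (chart_inv c)"
    and transition_holomorphic:
      "c \<in> A \<Longrightarrow> d \<in> A \<Longrightarrow> (snd d \<circ> chart_inv c) holomorphic_on (snd c ` (fst c \<inter> fst d))"
begin

lemma chart_at: "chart_at A x \<in> A" "x \<in> fst (chart_at A x)"
proof -
  have "\<exists>c. c \<in> A \<and> x \<in> fst c" using charts_cover by blast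
  from someI_ex[OF this] show "chart_at A x \<in> A" "x \<in> fst (chart_at A x)"
    unfolding chart_at_def by blast+
qed

lemma chart_inv_chart [simp]: "c \<in> A \<Longrightarrow> x \<in> fst c \<Longrightarrow> chart_inv c (snd c x) = x"
  using chart_homeomorphism unfolding homeomorphism_def by blast

lemma open_chart_image_Int:
  assumes "c \<in> A" "open U"
  shows "open (snd c ` (U \<inter> fst c))"
proof -
  have "openin (top_of_set (fst c)) (U \<inter> fst c)" using assms(2) by (auto simp: openin_open)
  then have "openin (top_of_set (snd c ` fst c)) (snd c ` (U \<inter> fst c))"
    by (rule homeomorphism_imp_open_map[OF chart_homeomorphism[OF assms(1)]])
  then show ?thesis using open_chart_image[OF assms(1)] openin_open_trans by blast
qed

text \<open>These neighbourhoods serve two purposes: the coordinate image is a ball, as needed to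
  integrate forms and to recognise constants, and the set itself is path connected, as needed for
  \<open>global_primitive\<close>.\<close>

lemma chart_disc:
  assumes "c \<in> A" "x \<in> fst c" "open W" "x \<in> W"
  obtains e V where "e > 0" "open V" "x \<in> V" "V \<subseteq> W \<inter> fst c" "path_connected V"
    "snd c ` V = ball (snd c x) e" "chart_inv c ` ball (snd c x) e = V"
proof -
  have "open (snd c ` (W \<inter> fst c))" by (rule open_chart_image_Int[OF assms(1,3)])
  moreover have "snd c x \<in> snd c ` (W \<inter> fst c)" using assms by blast
  ultimately obtain e where e: "e > 0" "ball (snd c x) e \<subseteq> snd c ` (W \<inter> fst c)"
    using open_contains_ball by metis
  define V where "V = chart_inv c ` ball (snd c x) e"
  have V: "V = fst c \<inter> snd c -` ball (snd c x) e" "V \<subseteq> W"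
  proof -
    have z: "chart_inv c z \<in> W \<inter> fst c \<and> snd c (chart_inv c z) = z" if "z \<in> ball (snd c x) e" for z
    proof -
      obtain y where "y \<in> W \<inter> fst c" "z = snd c y" using \<open>z \<in> _\<close> e(2) by blast
      then show ?thesis using assms(1) by simp
    qed
    show "V \<subseteq> W" using z by (auto simp: V_def)
    show "V = fst c \<inter> snd c -` ball (snd c x) e"
    proof
      show "V \<subseteq> fst c \<inter> snd c -` ball (snd c x) e" using z by (auto simp: V_def)
      show "fst c \<inter> snd c -` ball (snd c x) e \<subseteq> V"
      proof
        fix y assume y: "y \<in> fst c \<inter> snd c -` ball (snd c x) e"
        then have "y = chart_inv c (snd c y)" using assms(1) by simp
        then show "y \<in> V" using y unfolding V_def by blast
      qed
    qed
  qed
  have cont: "continuous_on (snd c ` fst c) (chart_inv c)" "continuous_on (fst c) (snd c)"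
    using chart_homeomorphism[OF assms(1)] unfolding homeomorphism_def by blast+
  have "open V" unfolding V(1)
    by (rule continuous_open_preimage[OF cont(2) open_chart[OF assms(1)] open_ball])
  moreover have "path_connected V" unfolding V_def
  proof (rule path_connected_continuous_image)
    show "continuous_on (ball (snd c x) e) (chart_inv c)"
      by (rule continuous_on_subset[OF cont(1)]) (use e(2) in blast)
  qed (simp add: convex_imp_path_connected)
  moreover have "snd c ` V = ball (snd c x) e"
    unfolding V(1) using e(2) by blast
  moreover have "x \<in> V" "V \<subseteq> W \<inter> fst c" using V e(1) assms(2) by auto
  ultimately show ?thesis using that[of e V] e(1) V_def by blast
qed

text \<open>The complex derivative of the coordinate change from \<open>c\<close> to
  \<open>d\<close>: the cocycle of the holomorphic tangent bundle.\<close>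

definition tr :: "'m chart \<Rightarrow> 'm chart \<Rightarrow> 'm \<Rightarrow> complex" where
  "tr c d x = deriv (snd d \<circ> chart_inv c) (snd c x)"

lemma tr_derivative:
  assumes "c \<in> A" "d \<in> A" "x \<in> fst c" "x \<in> fst d"
  shows "((snd d \<circ> chart_inv c) has_field_derivative tr c d x) (at (snd c x))"
  unfolding tr_def
  using transition_holomorphic[OF assms(1,2)]
proof (rule holomorphic_derivI)
  show "open (snd c ` (fst c \<inter> fst d))"
    using open_chart_image_Int[OF assms(1) open_chart[OF assms(2)]] by (simp add: Int_commute)
  show "snd c x \<in> snd c ` (fst c \<inter> fst d)" using assms by blast
qed

lemma has_derivative_chart_change:
  assumes cd: "c \<in> A" "d \<in> A" "x \<in> fst c" "x \<in> fst d"
    and f: "((f \<circ> chart_inv d) has_derivative T) (at (snd d x))"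
  shows "((f \<circ> chart_inv c) has_derivative (\<lambda>v. T (tr c d x * v))) (at (snd c x))"
proof -
  have "((\<lambda>z. (f \<circ> chart_inv d) ((snd d \<circ> chart_inv c) z)) has_derivative (\<lambda>v. T (tr c d x * v))) (at (snd c x))"
    using has_field_derivative_imp_has_derivative[OF tr_derivative[OF cd]]
    by (rule has_derivative_compose) (use cd f in \<open>simp add: comp_def\<close>)
  moreover have "open (snd c ` (fst d \<inter> fst c))" by (rule open_chart_image_Int[OF cd(1) open_chart[OF cd(2)]])
  ultimately show ?thesis
    by (rule has_derivative_transform_within_open) (use cd in auto)
qed

lemma tr_compose:
  assumes "c \<in> A" "d \<in> A" "e \<in> A" "x \<in> fst c" "x \<in> fst d" "x \<in> fst e"
  shows "tr c e x = tr d e x * tr c d x"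
proof -
  have "((snd e \<circ> chart_inv c) has_derivative (\<lambda>v. tr d e x * (tr c d x * v))) (at (snd c x))"
    by (rule has_derivative_chart_change[OF assms(1,2,4,5)
          has_field_derivative_imp_has_derivative[OF tr_derivative[OF assms(2,3,5,6)]]])
  then have "((snd e \<circ> chart_inv c) has_field_derivative (tr d e x * tr c d x)) (at (snd c x))"
    by (rule has_derivative_imp_has_field_derivative) (simp add: mult_ac)
  then show ?thesis using DERIV_unique tr_derivative assms by blast
qed

lemma tr_self [simp]:
  assumes "c \<in> A" "x \<in> fst c"
  shows "tr c c x = 1"
proof -
  have "((snd c \<circ> chart_inv c) has_field_derivative 1) (at (snd c x))"
    by (rule has_field_derivative_transform_within_open[OF DERIV_ident open_chart_image[OF assms(1)]])
      (use assms in auto)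
  then show ?thesis using DERIV_unique tr_derivative assms by blast
qed

lemma tr_inverse: "c \<in> A \<Longrightarrow> d \<in> A \<Longrightarrow> x \<in> fst c \<Longrightarrow> x \<in> fst d \<Longrightarrow> tr c d x * tr d c x = 1"
  using tr_compose[of d c d x] by simp

lemma chart_vector_eq:
  assumes "c \<in> A" "x \<in> fst c"
  shows "chart_vector A c x v = tr c (chart_at A x) x * v"
proof -
  have "((snd (chart_at A x) \<circ> chart_inv c) has_derivative (\<lambda>v. tr c (chart_at A x) x * v)) (at (snd c x))"
    by (rule has_field_derivative_imp_has_derivative[OF tr_derivative]) (use assms chart_at in auto)
  from frechet_derivative_at[OF this] show ?thesis
    unfolding chart_vector_def by metis
qed

lemma tr_nonzero: "c \<in> A \<Longrightarrow> d \<in> A \<Longrightarrow> x \<in> fst c \<Longrightarrow> x \<in> fst d \<Longrightarrow> tr c d x \<noteq> 0"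
  using tr_inverse by fastforce

text \<open>Relational companion of \<open>differential\<close>: unlike the total function it also
  asserts differentiability, so that rules of calculus can be stated for it.\<close>

definition has_diff :: "('m \<Rightarrow> 'v::real_normed_vector) \<Rightarrow> 'm \<Rightarrow> (complex \<Rightarrow> 'v) \<Rightarrow> bool" where
  "has_diff f x T \<longleftrightarrow> ((f \<circ> chart_inv (chart_at A x)) has_derivative T) (at (snd (chart_at A x) x))"

text \<open>The selected chart has no special role: passing to another chart multiplies the argument
  by \<open>tr\<close>, and passing back multiplies by the inverse factor.\<close>

lemma has_diff_chart:
  assumes c: "c \<in> A" "x \<in> fst c"
  shows "has_diff f x T \<longleftrightarrow>
    ((f \<circ> chart_inv c) has_derivative (\<lambda>v. T (chart_vector A c x v))) (at (snd c x))"
proof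
  assume "has_diff f x T"
  then show "((f \<circ> chart_inv c) has_derivative (\<lambda>v. T (chart_vector A c x v))) (at (snd c x))"
    using has_derivative_chart_change[of c "chart_at A x" x f T] c chart_at
    by (simp add: has_diff_def chart_vector_eq)
next
  let ?d = "chart_at A x"
  assume "((f \<circ> chart_inv c) has_derivative (\<lambda>v. T (chart_vector A c x v))) (at (snd c x))"
  from has_derivative_chart_change[OF chart_at(1) c(1) chart_at(2) c(2) this]
  have "((f \<circ> chart_inv ?d) has_derivative (\<lambda>v. T ((tr c ?d x * tr ?d c x) * v))) (at (snd ?d x))"
    by (simp add: chart_vector_eq[OF c] mult.assoc)
  then show "has_diff f x T"
    by (simp add: has_diff_def tr_inverse[OF c(1) chart_at(1) c(2) chart_at(2)])
qed

lemma differential_eq: "has_diff f x T \<Longrightarrow> differential A f x = T"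
  unfolding has_diff_def differential_def by (metis frechet_derivative_at)

lemma has_diff_cong:
  assumes "has_diff f x T" "open U" "x \<in> U" "\<And>y. y \<in> U \<Longrightarrow> f y = g y"
  shows "has_diff g x T"
  unfolding has_diff_def
proof (rule has_derivative_transform_within_open[OF assms(1)[unfolded has_diff_def]])
  show "open (snd (chart_at A x) ` (U \<inter> fst (chart_at A x)))"
    by (rule open_chart_image_Int[OF chart_at(1) assms(2)])
  show "snd (chart_at A x) x \<in> snd (chart_at A x) ` (U \<inter> fst (chart_at A x))" using assms(3) chart_at by blast
qed (use assms(4) chart_at in auto)

lemma has_diff_linear: "has_diff f x T \<Longrightarrow> bounded_linear h \<Longrightarrow> has_diff (\<lambda>x. h (f x)) x (\<lambda>X. h (T X))"
  unfolding has_diff_def comp_def by (rule bounded_linear.has_derivative)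

lemma has_diff_bilinear:
  assumes "bounded_bilinear pr" "has_diff f x S" "has_diff g x T"
  shows "has_diff (\<lambda>x. pr (f x) (g x)) x (\<lambda>X. pr (f x) (T X) + pr (S X) (g x))"
  using bounded_bilinear.FDERIV[OF assms(1) assms(2,3)[unfolded has_diff_def]]
  unfolding has_diff_def comp_def by (simp add: chart_at)

lemma has_diff_add: "has_diff f x S \<Longrightarrow> has_diff g x T \<Longrightarrow> has_diff (\<lambda>x. f x + g x) x (\<lambda>X. S X + T X)"
  unfolding has_diff_def comp_def by (rule has_derivative_add)

lemma has_diff_diff: "has_diff f x S \<Longrightarrow> has_diff g x T \<Longrightarrow> has_diff (\<lambda>x. f x - g x) x (\<lambda>X. S X - T X)"
  unfolding has_diff_def comp_def by (rule has_derivative_diff)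

lemma has_diff_const: "has_diff (\<lambda>x. k) x (\<lambda>X. 0)"
  unfolding has_diff_def comp_def by (rule has_derivative_const)

text \<open>The difference of two primitives of one form is such a function, which is how the
  compatibility of local primitives is obtained.\<close>

lemma has_diff_zero_locally_constant:
  assumes "open W" "x \<in> W" "\<And>y. y \<in> W \<Longrightarrow> has_diff f y (\<lambda>X. 0)"
  obtains V k where "open V" "x \<in> V" "\<And>y. y \<in> V \<Longrightarrow> f y = k"
proof -
  let ?c = "chart_at A x"
  obtain e V where eV: "e > 0" "open V" "x \<in> V" "V \<subseteq> W \<inter> fst ?c" "snd ?c ` V = ball (snd ?c x) e"
    using chart_disc[OF chart_at assms(1,2)] by metis
  have "((f \<circ> chart_inv ?c) has_derivative (\<lambda>h. 0)) (at z within ball (snd ?c x) e)"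
    if z: "z \<in> ball (snd ?c x) e" for z
  proof -
    obtain y where y: "y \<in> V" "z = snd ?c y" using z eV(5) by blast
    then have "has_diff f y (\<lambda>X. 0)" "y \<in> fst ?c" using assms(3) eV(4) by auto
    then have "((f \<circ> chart_inv ?c) has_derivative (\<lambda>h. 0)) (at z)"
      using has_diff_chart[OF chart_at(1), of y x f "\<lambda>X. 0"] y(2) by simp
    then show ?thesis by (rule has_derivative_at_withinI)
  qed
  then obtain k where k: "\<forall>z\<in>ball (snd ?c x) e. (f \<circ> chart_inv ?c) z = k"
    using has_derivative_zero_constant[OF convex_ball] by blast
  have "f y = k" if "y \<in> V" for y
  proof -
    have "snd ?c y \<in> ball (snd ?c x) e" "y \<in> fst ?c" using that eV(4,5) by blast+
    then show ?thesis using k[rule_format, of "snd ?c y"] chart_at(1)[of x] by simp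
  qed
  then show ?thesis using that[of V k] eV by blast
qed

lemma smooth_map_has_diff:
  assumes "smooth_map_on A U f" "open U" "x \<in> U"
  shows "has_diff f x (differential A f x)"
proof -
  have "smooth_on (snd (chart_at A x) ` (U \<inter> fst (chart_at A x))) (f \<circ> chart_inv (chart_at A x))"
    using assms(1) chart_at unfolding smooth_map_on_def by blast
  from smooth_on_has_derivative[OF this, of "snd (chart_at A x) x"] show ?thesis
    unfolding has_diff_def differential_def using assms(3) chart_at by blast
qed

section \<open>Smooth maps and smooth forms\<close>

lemma smooth_map_onI:
  assumes "\<And>c. c \<in> A \<Longrightarrow> smooth_on (snd c ` (U \<inter> fst c)) (\<lambda>z. f (chart_inv c z))"
  shows "smooth_map_on A U f"
  using assms unfolding smooth_map_on_def comp_def by blast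

lemma smooth_map_onD:
  assumes "smooth_map_on A U f" "c \<in> A"
  shows "smooth_on (snd c ` (U \<inter> fst c)) (\<lambda>z. f (chart_inv c z))"
  using assms unfolding smooth_map_on_def comp_def by blast

lemma smooth_map_on_cong:
  assumes "open U" "\<And>x. x \<in> U \<Longrightarrow> f x = g x" "smooth_map_on A U f"
  shows "smooth_map_on A U g"
proof (rule smooth_map_onI)
  fix c assume c: "c \<in> A"
  have "smooth_on (snd c ` (U \<inter> fst c)) (\<lambda>z. f (chart_inv c z)) = smooth_on (snd c ` (U \<inter> fst c)) (\<lambda>z. g (chart_inv c z))"
    by (rule smooth_on_cong[OF open_chart_image_Int[OF c assms(1)]]) (use assms(2) c in auto)
  then show "smooth_on (snd c ` (U \<inter> fst c)) (\<lambda>z. g (chart_inv c z))" using smooth_map_onD[OF assms(3) c] by simp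
qed

lemma smooth_map_on_subset:
  assumes "smooth_map_on A U f" "V \<subseteq> U"
  shows "smooth_map_on A V f"
proof (rule smooth_map_onI)
  fix c assume "c \<in> A"
  from smooth_map_onD[OF assms(1) this] show "smooth_on (snd c ` (V \<inter> fst c)) (\<lambda>z. f (chart_inv c z))"
    by (rule smooth_on_subset) (use assms(2) in blast)
qed

lemma smooth_map_on_UN:
  assumes "\<And>i. i \<in> I \<Longrightarrow> open (U i)" "\<And>i. i \<in> I \<Longrightarrow> smooth_map_on A (U i) f"
  shows "smooth_map_on A (\<Union>i\<in>I. U i) f"
proof (rule smooth_map_onI)
  fix c assume c: "c \<in> A"
  have "smooth_on (\<Union>i\<in>I. snd c ` (U i \<inter> fst c)) (\<lambda>z. f (chart_inv c z))"
    by (rule smooth_on_UN[OF open_chart_image_Int[OF c assms(1)] smooth_map_onD[OF assms(2) c]])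
  moreover have "snd c ` ((\<Union>i\<in>I. U i) \<inter> fst c) = (\<Union>i\<in>I. snd c ` (U i \<inter> fst c))" by blast
  ultimately show "smooth_on (snd c ` ((\<Union>i\<in>I. U i) \<inter> fst c)) (\<lambda>z. f (chart_inv c z))" by simp
qed

lemma smooth_map_on_const:
  assumes "open U"
  shows "smooth_map_on A U (\<lambda>x. k)"
  by (rule smooth_map_onI) (rule smooth_on_const[OF open_chart_image_Int[OF _ assms]])

lemma smooth_map_on_add:
  assumes "open U" "smooth_map_on A U f" "smooth_map_on A U g"
  shows "smooth_map_on A U (\<lambda>x. f x + g x)"
  by (rule smooth_map_onI)
    (rule smooth_on_add[OF open_chart_image_Int[OF _ assms(1)] smooth_map_onD[OF assms(2)] smooth_map_onD[OF assms(3)]])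

lemma smooth_map_on_linear:
  assumes "bounded_linear h" "open U" "smooth_map_on A U f"
  shows "smooth_map_on A U (\<lambda>x. h (f x))"
  by (rule smooth_map_onI)
    (rule bounded_linear.smooth_on_linear[OF assms(1) open_chart_image_Int[OF _ assms(2)] smooth_map_onD[OF assms(3)]])

lemma smooth_map_on_bilinear:
  assumes "bounded_bilinear pr" "open U" "smooth_map_on A U f" "smooth_map_on A U g"
  shows "smooth_map_on A U (\<lambda>x. pr (f x) (g x))"
  by (rule smooth_map_onI)
    (rule bounded_bilinear.smooth_on_bilinear[OF assms(1) open_chart_image_Int[OF _ assms(2)]
        smooth_map_onD[OF assms(3)] smooth_map_onD[OF assms(4)]])

lemma smooth_map_on_inverse:
  fixes f :: "'m \<Rightarrow> 'v::real_normed_div_algebra"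
  assumes "open U" "smooth_map_on A U f" "\<And>x. x \<in> U \<Longrightarrow> f x \<noteq> 0"
  shows "smooth_map_on A U (\<lambda>x. inverse (f x))"
proof (rule smooth_map_onI)
  fix c assume c: "c \<in> A"
  show "smooth_on (snd c ` (U \<inter> fst c)) (\<lambda>z. inverse (f (chart_inv c z)))"
    by (rule smooth_on_inverse[OF open_chart_image_Int[OF c assms(1)] smooth_map_onD[OF assms(2) c]])
      (use c assms(3) in auto)
qed

lemma form_coord_linear:
  assumes "linear (\<omega> x)" "c \<in> A" "x \<in> fst c"
  shows "linear (form_coord A c \<omega> (snd c x))"
proof -
  have "form_coord A c \<omega> (snd c x) = (\<lambda>v. \<omega> x (tr c (chart_at A x) x * v))"
    using assms(2,3) by (simp add: form_coord_def fun_eq_iff chart_vector_eq)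
  moreover have "linear (\<lambda>v. tr c (chart_at A x) x * v)"
    by (simp add: bounded_linear.linear bounded_linear_mult_right)
  then have "linear (\<lambda>v. \<omega> x (tr c (chart_at A x) x * v))"
    by (rule linear_compose[OF _ assms(1), unfolded comp_def])
  ultimately show ?thesis by simp
qed

lemma smooth_form_onI:
  assumes "\<And>x. x \<in> U \<Longrightarrow> linear (\<omega> x)"
    "\<And>c v. c \<in> A \<Longrightarrow> smooth_on (snd c ` (U \<inter> fst c)) (\<lambda>z. form_coord A c \<omega> z v)"
  shows "smooth_form_on A U \<omega>"
  using assms unfolding smooth_form_on_def by blast

lemma smooth_form_onD:
  assumes "smooth_form_on A U \<omega>"
  shows "x \<in> U \<Longrightarrow> linear (\<omega> x)"
    and "c \<in> A \<Longrightarrow> smooth_on (snd c ` (U \<inter> fst c)) (\<lambda>z. form_coord A c \<omega> z v)"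
  using assms unfolding smooth_form_on_def by blast+

lemma smooth_form_on_cong:
  assumes "open U" "\<And>x X. x \<in> U \<Longrightarrow> \<omega> x X = \<eta> x X" "smooth_form_on A U \<omega>"
  shows "smooth_form_on A U \<eta>"
proof (rule smooth_form_onI)
  show "linear (\<eta> x)" if "x \<in> U" for x
  proof -
    have "\<eta> x = \<omega> x" using assms(2)[OF that] by auto
    then show ?thesis using smooth_form_onD(1)[OF assms(3) that] by simp
  qed
  fix c v assume c: "c \<in> A"
  have "smooth_on (snd c ` (U \<inter> fst c)) (\<lambda>z. form_coord A c \<omega> z v) = smooth_on (snd c ` (U \<inter> fst c)) (\<lambda>z. form_coord A c \<eta> z v)"
    by (rule smooth_on_cong[OF open_chart_image_Int[OF c assms(1)]]) (use assms(2) c in \<open>auto simp: form_coord_def\<close>)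
  then show "smooth_on (snd c ` (U \<inter> fst c)) (\<lambda>z. form_coord A c \<eta> z v)" using smooth_form_onD(2)[OF assms(3) c] by simp
qed

lemma smooth_form_on_subset:
  assumes "smooth_form_on A U \<omega>" "V \<subseteq> U"
  shows "smooth_form_on A V \<omega>"
proof (rule smooth_form_onI)
  show "linear (\<omega> x)" if "x \<in> V" for x using smooth_form_onD(1)[OF assms(1)] that assms(2) by blast
  fix c v assume "c \<in> A"
  from smooth_form_onD(2)[OF assms(1) this] show "smooth_on (snd c ` (V \<inter> fst c)) (\<lambda>z. form_coord A c \<omega> z v)"
    by (rule smooth_on_subset) (use assms(2) in blast)
qed

lemma smooth_form_on_UN:
  assumes "\<And>i. i \<in> I \<Longrightarrow> open (U i)" "\<And>i. i \<in> I \<Longrightarrow> smooth_form_on A (U i) \<omega>"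
  shows "smooth_form_on A (\<Union>i\<in>I. U i) \<omega>"
proof (rule smooth_form_onI)
  show "linear (\<omega> x)" if "x \<in> (\<Union>i\<in>I. U i)" for x using that assms(2) smooth_form_onD(1) by blast
  fix c v assume c: "c \<in> A"
  have "smooth_on (\<Union>i\<in>I. snd c ` (U i \<inter> fst c)) (\<lambda>z. form_coord A c \<omega> z v)"
    by (rule smooth_on_UN[OF open_chart_image_Int[OF c assms(1)] smooth_form_onD(2)[OF assms(2) c]])
  moreover have "snd c ` ((\<Union>i\<in>I. U i) \<inter> fst c) = (\<Union>i\<in>I. snd c ` (U i \<inter> fst c))" by blast
  ultimately show "smooth_on (snd c ` ((\<Union>i\<in>I. U i) \<inter> fst c)) (\<lambda>z. form_coord A c \<omega> z v)" by simp
qed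

lemma smooth_form_on_add:
  assumes "open U" "smooth_form_on A U \<omega>" "smooth_form_on A U \<eta>"
  shows "smooth_form_on A U (\<lambda>x X. \<omega> x X + \<eta> x X)"
proof (rule smooth_form_onI)
  show "linear (\<lambda>X. \<omega> x X + \<eta> x X)" if "x \<in> U" for x
    using smooth_form_onD(1)[OF assms(2) that] smooth_form_onD(1)[OF assms(3) that] by (rule linear_compose_add)
  fix c v assume c: "c \<in> A"
  show "smooth_on (snd c ` (U \<inter> fst c)) (\<lambda>z. form_coord A c (\<lambda>x X. \<omega> x X + \<eta> x X) z v)"
    using smooth_on_add[OF open_chart_image_Int[OF c assms(1)] smooth_form_onD(2)[OF assms(2) c] smooth_form_onD(2)[OF assms(3) c]]
    by (simp add: form_coord_def)
qed

lemma smooth_form_on_bilinear: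
  assumes "bounded_bilinear pr" "open U" "smooth_map_on A U f" "smooth_form_on A U \<omega>"
  shows "smooth_form_on A U (\<lambda>x X. pr (f x) (\<omega> x X))"
proof (rule smooth_form_onI)
  show "linear (\<lambda>X. pr (f x) (\<omega> x X))" if "x \<in> U" for x
    using linear_compose[OF smooth_form_onD(1)[OF assms(4) that]
        bounded_linear.linear[OF bounded_bilinear.bounded_linear_right[OF assms(1), of "f x"]]]
    by (simp add: comp_def)
  fix c v assume c: "c \<in> A"
  show "smooth_on (snd c ` (U \<inter> fst c)) (\<lambda>z. form_coord A c (\<lambda>x X. pr (f x) (\<omega> x X)) z v)"
    using bounded_bilinear.smooth_on_bilinear[OF assms(1) open_chart_image_Int[OF c assms(2)]
        smooth_map_onD[OF assms(3) c] smooth_form_onD(2)[OF assms(4) c]]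
    by (simp add: form_coord_def)
qed

text \<open>Closedness is defined in the selected chart only. In another chart the coordinates of the form are
  \<open>v \<mapsto> \<omega>(\<phi> z)(\<phi>'(z) v)\<close> with a holomorphic \<open>\<phi>\<close>; the second derivative contributes
  \<open>\<phi>''(z) u v\<close>, which is symmetric in \<open>u\<close> and \<open>v\<close>.\<close>

lemma closed_form_chart:
  fixes \<omega> :: "'m \<Rightarrow> complex \<Rightarrow> 'v::real_normed_vector"
  assumes \<omega>: "smooth_form_on A UNIV \<omega>" and cl: "closed_form A \<omega>" and c: "c \<in> A" "x \<in> fst c"
  shows "frechet_derivative (\<lambda>z. form_coord A c \<omega> z 1) (at (snd c x)) \<i> =
         frechet_derivative (\<lambda>z. form_coord A c \<omega> z \<i>) (at (snd c x)) 1"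
proof -
  define d where "d = chart_at A x"
  have d: "d \<in> A" "x \<in> fst d" using chart_at by (auto simp: d_def)
  define \<phi> where "\<phi> = snd d \<circ> chart_inv c"
  define S where "S = snd c ` (fst c \<inter> fst d)"
  have S: "open S" "snd c x \<in> S"
    using open_chart_image_Int[OF c(1) open_chart[OF d(1)]] c d by (auto simp: S_def Int_commute)
  have hol: "\<phi> holomorphic_on S" using transition_holomorphic[OF c(1) d(1)] by (simp add: \<phi>_def S_def)
  define P where "P = (\<lambda>z. form_coord A d \<omega> z 1)"
  define Q where "Q = (\<lambda>z. form_coord A d \<omega> z \<i>)"
  let ?w = "snd d x" and ?z = "snd c x"
  have w: "\<phi> ?z = ?w" using c by (simp add: \<phi>_def)
  have "smooth_on (snd d ` (UNIV \<inter> fst d)) P" "smooth_on (snd d ` (UNIV \<inter> fst d)) Q"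
    unfolding P_def Q_def by (rule smooth_form_onD(2)[OF \<omega> d(1)])+
  then obtain DP DQ where DP: "(P has_derivative DP) (at ?w)" and DQ: "(Q has_derivative DQ) (at ?w)"
    and DPQ: "DP = frechet_derivative P (at ?w)" "DQ = frechet_derivative Q (at ?w)"
    using smooth_on_has_derivative d(2) by blast
  have sym: "DP \<i> = DQ 1"
    using cl[unfolded closed_form_def, rule_format, of x \<i> 1] unfolding ext_deriv_def Let_def d_def[symmetric]
    by (simp add: DPQ P_def Q_def)
  have lin: "linear DP" "linear DQ" using DP DQ by (auto intro: bounded_linear.linear has_derivative_bounded_linear)
  have coord: "form_coord A c \<omega> z v = Re (deriv \<phi> z * v) *\<^sub>R P (\<phi> z) + Im (deriv \<phi> z * v) *\<^sub>R Q (\<phi> z)"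
    if "z \<in> S" for z v
  proof -
    obtain y where y: "y \<in> fst c" "y \<in> fst d" "z = snd c y" using \<open>z \<in> S\<close> by (auto simp: S_def)
    have "form_coord A c \<omega> z v = form_coord A d \<omega> (snd d y) (tr c d y * v)"
      using c(1) d(1) y tr_compose[OF c(1) d(1) chart_at(1) y(1,2) chart_at(2)]
      by (simp add: form_coord_def chart_vector_eq mult.assoc)
    also have "\<dots> = Re (tr c d y * v) *\<^sub>R P (snd d y) + Im (tr c d y * v) *\<^sub>R Q (snd d y)"
      unfolding P_def Q_def
      by (rule linear_complex_expand[OF form_coord_linear[OF smooth_form_onD(1)[OF \<omega>] d(1) y(2)]]) simp
    finally show ?thesis using y c(1) by (simp add: tr_def \<phi>_def)
  qed
  define a b where "a = deriv \<phi> ?z" and "b = deriv (deriv \<phi>) ?z"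
  have \<phi>': "(\<phi> has_derivative (\<lambda>u. a * u)) (at ?z)"
    using holomorphic_derivI[OF hol S] by (simp add: a_def has_field_derivative_def)
  have \<phi>'': "(deriv \<phi> has_derivative (\<lambda>u. b * u)) (at ?z)"
    using holomorphic_derivI[OF holomorphic_deriv[OF hol S(1)] S] by (simp add: b_def has_field_derivative_def)
  have P\<phi>: "((\<lambda>z. P (\<phi> z)) has_derivative (\<lambda>u. DP (a * u))) (at ?z)"
    and Q\<phi>: "((\<lambda>z. Q (\<phi> z)) has_derivative (\<lambda>u. DQ (a * u))) (at ?z)"
    by (rule has_derivative_compose[OF \<phi>'], simp add: w DP DQ)+
  have D: "frechet_derivative (\<lambda>z. form_coord A c \<omega> z v) (at ?z) u =
      (Re (a * v) *\<^sub>R DP (a * u) + Re (b * u * v) *\<^sub>R P ?w) + (Im (a * v) *\<^sub>R DQ (a * u) + Im (b * u * v) *\<^sub>R Q ?w)"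
    for u v
  proof -
    have "((\<lambda>z. Re (deriv \<phi> z * v) *\<^sub>R P (\<phi> z) + Im (deriv \<phi> z * v) *\<^sub>R Q (\<phi> z)) has_derivative
      (\<lambda>u. (Re (a * v) *\<^sub>R DP (a * u) + Re (b * u * v) *\<^sub>R P ?w) + (Im (a * v) *\<^sub>R DQ (a * u) + Im (b * u * v) *\<^sub>R Q ?w))) (at ?z)"
      unfolding a_def w[symmetric]
      by (intro has_derivative_add has_derivative_scaleR P\<phi>[unfolded a_def] Q\<phi>[unfolded a_def] has_derivative_Re has_derivative_Im
          has_derivative_mult_left \<phi>'')
    then have "((\<lambda>z. form_coord A c \<omega> z v) has_derivative
      (\<lambda>u. (Re (a * v) *\<^sub>R DP (a * u) + Re (b * u * v) *\<^sub>R P ?w) + (Im (a * v) *\<^sub>R DQ (a * u) + Im (b * u * v) *\<^sub>R Q ?w))) (at ?z)"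
      using S by (rule has_derivative_transform_within_open) (simp add: coord)
    from frechet_derivative_at[OF this] show ?thesis by (simp add: fun_eq_iff)
  qed
  \<comment> \<open>After this expansion the difference of the two sides, without the symmetric
    second-order terms, is |a|^2 times \<open>DP \<i> - DQ 1\<close>, which vanishes by
    \<open>sym\<close>.\<close>
  have "DP (a * 1) = Re a *\<^sub>R DP 1 + Im a *\<^sub>R DP \<i>" "DQ (a * 1) = Re a *\<^sub>R DQ 1 + Im a *\<^sub>R DQ \<i>"
    "DP (a * \<i>) = (- Im a) *\<^sub>R DP 1 + Re a *\<^sub>R DP \<i>" "DQ (a * \<i>) = (- Im a) *\<^sub>R DQ 1 + Re a *\<^sub>R DQ \<i>"
    using linear_complex_expand[OF lin(1), of "a * 1"] linear_complex_expand[OF lin(2), of "a * 1"]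
      linear_complex_expand[OF lin(1), of "a * \<i>"] linear_complex_expand[OF lin(2), of "a * \<i>"] by auto
  then show ?thesis
    unfolding D by (simp only: sym) (simp add: scaleR_add_right scaleR_diff_right mult.commute)
qed

text \<open>On a coordinate disc the form is P dx + Q dy with its values on the coordinate fields as
  P and Q. The symmetry hypothesis is needed in one fixed chart at all points of the disc, although
  each point has its own selected chart; \<open>closed_form_chart\<close> bridges this.\<close>

lemma local_primitive:
  fixes \<omega> :: "'m \<Rightarrow> complex \<Rightarrow> 'v::euclidean_space"
  assumes \<omega>: "smooth_form_on A UNIV \<omega>" and cl: "closed_form A \<omega>"
  obtains V g where "open V" "x \<in> V" "\<And>y. y \<in> V \<Longrightarrow> has_diff g y (\<omega> y)"
proof -
  define c where "c = chart_at A x"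
  have c: "c \<in> A" "x \<in> fst c" using chart_at by (auto simp: c_def)
  obtain e V where eV: "e > 0" "open V" "x \<in> V" "V \<subseteq> UNIV \<inter> fst c" "snd c ` V = ball (snd c x) e"
    using chart_disc[OF c open_UNIV UNIV_I] by metis
  define P where "P v = (\<lambda>z. form_coord A c \<omega> z v)" for v
  have sub: "ball (snd c x) e \<subseteq> snd c ` (UNIV \<inter> fst c)" using eV(4,5) by blast
  have sm: "smooth_on (ball (snd c x) e) (P v)" for v
    unfolding P_def by (rule smooth_on_subset[OF smooth_form_onD(2)[OF \<omega> c(1)] sub])
  have "\<exists>G. \<forall>z\<in>ball (snd c x) e. (G has_derivative (\<lambda>v. Re v *\<^sub>R P 1 z + Im v *\<^sub>R P \<i> z)) (at z)"
  proof (rule poincare_ball)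
    show "(P 1 has_derivative frechet_derivative (P 1) (at z)) (at z)"
      "(P \<i> has_derivative frechet_derivative (P \<i>) (at z)) (at z)" if "z \<in> ball (snd c x) e" for z
      by (rule smooth_on_has_derivative[OF sm that])+
    show "continuous_on (ball (snd c x) e) (\<lambda>z. frechet_derivative (P 1) (at z) v)"
      "continuous_on (ball (snd c x) e) (\<lambda>z. frechet_derivative (P \<i>) (at z) v)" for v
      by (rule smooth_on_imp_continuous_on[OF smooth_on_derivative[OF sm]])+
    show "frechet_derivative (P 1) (at z) \<i> = frechet_derivative (P \<i>) (at z) 1" if "z \<in> ball (snd c x) e" for z
    proof -
      obtain y where "y \<in> fst c" "z = snd c y" using \<open>z \<in> _\<close> sub by blast
      then show ?thesis unfolding P_def using closed_form_chart[OF \<omega> cl c(1)] by blast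
    qed
  qed
  then obtain G where G: "\<And>z. z \<in> ball (snd c x) e \<Longrightarrow> (G has_derivative (\<lambda>v. Re v *\<^sub>R P 1 z + Im v *\<^sub>R P \<i> z)) (at z)"
    by blast
  have "has_diff (G \<circ> snd c) y (\<omega> y)" if y: "y \<in> V" for y
  proof -
    have yc: "y \<in> fst c" "snd c y \<in> ball (snd c x) e" using y eV by blast+
    have "(\<lambda>v. Re v *\<^sub>R P 1 (snd c y) + Im v *\<^sub>R P \<i> (snd c y)) = form_coord A c \<omega> (snd c y)"
      unfolding P_def
      by (rule ext, rule linear_complex_expand[symmetric, OF form_coord_linear[OF smooth_form_onD(1)[OF \<omega> UNIV_I] c(1) yc(1)]])
    also have "\<dots> = (\<lambda>v. \<omega> y (chart_vector A c y v))" using c(1) yc by (simp add: form_coord_def fun_eq_iff)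
    finally have "(G has_derivative (\<lambda>v. \<omega> y (chart_vector A c y v))) (at (snd c y))"
      using G[OF yc(2)] by simp
    then have "((G \<circ> snd c \<circ> chart_inv c) has_derivative (\<lambda>v. \<omega> y (chart_vector A c y v))) (at (snd c y))"
      by (rule has_derivative_transform_within_open[OF _ open_chart_image[OF c(1)]]) (use c(1) yc in auto)
    then show ?thesis using has_diff_chart[OF c(1) yc(1)] by blast
  qed
  then show ?thesis using that eV by blast
qed

end

lemma riemann_surface_atlas: "riemann_surface A \<Longrightarrow> atlas A"
  unfolding riemann_surface_def atlas_def by blast

subsection \<open>The covering surface\<close>

text \<open>Multiplication by \<open>a\<close> scales the inner product of the plane by |a|^2. The
  tangent map of the covering is such a multiplication.\<close>

lemma conformal_linear_rotate:
  assumes "conformal_linear T" "a \<noteq> 0"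
  shows "conformal_linear (\<lambda>X. T (a * X))"
proof -
  obtain r where T: "linear T" "inj T" "r > 0" "\<And>v w. inner (T v) (T w) = r * inner v w"
    using assms(1) unfolding conformal_linear_def by blast
  have "linear (\<lambda>X. a * X)" by (simp add: bounded_linear.linear bounded_linear_mult_right)
  then have "linear (\<lambda>X. T (a * X))" by (rule linear_compose[OF _ T(1), unfolded comp_def])
  moreover have "inj (\<lambda>X. T (a * X))"
  proof (rule injI)
    fix x y assume "T (a * x) = T (a * y)"
    then have "a * x = a * y" by (rule injD[OF T(2)])
    then show "x = y" using assms(2) by simp
  qed
  moreover have "inner (T (a * v)) (T (a * w)) = (r * (norm a)\<^sup>2) * inner v w" for v w
    unfolding T(4) inner_complex_def cmod_power2 by (simp add: algebra_simps power2_eq_square)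
  moreover have "r * (norm a)\<^sup>2 > 0" using T(3) assms(2) by simp
  ultimately show ?thesis unfolding conformal_linear_def by blast
qed

locale covered_atlas = atlas A for A :: "'m::topological_space chart set" +
  fixes p :: "'u::topological_space \<Rightarrow> 'm"
  assumes cov: "covering_space UNIV p UNIV"
begin

abbreviation "B \<equiv> cover_atlas A p"

lemma p_continuous: "continuous_on S p"
  using cov covering_space_imp_continuous continuous_on_subset by blast

lemma p_surj: "\<exists>y. p y = x"
  using covering_space_imp_surjective[OF cov] by (metis UNIV_I imageE)

lemma p_open:
  assumes "open T"
  shows "open (p ` T)"
proof (subst open_subopen, intro ballI)
  fix x assume "x \<in> p ` T"
  then obtain y where y: "y \<in> T" "x = p y" by blast
  obtain T' u q where T': "y \<in> T'" "openin (top_of_set UNIV) T'" "openin (top_of_set UNIV) u" "homeomorphism T' u p q"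
    using covering_space_local_homeomorphism[OF cov UNIV_I] by metis
  have "openin (top_of_set T') (T' \<inter> T)" using assms by (auto simp: openin_open)
  then have "openin (top_of_set u) (p ` (T' \<inter> T))" by (rule homeomorphism_imp_open_map[OF T'(4)])
  then have "open (p ` (T' \<inter> T))" using T'(3) openin_open_trans by (metis open_openin subtopology_UNIV)
  then show "\<exists>T'. open T' \<and> x \<in> T' \<and> T' \<subseteq> p ` T" using y T'(1) by blast
qed

lemma cover_chartE:
  assumes "b \<in> B"
  obtains V c where "b = (V, snd c \<circ> p)" "c \<in> A" "open V" "inj_on p V" "p ` V \<subseteq> fst c"
  using assms unfolding cover_atlas_def by blast

lemma cover_chart_inv:
  assumes "c \<in> A" "inj_on p V" "p ` V \<subseteq> fst c" "y \<in> V"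
  shows "chart_inv (V, snd c \<circ> p) (snd c (p y)) = y"
proof -
  have "inj_on (snd c \<circ> p) V"
  proof (rule comp_inj_on[OF assms(2)])
    show "inj_on (snd c) (p ` V)"
      by (rule inj_on_subset[OF _ assms(3)]) (metis chart_inv_chart[OF assms(1)] inj_onI)
  qed
  from inv_into_f_f[OF this assms(4)] show ?thesis by (simp add: chart_inv_def)
qed

text \<open>Charts of the cover are charts of \<open>A\<close> read through \<open>p\<close>, so
  their transition maps are restrictions of those of \<open>A\<close>.\<close>

lemma cover_atlas: "atlas B"
proof
  show "(\<Union>b\<in>B. fst b) = UNIV"
  proof (rule UNIV_eq_I[symmetric])
    fix y
    obtain T' u q where T': "y \<in> T'" "openin (top_of_set UNIV) T'" "homeomorphism T' u p q"
      using covering_space_local_homeomorphism[OF cov UNIV_I] by metis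
    let ?c = "chart_at A (p y)" 
    let ?V = "T' \<inter> p -` fst ?c"
    have "open (p -` fst ?c)" by (rule open_vimage[OF open_chart[OF chart_at(1)] p_continuous])
    then have "open ?V" using T'(2) by auto
    moreover have "inj_on p ?V" using T'(3) by (metis Int_lower1 homeomorphism_apply1 inj_on_inverseI inj_on_subset)
    ultimately have "(?V, snd ?c \<circ> p) \<in> B" using chart_at unfolding cover_atlas_def by blast
    then show "y \<in> (\<Union>b\<in>B. fst b)" using T'(1) chart_at by (intro UN_I) auto
  qed
next
  fix b assume "b \<in> B"
  then obtain V c where b: "b = (V, snd c \<circ> p)" "c \<in> A" "open V" "inj_on p V" "p ` V \<subseteq> fst c"
    by (rule cover_chartE)
  show "open (fst b)" using b by simp
  have opn: "open ((snd c \<circ> p) ` U)" if "open U" "U \<subseteq> V" for U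
  proof -
    have "(snd c \<circ> p) ` U = snd c ` (p ` U \<inter> fst c)" using b(5) that(2) by (auto simp: image_iff)
    then show ?thesis using open_chart_image_Int[OF b(2) p_open[OF that(1)]] by simp
  qed
  show "open (snd b ` fst b)" using opn[OF b(3)] b(1) by simp
  have inv: "chart_inv b (snd c (p y)) = y" if "y \<in> V" for y
    using cover_chart_inv[OF b(2,4,5) that] b(1) by simp
  have "homeomorphism V ((snd c \<circ> p) ` V) (snd c \<circ> p) (chart_inv b)"
  proof (rule homeomorphismI)
    show "continuous_on V (snd c \<circ> p)"
    proof (rule continuous_on_compose[OF p_continuous])
      show "continuous_on (p ` V) (snd c)"
        using chart_homeomorphism[OF b(2)] b(5) by (metis continuous_on_subset homeomorphism_cont1)
    qed
    show "continuous_on ((snd c \<circ> p) ` V) (chart_inv b)"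
      unfolding continuous_on_open_vimage[OF opn[OF b(3) order_refl]]
    proof (intro allI impI)
      fix W :: "'u set" assume "open W"
      have "chart_inv b -` W \<inter> (snd c \<circ> p) ` V = (snd c \<circ> p) ` (W \<inter> V)"
        using inv by auto
      then show "open (chart_inv b -` W \<inter> (snd c \<circ> p) ` V)"
        using opn[of "W \<inter> V"] \<open>open W\<close> b(3) by auto
    qed
  qed (use inv in auto)
  then show "homeomorphism (fst b) (snd b ` fst b) (snd b) (chart_inv b)" using b(1) by simp
  fix b' assume "b' \<in> B"
  then obtain V' c' where b': "b' = (V', snd c' \<circ> p)" "c' \<in> A" "p ` V' \<subseteq> fst c'"
    by (rule cover_chartE)
  have "(snd c' \<circ> chart_inv c) holomorphic_on ((snd c \<circ> p) ` (V \<inter> V'))"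
    by (rule holomorphic_on_subset[OF transition_holomorphic[OF b(2) b'(2)]]) (use b(5) b'(3) in auto)
  then have "(snd c' \<circ> p \<circ> chart_inv b) holomorphic_on ((snd c \<circ> p) ` (V \<inter> V'))"
    by (rule holomorphic_transform) (use inv b(2,5) in auto)
  then show "(snd b' \<circ> chart_inv b) holomorphic_on (snd b ` (fst b \<inter> fst b'))"
    using b(1) b'(1) by simp
qed

sublocale C: atlas B by (rule cover_atlas)

lemma chart_at_coverE:
  obtains V c where "chart_at B y = (V, snd c \<circ> p)" "c \<in> A" "inj_on p V" "p ` V \<subseteq> fst c"
  using cover_chartE[OF C.chart_at(1)] by metis

text \<open>In these coordinates \<open>p\<close> is the identity, so differentiating
  \<open>f \<circ> p\<close> upstairs is differentiating \<open>f\<close> in the chart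
  \<open>c\<close>. This \<open>c\<close> may differ from the chart selected at
  \<open>p y\<close>.\<close>

lemma has_diff_cover_iff:
  assumes b: "chart_at B y = (V, snd c \<circ> p)" "c \<in> A" "inj_on p V" "p ` V \<subseteq> fst c"
  shows "C.has_diff (f \<circ> p) y T \<longleftrightarrow> ((f \<circ> chart_inv c) has_derivative T) (at (snd c (p y)))"
proof -
  have y: "snd c (p y) \<in> (snd c \<circ> p) ` V" using C.chart_at(2)[of y] b(1) by simp
  have op: "open ((snd c \<circ> p) ` V)" using C.open_chart_image[OF C.chart_at(1), of y] b(1) by simp
  have eq: "(f \<circ> p \<circ> chart_inv (V, snd c \<circ> p)) z = (f \<circ> chart_inv c) z" if z: "z \<in> (snd c \<circ> p) ` V" for z
  proof -
    obtain x where x: "x \<in> V" "z = snd c (p x)" using z by auto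
    then have "p x \<in> fst c" using b(4) by blast
    then show ?thesis using x cover_chart_inv[OF b(2-4) x(1)] b(2) by simp
  qed
  have "C.has_diff (f \<circ> p) y T \<longleftrightarrow>
      ((f \<circ> p \<circ> chart_inv (V, snd c \<circ> p)) has_derivative T) (at (snd c (p y)))"
    by (simp add: C.has_diff_def b(1))
  also have "\<dots> \<longleftrightarrow> ((f \<circ> chart_inv c) has_derivative T) (at (snd c (p y)))" (is "?l \<longleftrightarrow> ?r")
  proof
    assume ?l
    then show ?r by (rule has_derivative_transform_within_open[OF _ op y]) (rule eq)
  next
    assume ?r
    then show ?l by (rule has_derivative_transform_within_open[OF _ op y]) (rule eq[symmetric])
  qed
  finally show ?thesis .
qed

lemma tangent_map_chart:
  assumes b: "chart_at B y = (V, snd c \<circ> p)" "c \<in> A" "inj_on p V" "p ` V \<subseteq> fst c"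
  shows "tangent_map B A p y X = chart_vector A c (p y) X"
proof -
  let ?d = "chart_at A (p y)"
  have y: "p y \<in> fst c" using C.chart_at(2)[of y] b(1,4) by auto
  have "C.has_diff (snd ?d \<circ> p) y (\<lambda>v. tr c ?d (p y) * v)"
    unfolding has_diff_cover_iff[OF b]
    by (rule has_field_derivative_imp_has_derivative[OF tr_derivative[OF b(2) chart_at(1) y chart_at(2)]])
  then show ?thesis
    unfolding tangent_map_def chart_vector_eq[OF b(2) y] by (simp add: C.differential_eq)
qed

text \<open>The selections of charts at \<open>y\<close> and at \<open>p y\<close> are independent,
  so the tangent map is a transition derivative rather than the identity. A nonzero complex factor
  is still compatible with conformality and with multiplication by \<i>.\<close>

lemma tangent_map_complex_linear:
  obtains a where "a \<noteq> 0" "\<And>X. tangent_map B A p y X = a * X"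
proof -
  obtain V c where b: "chart_at B y = (V, snd c \<circ> p)" "c \<in> A" "inj_on p V" "p ` V \<subseteq> fst c"
    by (rule chart_at_coverE)
  have y: "p y \<in> fst c" using C.chart_at(2)[of y] b(1,4) by auto
  show ?thesis
    by (rule that[OF tr_nonzero[OF b(2) chart_at(1) y chart_at(2)]])
      (simp add: tangent_map_chart[OF b] chart_vector_eq[OF b(2) y])
qed

lemma has_diff_cover:
  assumes "has_diff g (p y) T"
  shows "C.has_diff (g \<circ> p) y (\<lambda>X. T (tangent_map B A p y X))"
proof -
  obtain V c where b: "chart_at B y = (V, snd c \<circ> p)" "c \<in> A" "inj_on p V" "p ` V \<subseteq> fst c"
    by (rule chart_at_coverE)
  have y: "p y \<in> fst c" using C.chart_at(2)[of y] b(1,4) by auto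
  show ?thesis
    unfolding has_diff_cover_iff[OF b] tangent_map_chart[OF b]
    using assms has_diff_chart[OF b(2) y] by blast
qed

lemma smooth_map_on_cover:
  assumes "\<And>y. \<exists>U g k. open U \<and> y \<in> U \<and> smooth_map_on A (p ` U) g \<and> (\<forall>y\<in>U. f y = g (p y) + k)"
  shows "smooth_map_on B UNIV f"
proof -
  obtain U g k where U: "\<And>y. open (U y)" "\<And>y. y \<in> U y" "\<And>y. smooth_map_on A (p ` U y) (g y)"
    "\<And>y x. x \<in> U y \<Longrightarrow> f x = g y (p x) + k y"
    using assms by metis
  have "smooth_map_on B (U y) f" for y
  proof (rule C.smooth_map_onI)
    fix b assume bB: "b \<in> B"
    then obtain V c where b: "b = (V, snd c \<circ> p)" "c \<in> A" "open V" "inj_on p V" "p ` V \<subseteq> fst c"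
      by (rule cover_chartE)
    have op: "open (snd b ` (U y \<inter> fst b))" by (rule C.open_chart_image_Int[OF bB U(1)])
    have eq: "f (chart_inv b z) = g y (chart_inv c z) + k y" if z: "z \<in> snd b ` (U y \<inter> fst b)" for z
    proof -
      obtain x where x: "x \<in> U y" "x \<in> V" "z = snd c (p x)" using z b(1) by auto
      then have "p x \<in> fst c" using b(5) by blast
      then show ?thesis using x cover_chart_inv[OF b(2,4,5) x(2)] b(1,2) U(4)[OF x(1)] by simp
    qed
    have "smooth_on (snd b ` (U y \<inter> fst b)) (\<lambda>z. g y (chart_inv c z))"
      by (rule smooth_on_subset[OF smooth_map_onD[OF U(3)[of y] b(2)]]) (use b(1,5) in auto)
    then have "smooth_on (snd b ` (U y \<inter> fst b)) (\<lambda>z. g y (chart_inv c z) + k y)"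
      by (rule smooth_on_add[OF op _ smooth_on_const[OF op]])
    then show "smooth_on (snd b ` (U y \<inter> fst b)) (\<lambda>z. f (chart_inv b z))"
      using smooth_on_cong[OF op eq] by simp
  qed
  then have "smooth_map_on B (\<Union>y. U y) f" using U(1) by (intro C.smooth_map_on_UN) auto
  moreover have "(\<Union>y. U y) = UNIV" using U(2) by blast
  ultimately show ?thesis by simp
qed

section \<open>Integration of closed conformal forms on the cover\<close>

lemma smooth_primitive:
  assumes "open W" "smooth_form_on A UNIV \<omega>" "\<And>x. x \<in> W \<Longrightarrow> has_diff g x (\<omega> x)"
  shows "smooth_map_on A W g"
proof (rule smooth_map_onI)
  fix c assume c: "c \<in> A"
  show "smooth_on (snd c ` (W \<inter> fst c)) (\<lambda>z. g (chart_inv c z))"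
  proof (rule smooth_onI_derivative[OF open_chart_image_Int[OF c assms(1)]])
    fix z assume "z \<in> snd c ` (W \<inter> fst c)"
    then obtain x where x: "x \<in> W" "x \<in> fst c" "z = snd c x" by blast
    have "((g \<circ> chart_inv c) has_derivative (\<lambda>v. \<omega> x (chart_vector A c x v))) (at (snd c x))"
      using assms(3)[OF x(1)] has_diff_chart[OF c x(2)] by blast
    then show "((\<lambda>z. g (chart_inv c z)) has_derivative form_coord A c \<omega> z) (at z)"
      using x(2,3) c by (simp add: comp_def form_coord_def[abs_def])
  next
    show "smooth_on (snd c ` (W \<inter> fst c)) (\<lambda>z. form_coord A c \<omega> z v)" for v
      by (rule smooth_form_onD(2)[OF smooth_form_on_subset[OF assms(2)] c]) simp
  qed
qed

lemma cover_connected: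
  assumes "simply_connected (UNIV :: 'u set)"
  shows "connected (UNIV :: 'u set)"
proof -
  have "\<exists>\<gamma>. path \<gamma> \<and> pathstart \<gamma> = x \<and> pathfinish \<gamma> = y" for x y :: 'u
    by (rule simply_connected_imp_path[OF assms])
  then have "path_connected (UNIV :: 'u set)" by (simp add: path_connected_def)
  then show ?thesis by (rule path_connected_imp_connected)
qed

theorem closed_form_integrates:
  fixes \<omega> :: "'m \<Rightarrow> complex \<Rightarrow> quat"
  assumes sc: "simply_connected (UNIV :: 'u set)"
    and \<omega>: "\<omega> \<in> conformal_forms A" and cl: "closed_form A \<omega>"
  shows "\<exists>f. conformal_immersion_with_periods A p f \<and> differential B f = pullback_form A p \<omega>"
proof -
  have sm: "smooth_form_on A UNIV \<omega>" and conf: "\<And>x. conformal_linear (\<omega> x)" and im: "\<And>x X. qr (\<omega> x X) = 0"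
    using \<omega> by (auto simp: conformal_forms_def Im_quat_def)
  \<comment> \<open>A primitive of an imaginary form may have a nonzero, locally constant real part.
    Projecting to the imaginary quaternions removes it without changing the differential.\<close>
  define Im where "Im q = q - qr q *\<^sub>R (1::quat)" for q
  have Im_bl: "bounded_linear Im"
    by (auto intro!: linear_conv_bounded_linear[THEN iffD1] linearI simp: Im_def quat_eq_iff algebra_simps)
  have Im_qr: "qr (Im q) = 0" for q by (simp add: Im_def)
  \<comment> \<open>\<open>V\<close> may be any open set over which \<open>g\<close> is a primitive,
    not only a full preimage; it can then be shrunk to a path-connected disc of the cover.\<close>
  define \<G> where "\<G> = {(V, g \<circ> p) | V g. open V \<and> (\<forall>y\<in>V. has_diff g (p y) (\<omega> (p y)))}"
  have locpr: "\<exists>V g. open V \<and> x \<in> V \<and> (\<forall>y\<in>V. has_diff g y (\<omega> y))" for x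
    using local_primitive[OF sm cl] by metis
  interpret primitive_system \<G>
  proof
    show "open V" if "(V, g) \<in> \<G>" for V g using that by (auto simp: \<G>_def)
    fix y
    obtain V g where V: "open V" "p y \<in> V" "\<forall>y\<in>V. has_diff g y (\<omega> y)" using locpr by blast
    have "open (p -` V)" by (rule open_vimage[OF V(1) p_continuous])
    then have "(p -` V, g \<circ> p) \<in> \<G>" using V by (auto simp: \<G>_def)
    then show "\<exists>V g. (V, g) \<in> \<G> \<and> y \<in> V" using V(2) by blast
  next
    fix V g V' g' y assume *: "(V, g) \<in> \<G>" "(V', g') \<in> \<G>" "y \<in> V" "y \<in> V'"
    obtain h where h: "open V" "g = h \<circ> p" "\<And>y. y \<in> V \<Longrightarrow> has_diff h (p y) (\<omega> (p y))"
      using *(1) by (auto simp: \<G>_def)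
    obtain h' where h': "open V'" "g' = h' \<circ> p" "\<And>y. y \<in> V' \<Longrightarrow> has_diff h' (p y) (\<omega> (p y))"
      using *(2) by (auto simp: \<G>_def)
    have zero: "has_diff (\<lambda>x. h x - h' x) x (\<lambda>X. 0)" if "x \<in> p ` (V \<inter> V')" for x
    proof -
      obtain y where "y \<in> V" "y \<in> V'" "x = p y" using \<open>x \<in> _\<close> by blast
      then show ?thesis using has_diff_diff[OF h(3)[of y] h'(3)[of y]] by simp
    qed
    have op: "open (p ` (V \<inter> V'))" using h(1) h'(1) by (intro p_open) blast
    have mem: "p y \<in> p ` (V \<inter> V')" using *(3,4) by blast
    obtain W k where W: "open W" "p y \<in> W" "\<And>x. x \<in> W \<Longrightarrow> h x - h' x = k"
      using has_diff_zero_locally_constant[OF op mem zero] by blast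
    have "open (p -` W)" by (rule open_vimage[OF W(1) p_continuous])
    moreover have "g x = g' x + k" if "x \<in> p -` W" for x
      using W(3)[of "p x"] that h(2) h'(2) by (simp add: diff_eq_eq add.commute)
    ultimately show "\<exists>W k. open W \<and> y \<in> W \<and> (\<forall>y\<in>W. g y = g' y + k)"
      using W(2) by (intro exI[of _ "p -` W"] exI[of _ k]) simp
  qed
  obtain F where F: "\<And>V g. (V, g) \<in> \<G> \<Longrightarrow> path_connected V \<Longrightarrow> \<exists>k. \<forall>x\<in>V. F x = g x + k"
    using global_primitive[OF sc] by blast
  define f where "f y = Im (F y)" for y
  \<comment> \<open>The local primitive \<open>g\<close> is given in advance. This freedom lets one
    and the same \<open>g\<close> describe \<open>f\<close> at two points of a fibre.\<close>
  have loc: "\<exists>V k. open V \<and> y \<in> V \<and> V \<subseteq> p -` W \<and> (\<forall>x\<in>V. f x = Im (g (p x)) + k)"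
    if W: "open W" "p y \<in> W" "\<forall>x\<in>W. has_diff g x (\<omega> x)" for y W g
  proof -
    have "open (p -` W)" by (rule open_vimage[OF W(1) p_continuous])
    then obtain V where V: "open V" "y \<in> V" "V \<subseteq> p -` W \<inter> fst (chart_at B y)" "path_connected V"
      using C.chart_disc[OF C.chart_at, of "p -` W" y] W(2) by (metis vimageI)
    have "(V, g \<circ> p) \<in> \<G>" using V(1,3) W(3) by (auto simp: \<G>_def)
    then obtain k where "\<forall>x\<in>V. F x = (g \<circ> p) x + k" using F V(4) by blast
    then have "\<forall>x\<in>V. f x = Im (g (p x)) + Im k"
      by (simp add: f_def linear_add[OF bounded_linear.linear[OF Im_bl]])
    then show ?thesis using V by blast
  qed
  have Img: "has_diff (\<lambda>x. Im (g x)) x (\<omega> x)" if "has_diff g x (\<omega> x)" for g x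
    using has_diff_linear[OF that Im_bl] by (simp add: Im_def im)
  have df: "C.has_diff f y (pullback_form A p \<omega> y)" for y
  proof -
    obtain W g where W: "open W" "p y \<in> W" "\<forall>y\<in>W. has_diff g y (\<omega> y)" using locpr by blast
    obtain V k where V: "open V" "y \<in> V" "\<forall>x\<in>V. f x = Im (g (p x)) + k" using loc[OF W] by blast
    have "C.has_diff ((\<lambda>x. Im (g x)) \<circ> p) y (\<lambda>X. \<omega> (p y) (tangent_map B A p y X))"
      by (rule has_diff_cover[OF Img]) (use W in blast)
    from C.has_diff_add[OF this C.has_diff_const[of k]]
    have "C.has_diff (\<lambda>x. Im (g (p x)) + k) y (pullback_form A p \<omega> y)"
      by (simp add: pullback_form_def[abs_def])
    then show ?thesis by (rule C.has_diff_cong[OF _ V(1,2)]) (use V(3) in simp)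
  qed
  have diff: "differential B f = pullback_form A p \<omega>" using C.differential_eq[OF df] by (rule ext)
  have "conformal_immersion_with_periods A p f"
    unfolding conformal_immersion_with_periods_def
  proof (intro conjI allI impI)
    show "range f \<subseteq> Im_quat" by (auto simp: f_def Im_quat_def Im_qr)
    show "smooth_map_on B UNIV f"
    proof (rule smooth_map_on_cover)
      fix y
      obtain W g where W: "open W" "p y \<in> W" "\<forall>y\<in>W. has_diff g y (\<omega> y)" using locpr by blast
      obtain V k where V: "open V" "y \<in> V" "V \<subseteq> p -` W" "\<forall>x\<in>V. f x = Im (g (p x)) + k" using loc[OF W] by blast
      have "smooth_map_on A W (\<lambda>x. Im (g x))"
        by (rule smooth_primitive[OF W(1) sm]) (use W(3) Img in blast)
      then have "smooth_map_on A (p ` V) (\<lambda>x. Im (g x))" by (rule smooth_map_on_subset) (use V(3) in blast)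
      then show "\<exists>U g k. open U \<and> y \<in> U \<and> smooth_map_on A (p ` U) g \<and> (\<forall>y\<in>U. f y = g (p y) + k)"
        using V by (intro exI[of _ V] exI[of _ "\<lambda>x. Im (g x)"] exI[of _ k]) simp
    qed
    fix y
    obtain a where a: "a \<noteq> 0" "\<And>X. tangent_map B A p y X = a * X" using tangent_map_complex_linear[of y] by blast
    have "differential B f y = (\<lambda>X. \<omega> (p y) (a * X))" by (simp add: diff pullback_form_def[abs_def] a(2))
    then show "conformal_linear (differential B f y)" using conformal_linear_rotate[OF conf a(1)] by simp
  next
    fix \<gamma> assume \<gamma>: "deck_transformation p \<gamma>"
    have p\<gamma>: "p (\<gamma> y) = p y" for y using \<gamma> unfolding deck_transformation_def by (metis comp_apply)
    have cont: "continuous_on UNIV \<gamma>" using \<gamma> unfolding deck_transformation_def homeomorphism_def by blast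
    \<comment> \<open>Because \<open>p \<circ> \<gamma> = p\<close>, the same \<open>g\<close>
      describes \<open>f\<close> near \<open>y\<close> and near \<open>\<gamma> y\<close>. It
      cancels in the difference, which is therefore locally constant on a connected space.\<close>
    have "f (\<gamma> y) - f y = f (\<gamma> undefined) - f undefined" for y
    proof (rule connected_local_const[OF cover_connected[OF sc] UNIV_I UNIV_I, of "\<lambda>y. f (\<gamma> y) - f y"], intro ballI)
      fix y
      obtain W g where W: "open W" "p y \<in> W" "\<forall>y\<in>W. has_diff g y (\<omega> y)" using locpr by blast
      obtain V k where V: "open V" "y \<in> V" "\<forall>x\<in>V. f x = Im (g (p x)) + k" using loc[OF W] by blast
      obtain V' k' where V': "open V'" "\<gamma> y \<in> V'" "\<forall>x\<in>V'. f x = Im (g (p x)) + k'"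
        using loc[of W "\<gamma> y"] W p\<gamma> by metis
      have op: "open (\<gamma> -` V')" by (rule open_vimage[OF V'(1) cont])
      show "\<forall>\<^sub>F x in at y. f (\<gamma> y) - f y = f (\<gamma> x) - f x"
        unfolding eventually_at_topological
        by (rule exI[of _ "V \<inter> \<gamma> -` V'"]) (use V V' op p\<gamma> in auto)
    qed
    then show "\<exists>c. \<forall>y. f (\<gamma> y) - f y = c" by blast
  qed
  with diff show ?thesis by blast
qed

end

subsection \<open>Quaternion algebra\<close>

lemma qcnj_simps [simp]:
  "qcnj (qcnj a) = a" "qcnj (a * b) = qcnj b * qcnj a" "qcnj (a + b) = qcnj a + qcnj b"
  "qcnj (- a) = - qcnj a" "qcnj (a - b) = qcnj a - qcnj b" "qcnj (r *\<^sub>R a) = r *\<^sub>R qcnj a" "qcnj 1 = 1" "qcnj 0 = 0"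
  by (simp_all add: quat_eq_iff algebra_simps)

lemma mult_qcnj: "a * qcnj a = (norm a)\<^sup>2 *\<^sub>R 1" "qcnj a * a = (norm a)\<^sup>2 *\<^sub>R 1"
  unfolding power2_norm_eq_inner by (simp_all add: quat_eq_iff inner_quat_def algebra_simps)

lemma norm_qcnj [simp]: "norm (qcnj a) = norm a"
  by (simp add: norm_quat_def inner_quat_def)

lemma qcnj_eq_uminus_iff: "qcnj a = - a \<longleftrightarrow> qr a = 0"
  by (auto simp: quat_eq_iff)

lemma qcnj_eq_self: "qcnj a = a \<Longrightarrow> a = qr a *\<^sub>R 1"
  by (auto simp: quat_eq_iff)

text \<open>The imaginary part of n * n is twice \<open>qr n\<close> times that of n. With
  \<open>qr n\<close> nonzero, n would be real and have a positive square; so n is imaginary, and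
  its square is minus its squared norm.\<close>

lemma quat_square_minus_one:
  assumes "n * n = (- 1 :: quat)"
  shows "qcnj n = - n" "norm n = 1"
proof -
  have e: "qr n * qr n - qi n * qi n - qj n * qj n - qk n * qk n = - 1"
    "qr n * qi n = 0" "qr n * qj n = 0" "qr n * qk n = 0"
    using assms by (simp_all add: quat_eq_iff mult.commute)
  have r: "qr n = 0"
  proof (rule ccontr)
    assume "qr n \<noteq> 0"
    then have "qr n * qr n = - 1" using e by simp
    moreover have "0 \<le> qr n * qr n" by simp
    ultimately show False by linarith
  qed
  then show "qcnj n = - n" by (simp add: qcnj_eq_uminus_iff)
  show "norm n = 1" using e r by (simp add: norm_quat_def inner_quat_def)
qed

lemma qr_mult_commute: "qr (a * b) = qr (b * a)"
  by simp

lemma inner_quat_qcnj: "inner a b = qr (qcnj a * b)"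
  by (simp add: inner_quat_def)

text \<open>If qcnj a * u is a real number r, then so is its conjugate qcnj u * a; multiplying by u
  from the left gives |u|^2 a = r u.\<close>

lemma quat_eq_scaleR_of_real_product:
  assumes "qcnj (qcnj a * u) = qcnj a * u" "u \<noteq> 0"
  shows "a = (qr (qcnj a * u) / (norm u)\<^sup>2) *\<^sub>R u"
proof -
  let ?r = "qr (qcnj a * u)"
  have "qcnj a * u = ?r *\<^sub>R 1" by (rule qcnj_eq_self[OF assms(1)])
  then have "qcnj (qcnj a * u) = ?r *\<^sub>R 1" by (metis assms(1))
  then have "u * (qcnj u * a) = ?r *\<^sub>R u" by simp
  then have "(norm u)\<^sup>2 *\<^sub>R a = ?r *\<^sub>R u" by (simp add: mult.assoc[symmetric] mult_qcnj)
  then have "a = (1 / (norm u)\<^sup>2) *\<^sub>R (?r *\<^sub>R u)" using assms(2) by (metis divideR_right divide_inverse_commute inverse_eq_divide mult_1 norm_eq_zero power_eq_0_iff)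
  then show ?thesis by simp
qed

subsection \<open>Mean curvature of a conformal map\<close>

text \<open>Left multiplication by the imaginary N is skew-adjoint. With
  \<open>T \<i> = N * T 1\<close> both diagonal terms of the trace become inner products with
  \<open>T 1\<close>, and together they involve only the combination in the last hypothesis.\<close>

lemma mean_curvature_conformal:
  fixes S :: "complex \<Rightarrow> quat"
  assumes df: "differential B f y = T" and dn: "differential B n y = S"
    and lin: "linear S" and T: "conformal_linear T"
    and N: "qcnj N = - N" and Ti: "T \<i> = N * T 1"
    and S: "S 1 - N * S \<i> = (- 2 * h) *\<^sub>R T 1"
  shows "mean_curvature B f n y = h"
proof -
  obtain r where r: "r > 0" "\<And>v w. inner (T v) (T w) = r * inner v w" and T_lin: "linear T"
    using T unfolding conformal_linear_def by blast
  \<comment> \<open>The first fundamental form is \<open>r\<close> times the standard inner product,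
    so the defining equation of the shape operator is solved by testing it on \<open>1\<close> and
    \<open>\<i>\<close>.\<close>
  define S0 where "S0 X = Complex (- inner (S X) (T 1) / r) (- inner (S X) (T \<i>) / r)" for X
  have S0_lin: "linear S0"
    by (rule linearI) (auto simp: S0_def complex_eq_iff linear_add[OF lin] linear_scale[OF lin]
        inner_add_left add_divide_distrib diff_divide_distrib)
  have "shape_operator B f n y = S0"
    unfolding shape_operator_def first_fundamental_form_def second_fundamental_form_def df dn r(2)
  proof (rule the_equality)
    have "r * inner (S0 X) Y = - inner (S X) (T Y)" for X Y
      unfolding linear_complex_expand[OF T_lin, of Y] using r(1)
      by (simp add: S0_def inner_complex_def inner_add_right field_simps)
    then show "linear S0 \<and> (\<forall>X Y. r * inner (S0 X) Y = - inner (S X) (T Y))" using S0_lin by blast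
    fix S' assume S': "linear S' \<and> (\<forall>X Y. r * inner (S' X) Y = - inner (S X) (T Y))"
    show "S' = S0"
    proof
      fix X
      have "r * Re (S' X) = - inner (S X) (T 1)" "r * Im (S' X) = - inner (S X) (T \<i>)"
        using S'[THEN conjunct2, rule_format, of X 1] S'[THEN conjunct2, rule_format, of X \<i>]
        by (simp_all add: inner_complex_def)
      then show "S' X = S0 X" using r(1) by (simp add: S0_def complex_eq_iff field_simps)
    qed
  qed
  then have "mean_curvature B f n y = - (inner (S 1) (T 1) + inner (S \<i>) (T \<i>)) / (2 * r)"
    by (simp add: mean_curvature_def Basis_complex_def S0_def inner_complex_def add_divide_distrib diff_divide_distrib)
  also have "inner (S \<i>) (T \<i>) = - inner (N * S \<i>) (T 1)"
    unfolding Ti inner_quat_qcnj by (simp add: N mult.assoc)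
  also have "inner (S 1) (T 1) + - inner (N * S \<i>) (T 1) = inner (S 1 - N * S \<i>) (T 1)"
    by (simp add: inner_diff_left)
  also have "\<dots> = - 2 * h * r" unfolding S by (simp add: r(2))
  finally show ?thesis using r(1) by simp
qed

subsection \<open>Spin bundles with a nowhere vanishing section\<close>

locale spinor = atlas A for A :: "'m::topological_space chart set" +
  fixes L :: "('m, 'l) pairing_bundle"
    and J :: "'l \<Rightarrow> 'l"
    and dbar :: "('m \<Rightarrow> 'l) \<Rightarrow> 'm \<Rightarrow> complex \<Rightarrow> 'l"
    and \<psi> :: "'m \<Rightarrow> 'l"
  assumes spin: "spin_bundle A L"
    and compl: "spin_complex_structure A L J"
    and dirac: "dirac_structure A L J dbar"
    and psi: "\<psi> \<in> sections A L"
    and psi_nz: "\<not> fzero L (\<psi> x)"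
begin

lemmas qline = spin[unfolded spin_bundle_def, THEN conjunct1]
lemmas pairing_smooth = spin[unfolded spin_bundle_def, THEN conjunct2, THEN conjunct1]
lemmas pairing_linear = spin[unfolded spin_bundle_def, THEN conjunct2, THEN conjunct2, THEN conjunct1, rule_format]
lemmas pairing_scale = spin[unfolded spin_bundle_def, THEN conjunct2, THEN conjunct2, THEN conjunct2, THEN conjunct2, THEN conjunct1, rule_format]
lemmas pairing_cnj = spin[unfolded spin_bundle_def, THEN conjunct2, THEN conjunct2, THEN conjunct2, THEN conjunct2, THEN conjunct2, THEN conjunct1, rule_format]
lemmas pairing_nonzero = spin[unfolded spin_bundle_def, THEN conjunct2, THEN conjunct2, THEN conjunct2, THEN conjunct2, THEN conjunct2, THEN conjunct2, THEN conjunct1, rule_format]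
lemmas pairing_conformal = spin[unfolded spin_bundle_def, THEN conjunct2, THEN conjunct2, THEN conjunct2, THEN conjunct2, THEN conjunct2, THEN conjunct2, THEN conjunct2, rule_format]
lemmas J_scale = compl[unfolded spin_complex_structure_def, THEN conjunct2, THEN conjunct2, THEN conjunct1, rule_format]
lemmas J_smooth = compl[unfolded spin_complex_structure_def, THEN conjunct2, THEN conjunct2, THEN conjunct2, THEN conjunct1]
lemmas J_J = compl[unfolded spin_complex_structure_def, THEN conjunct2, THEN conjunct2, THEN conjunct2, THEN conjunct2, THEN conjunct1, rule_format]
lemmas pairing_J = compl[unfolded spin_complex_structure_def, THEN conjunct2, THEN conjunct2, THEN conjunct2, THEN conjunct2, THEN conjunct2, rule_format]
lemmas proj_J [simp] = compl[unfolded spin_complex_structure_def, THEN conjunct1, rule_format]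
lemmas proj_scale [simp] = qline[unfolded qline_bundle_def, THEN conjunct2, THEN conjunct1, rule_format]
lemmas trivs_cover = qline[unfolded qline_bundle_def, THEN conjunct2, THEN conjunct2, THEN conjunct1]
lemmas trivs_trivial = qline[unfolded qline_bundle_def, THEN conjunct2, THEN conjunct2, THEN conjunct2, THEN conjunct1]
lemmas qh = dirac[unfolded dirac_structure_def, THEN conjunct1]
lemmas dbar_J = dirac[unfolded dirac_structure_def, THEN conjunct2, rule_format]
lemmas qh_Kbar = qh[unfolded qh_spin_structure_def, THEN conjunct1]
lemmas qh_add = qh[unfolded qh_spin_structure_def, THEN conjunct2, THEN conjunct1, rule_format]
lemmas qh_scale = qh[unfolded qh_spin_structure_def, THEN conjunct2, THEN conjunct2, THEN conjunct1, rule_format]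
lemmas qh_leibniz = qh[unfolded qh_spin_structure_def, THEN conjunct2, THEN conjunct2, THEN conjunct2, THEN conjunct1, rule_format]
lemmas qh_pairing = qh[unfolded qh_spin_structure_def, THEN conjunct2, THEN conjunct2, THEN conjunct2, THEN conjunct2, rule_format]

lemma proj_add [simp]: "proj L a = proj L b \<Longrightarrow> proj L (fadd L a b) = proj L b"
  using qline[unfolded qline_bundle_def, THEN conjunct1, rule_format, of a b] by simp

lemma proj_psi [simp]: "proj L (\<psi> x) = x"
  using psi unfolding sections_def smooth_section_on_def by blast

lemma trivE:
  obtains U \<tau> where "(U, \<tau>) \<in> trivs L" "x \<in> U"
proof -
  have "x \<in> (\<Union>t\<in>trivs L. fst t)" unfolding trivs_cover by simp
  then show ?thesis using that by auto
qed

lemma triv: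
  assumes "(U, \<tau>) \<in> trivs L"
  shows "open U"
    and "proj L a \<in> U \<Longrightarrow> proj L a = proj L b \<Longrightarrow> \<tau> (fadd L a b) = \<tau> a + \<tau> b"
    and "proj L a \<in> U \<Longrightarrow> \<tau> (fscale L a q) = \<tau> a * q"
    and "proj L a \<in> U \<Longrightarrow> proj L a = proj L b \<Longrightarrow> \<tau> a = \<tau> b \<Longrightarrow> a = b"
proof -
  note t = bspec[OF trivs_trivial assms, unfolded case_prod_conv]
  note * = t[THEN conjunct1] t[THEN conjunct2, THEN conjunct1]
    t[THEN conjunct2, THEN conjunct2, THEN conjunct1] t[THEN conjunct2, THEN conjunct2, THEN conjunct2]
  show "open U" by (rule *(1))
  show "proj L a \<in> U \<Longrightarrow> proj L a = proj L b \<Longrightarrow> \<tau> (fadd L a b) = \<tau> a + \<tau> b" using *(3) by simp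
  show "proj L a \<in> U \<Longrightarrow> \<tau> (fscale L a q) = \<tau> a * q" using *(4) by simp
  assume "proj L a \<in> U" "proj L a = proj L b" "\<tau> a = \<tau> b"
  then show "a = b" using bspec[OF *(2), of "proj L a"] unfolding bij_betw_def inj_on_def by simp
qed

section \<open>The global coordinate of the bundle in the frame \<psi>\<close>

lemma triv_psi_nonzero:
  assumes "(U, \<tau>) \<in> trivs L" "x \<in> U"
  shows "\<tau> (\<psi> x) \<noteq> 0"
proof
  assume "\<tau> (\<psi> x) = 0"
  then have "\<tau> (fscale L (\<psi> x) 0) = \<tau> (\<psi> x)" using triv(3)[OF assms(1)] assms(2) by simp
  then have "fscale L (\<psi> x) 0 = \<psi> x" using triv(4)[OF assms(1)] assms(2) by simp
  then show False using psi_nz by (simp add: fzero_def)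
qed

text \<open>The coordinate of \<open>a\<close> in the frame \<psi>. Through \<open>kappa_eqI\<close>
  every identity between bundle elements over one point becomes an identity of quaternions.\<close>

definition \<kappa> :: "'l \<Rightarrow> quat" where
  "\<kappa> a = (THE q. fscale L (\<psi> (proj L a)) q = a)"

lemma scale_psi_inj: "fscale L (\<psi> x) q = fscale L (\<psi> x) q' \<Longrightarrow> q = q'"
proof -
  assume eq: "fscale L (\<psi> x) q = fscale L (\<psi> x) q'"
  obtain U \<tau> where U: "(U, \<tau>) \<in> trivs L" "x \<in> U" by (rule trivE)
  have "\<tau> (\<psi> x) * q = \<tau> (\<psi> x) * q'" using triv(3)[OF U(1)] U(2) eq by (metis proj_psi)
  then show "q = q'" using triv_psi_nonzero[OF U] by simp
qed

lemma kappa_scale_psi [simp]: "\<kappa> (fscale L (\<psi> x) q) = q"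
  unfolding \<kappa>_def by (rule the_equality) (auto dest: scale_psi_inj)

lemma scale_kappa: "fscale L (\<psi> (proj L a)) (\<kappa> a) = a"
proof -
  obtain U \<tau> where U: "(U, \<tau>) \<in> trivs L" "proj L a \<in> U" by (rule trivE)
  have "fscale L (\<psi> (proj L a)) (inverse (\<tau> (\<psi> (proj L a))) * \<tau> a) = a"
    using triv_psi_nonzero[OF U] by (intro triv(4)[OF U(1)]) (simp_all add: U triv(3)[OF U(1)] mult.assoc[symmetric])
  then show ?thesis by (metis kappa_scale_psi)
qed

lemma triv_kappa: "(U, \<tau>) \<in> trivs L \<Longrightarrow> proj L a \<in> U \<Longrightarrow> \<tau> a = \<tau> (\<psi> (proj L a)) * \<kappa> a"
  by (metis scale_kappa triv(3) proj_psi)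

lemma kappa_eqI: "proj L a = proj L b \<Longrightarrow> \<kappa> a = \<kappa> b \<Longrightarrow> a = b"
  by (metis scale_kappa)

lemma kappa_scale [simp]: "\<kappa> (fscale L a q) = \<kappa> a * q"
proof -
  obtain U \<tau> where U: "(U, \<tau>) \<in> trivs L" "proj L a \<in> U" by (rule trivE)
  have "\<tau> (\<psi> (proj L a)) * \<kappa> (fscale L a q) = \<tau> (\<psi> (proj L a)) * (\<kappa> a * q)"
  proof -
    have "\<tau> (\<psi> (proj L a)) * \<kappa> (fscale L a q) = \<tau> (fscale L a q)"
      using triv_kappa[OF U(1), of "fscale L a q"] U(2) by simp
    also have "\<dots> = \<tau> a * q" by (rule triv(3)[OF U])
    also have "\<dots> = \<tau> (\<psi> (proj L a)) * (\<kappa> a * q)" using triv_kappa[OF U] by (simp add: mult.assoc)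
    finally show ?thesis .
  qed
  then show ?thesis using triv_psi_nonzero[OF U] by simp
qed

lemma kappa_add [simp]: "proj L a = proj L b \<Longrightarrow> \<kappa> (fadd L a b) = \<kappa> a + \<kappa> b"
proof -
  assume ab: "proj L a = proj L b"
  obtain U \<tau> where U: "(U, \<tau>) \<in> trivs L" "proj L a \<in> U" by (rule trivE)
  have "\<tau> (\<psi> (proj L a)) * \<kappa> (fadd L a b) = \<tau> (\<psi> (proj L a)) * (\<kappa> a + \<kappa> b)"
    using triv_kappa[OF U(1), of "fadd L a b"] triv_kappa[OF U] triv_kappa[OF U(1), of b] triv(2)[OF U ab] U(2) ab
    by (simp add: distrib_left)
  then show ?thesis using triv_psi_nonzero[OF U] by simp
qed

text \<open>Evaluating the coordinate of \<psi> scaled by its own coordinate in two ways shows that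
  this coordinate is idempotent; it is nonzero, and the quaternions have no zero divisors.\<close>

lemma kappa_psi [simp]: "\<kappa> (\<psi> x) = 1"
proof -
  have "\<kappa> (\<psi> x) * \<kappa> (\<psi> x) = \<kappa> (\<psi> x)"
    by (rule trans[OF kappa_scale[symmetric] kappa_scale_psi])
  moreover have "\<kappa> (\<psi> x) \<noteq> 0"
  proof
    assume "\<kappa> (\<psi> x) = 0"
    then have "fscale L (\<psi> x) 0 = \<psi> x" using scale_kappa[of "\<psi> x"] by simp
    then show False using psi_nz by (simp add: fzero_def)
  qed
  ultimately show ?thesis by simp
qed

lemma fzero_iff: "fzero L a \<longleftrightarrow> \<kappa> a = 0"
proof
  assume "fzero L a"
  then show "\<kappa> a = 0" using kappa_scale[of a 0] by (simp add: fzero_def)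
next
  assume "\<kappa> a = 0"
  then show "fzero L a" unfolding fzero_def by (intro kappa_eqI) simp_all
qed

definition N :: "'m \<Rightarrow> quat" where "N x = - \<kappa> (J (\<psi> x))"

definition \<omega> :: "'m \<Rightarrow> complex \<Rightarrow> quat" where "\<omega> x = pairing L (\<psi> x) (\<psi> x)"

definition \<alpha> :: "'m \<Rightarrow> complex \<Rightarrow> quat" where "\<alpha> x X = \<kappa> (dbar \<psi> x X)"

text \<open>J is right linear, so its value on the frame determines it: in coordinates it is left
  multiplication by -N, the formula of \<open>induced_J\<close>.\<close>

lemma kappa_J [simp]: "\<kappa> (J a) = - (N (proj L a) * \<kappa> a)"
proof -
  have "J a = fscale L (J (\<psi> (proj L a))) (\<kappa> a)"
    using J_scale[of "\<psi> (proj L a)" "\<kappa> a"] scale_kappa[of a] by simp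
  then show ?thesis by (simp add: N_def)
qed

lemma N_square: "N x * N x = - 1"
proof -
  have "J (J (\<psi> x)) = fscale L (\<psi> x) (- 1)" by (rule J_J)
  then have "\<kappa> (J (J (\<psi> x))) = - 1" by (simp only: kappa_scale_psi)
  then show ?thesis by simp
qed

lemma N_square_mult: "N x * (N x * q) = - q"
  by (simp add: mult.assoc[symmetric] N_square)

lemma N_cnj [simp]: "qcnj (N x) = - N x" and N_norm: "norm (N x) = 1"
  using quat_square_minus_one[OF N_square] by blast+

lemma J_psi: "J (\<psi> x) = fscale L (\<psi> x) (- N x)"
  by (rule kappa_eqI) simp_all

lemma pairing_kappa:
  assumes "proj L a = x" "proj L b = x"
  shows "pairing L a b X = qcnj (\<kappa> a) * \<omega> x X * \<kappa> b"
proof -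
  have "pairing L (fscale L (\<psi> x) (\<kappa> a)) (fscale L (\<psi> x) (\<kappa> b)) X = qcnj (\<kappa> a) * pairing L (\<psi> x) (\<psi> x) X * \<kappa> b"
    by (rule pairing_scale) simp
  moreover have "fscale L (\<psi> x) (\<kappa> a) = a" "fscale L (\<psi> x) (\<kappa> b) = b" 
    using scale_kappa[of a] scale_kappa[of b] assms by simp_all
  ultimately show ?thesis by (simp add: \<omega>_def)
qed

lemma omega_linear: "linear (\<omega> x)"
  unfolding \<omega>_def by (rule pairing_linear) simp

lemma omega_cnj [simp]: "qcnj (\<omega> x X) = - \<omega> x X"
  unfolding \<omega>_def by (rule pairing_cnj) simp

text \<open>J may be moved into either slot of the pairing. The first slot is conjugated and
  contributes qcnj (-N) = N on the left, the second contributes -N on the right.\<close>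

lemma omega_star: "\<omega> x (\<i> * X) = N x * \<omega> x X" "\<omega> x (\<i> * X) = - (\<omega> x X * N x)"
proof -
  have "pairing L (\<psi> x) (\<psi> x) (\<i> * X) = pairing L (J (\<psi> x)) (\<psi> x) X \<and>
        pairing L (\<psi> x) (\<psi> x) (\<i> * X) = pairing L (\<psi> x) (J (\<psi> x)) X"
    by (rule pairing_J) simp
  then have "\<omega> x (\<i> * X) = pairing L (J (\<psi> x)) (\<psi> x) X" "\<omega> x (\<i> * X) = pairing L (\<psi> x) (J (\<psi> x)) X"
    unfolding \<omega>_def by (rule conjunct1, rule conjunct2)
  then show "\<omega> x (\<i> * X) = N x * \<omega> x X" "\<omega> x (\<i> * X) = - (\<omega> x X * N x)"
    by (simp_all add: pairing_kappa[of _ x])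
qed

lemma omega_N: "\<omega> x X * N x = - (N x * \<omega> x X)"
  using omega_star[of x X] by (metis minus_minus)

lemma omega_nonzero: "X \<noteq> 0 \<Longrightarrow> \<omega> x X \<noteq> 0"
  unfolding \<omega>_def by (rule pairing_nonzero) (simp add: psi_nz)

lemma omega_norm: "\<exists>r>0. \<forall>X. (norm (\<omega> x X))\<^sup>2 = r * (norm X)\<^sup>2"
  unfolding \<omega>_def by (rule pairing_conformal[OF psi_nz])

text \<open>In a trivialisation the frame has a smooth, nowhere vanishing coordinate; multiplying by
  it or by its inverse passes between the local coordinate of a section and the global one.\<close>

lemma smooth_section_iff:
  assumes U: "open U"
  shows "smooth_section_on A L U s \<longleftrightarrow> (\<forall>x\<in>U. proj L (s x) = x) \<and> smooth_map_on A U (\<lambda>x. \<kappa> (s x))"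
proof -
  have psi_sm: "smooth_map_on A (U \<inter> V) (\<lambda>x. \<tau> (\<psi> x))" if "(V, \<tau>) \<in> trivs L" for V \<tau>
  proof -
    have "smooth_map_on A (UNIV \<inter> V) (\<tau> \<circ> \<psi>)"
      using psi that unfolding sections_def smooth_section_on_def by fast
    then show ?thesis using smooth_map_on_subset[of "UNIV \<inter> V" "\<tau> \<circ> \<psi>" "U \<inter> V"] by (simp add: comp_def)
  qed
  show ?thesis
  proof
    assume s: "smooth_section_on A L U s"
    then have pr: "\<forall>x\<in>U. proj L (s x) = x" unfolding smooth_section_on_def by blast
    have "smooth_map_on A (U \<inter> fst t) (\<lambda>x. \<kappa> (s x))" if "t \<in> trivs L" for t
    proof -
      obtain V \<tau> where t: "t = (V, \<tau>)" "(V, \<tau>) \<in> trivs L" 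
        using \<open>t \<in> trivs L\<close> by (metis prod.collapse)
      have op: "open (U \<inter> V)" using U triv(1)[OF t(2)] by blast
      have sm: "smooth_map_on A (U \<inter> V) (\<lambda>x. \<tau> (s x))"
        using s t(2) unfolding smooth_section_on_def by (auto simp: comp_def)
      have inv: "smooth_map_on A (U \<inter> V) (\<lambda>x. inverse (\<tau> (\<psi> x)))"
        by (rule smooth_map_on_inverse[OF op psi_sm[OF t(2)]]) (use triv_psi_nonzero[OF t(2)] in blast)
      have "smooth_map_on A (U \<inter> V) (\<lambda>x. inverse (\<tau> (\<psi> x)) * \<tau> (s x))"
        by (rule smooth_map_on_bilinear[OF bounded_bilinear_mult op inv sm])
      moreover have "inverse (\<tau> (\<psi> x)) * \<tau> (s x) = \<kappa> (s x)" if "x \<in> U \<inter> V" for x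
        using triv_kappa[OF t(2), of "s x"] pr that triv_psi_nonzero[OF t(2), of x]
        by (simp add: mult.assoc[symmetric])
      ultimately show ?thesis unfolding t(1) fst_conv
        by (rule smooth_map_on_cong[OF op, rotated])
    qed
    then have "smooth_map_on A (\<Union>t\<in>trivs L. U \<inter> fst t) (\<lambda>x. \<kappa> (s x))"
      using U triv(1) by (intro smooth_map_on_UN) (auto intro!: open_Int)
    moreover have "(\<Union>t\<in>trivs L. U \<inter> fst t) = U" using trivs_cover by blast
    ultimately show "(\<forall>x\<in>U. proj L (s x) = x) \<and> smooth_map_on A U (\<lambda>x. \<kappa> (s x))" using pr by simp
  next
    assume s: "(\<forall>x\<in>U. proj L (s x) = x) \<and> smooth_map_on A U (\<lambda>x. \<kappa> (s x))"
    have "smooth_map_on A (U \<inter> V) (\<tau> \<circ> s)" if t: "(V, \<tau>) \<in> trivs L" for V \<tau>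
    proof -
      have op: "open (U \<inter> V)" using U triv(1)[OF t] by blast
      have "smooth_map_on A (U \<inter> V) (\<lambda>x. \<kappa> (s x))" by (rule smooth_map_on_subset[OF conjunct2[OF s]]) simp
      from smooth_map_on_bilinear[OF bounded_bilinear_mult op psi_sm[OF t] this]
      have "smooth_map_on A (U \<inter> V) (\<lambda>x. \<tau> (\<psi> x) * \<kappa> (s x))" .
      then show ?thesis
      proof (rule smooth_map_on_cong[OF op, rotated])
        show "\<tau> (\<psi> x) * \<kappa> (s x) = (\<tau> \<circ> s) x" if "x \<in> U \<inter> V" for x
          using triv_kappa[OF t, of "s x"] s that by simp
      qed
    qed
    then show "smooth_section_on A L U s" using s unfolding smooth_section_on_def by blast
  qed
qed

lemma sections_iff: "s \<in> sections A L \<longleftrightarrow> (\<forall>x. proj L (s x) = x) \<and> smooth_map_on A UNIV (\<lambda>x. \<kappa> (s x))"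
  unfolding sections_def by (simp add: smooth_section_iff)

lemma smooth_lform_iff:
  "smooth_lform A L \<mu> \<longleftrightarrow> (\<forall>x X. proj L (\<mu> x X) = x) \<and> smooth_form_on A UNIV (\<lambda>x X. \<kappa> (\<mu> x X))"
proof -
  have psi_sm: "smooth_map_on A V (\<lambda>x. \<tau> (\<psi> x))" if "(V, \<tau>) \<in> trivs L" for V \<tau>
  proof -
    have "smooth_map_on A (UNIV \<inter> V) (\<tau> \<circ> \<psi>)"
      using psi that unfolding sections_def smooth_section_on_def by fast
    then show ?thesis by (simp add: comp_def)
  qed
  show ?thesis
  proof
    assume s: "smooth_lform A L \<mu>"
    then have pr: "\<forall>x X. proj L (\<mu> x X) = x" unfolding smooth_lform_def by blast
    have "smooth_form_on A (fst t) (\<lambda>x X. \<kappa> (\<mu> x X))" if "t \<in> trivs L" for t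
    proof -
      obtain V \<tau> where t: "t = (V, \<tau>)" "(V, \<tau>) \<in> trivs L" 
        using \<open>t \<in> trivs L\<close> by (metis prod.collapse)
      have op: "open V" using triv(1)[OF t(2)] .
      have sm: "smooth_form_on A V (\<lambda>x X. \<tau> (\<mu> x X))"
        using s t(2) unfolding smooth_lform_def by fast
      have inv: "smooth_map_on A V (\<lambda>x. inverse (\<tau> (\<psi> x)))"
        by (rule smooth_map_on_inverse[OF op psi_sm[OF t(2)]]) (use triv_psi_nonzero[OF t(2)] in blast)
      have "smooth_form_on A V (\<lambda>x X. inverse (\<tau> (\<psi> x)) * \<tau> (\<mu> x X))"
        by (rule smooth_form_on_bilinear[OF bounded_bilinear_mult op inv sm])
      moreover have "inverse (\<tau> (\<psi> x)) * \<tau> (\<mu> x X) = \<kappa> (\<mu> x X)" if "x \<in> V" for x X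
        using triv_kappa[OF t(2), of "\<mu> x X"] pr that triv_psi_nonzero[OF t(2), of x]
        by (simp add: mult.assoc[symmetric])
      ultimately show ?thesis unfolding t(1) fst_conv
        by (rule smooth_form_on_cong[OF op, rotated])
    qed
    then have "smooth_form_on A (\<Union>t\<in>trivs L. fst t) (\<lambda>x X. \<kappa> (\<mu> x X))"
      using triv(1) by (intro smooth_form_on_UN) auto
    moreover have "(\<Union>t\<in>trivs L. fst t) = UNIV" by (rule trivs_cover)
    ultimately show "(\<forall>x X. proj L (\<mu> x X) = x) \<and> smooth_form_on A UNIV (\<lambda>x X. \<kappa> (\<mu> x X))" using pr by simp
  next
    assume s: "(\<forall>x X. proj L (\<mu> x X) = x) \<and> smooth_form_on A UNIV (\<lambda>x X. \<kappa> (\<mu> x X))"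
    have "smooth_form_on A V (\<lambda>x X. \<tau> (\<mu> x X))" if t: "(V, \<tau>) \<in> trivs L" for V \<tau>
    proof -
      have op: "open V" using triv(1)[OF t] .
      have "smooth_form_on A V (\<lambda>x X. \<kappa> (\<mu> x X))" by (rule smooth_form_on_subset[OF conjunct2[OF s]]) simp
      from smooth_form_on_bilinear[OF bounded_bilinear_mult op psi_sm[OF t] this]
      have "smooth_form_on A V (\<lambda>x X. \<tau> (\<psi> x) * \<kappa> (\<mu> x X))" .
      then show ?thesis
      proof (rule smooth_form_on_cong[OF op, rotated])
        show "\<tau> (\<psi> x) * \<kappa> (\<mu> x X) = \<tau> (\<mu> x X)" if "x \<in> V" for x X
          using triv_kappa[OF t, of "\<mu> x X"] s that by simp
      qed
    qed
    then show "smooth_lform A L \<mu>" using s unfolding smooth_lform_def by blast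
  qed
qed

lemma omega_smooth: "smooth_form_on A UNIV \<omega>"
proof -
  have "smooth_section_on A L UNIV \<psi>" using psi by (simp add: sections_def)
  then show ?thesis using pairing_smooth unfolding \<omega>_def[abs_def] by blast
qed

text \<open>The bundle axioms control only the norm of \<omega>; polarisation yields the inner
  products.\<close>

lemma omega_conformal: "conformal_linear (\<omega> x)"
proof -
  obtain r where r: "r > 0" "\<And>X. (norm (\<omega> x X))\<^sup>2 = r * (norm X)\<^sup>2" using omega_norm by blast
  have "inner (\<omega> x v) (\<omega> x w) = r * inner v w" for v w
  proof -
    have "(norm (\<omega> x v + \<omega> x w))\<^sup>2 = r * (norm (v + w))\<^sup>2" using r(2)[of "v + w"] by (simp add: linear_add[OF omega_linear])
    then have "(norm (\<omega> x v))\<^sup>2 + 2 * inner (\<omega> x v) (\<omega> x w) + (norm (\<omega> x w))\<^sup>2 = r * ((norm v)\<^sup>2 + 2 * inner v w + (norm w)\<^sup>2)"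
      by (simp add: power2_norm_eq_inner inner_add_left inner_add_right inner_commute add_ac)
    then show ?thesis by (simp add: r(2) algebra_simps)
  qed
  moreover have "inj (\<omega> x)"
    using linear_injective_0[OF omega_linear] omega_nonzero by blast
  ultimately show ?thesis unfolding conformal_linear_def using omega_linear r(1) by blast
qed

lemma omega_conformal_forms: "\<omega> \<in> conformal_forms A"
  unfolding conformal_forms_def Im_quat_def
  using omega_smooth omega_conformal qcnj_eq_uminus_iff[THEN iffD1, OF omega_cnj] by auto

lemma N_smooth: "smooth_map_on A UNIV N"
proof -
  have "smooth_section_on A L UNIV (J \<circ> \<psi>)"
    using J_smooth psi unfolding sections_def by blast
  then have "smooth_map_on A UNIV (\<lambda>x. - \<kappa> (J (\<psi> x)))"
    using smooth_section_iff[OF open_UNIV, of "J \<circ> \<psi>"]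
      smooth_map_on_linear[OF bounded_linear_minus[OF bounded_linear_ident] open_UNIV, of "\<lambda>x. \<kappa> (J (\<psi> x))"]
    by (simp only: comp_apply)
  then show ?thesis unfolding N_def[abs_def] .
qed

section \<open>The Dirac operator and the closedness equation in the frame\<close>

lemma dbar_Kbar:
  assumes "\<phi> \<in> sections A L"
  shows "proj L (dbar \<phi> x X) = x" "smooth_form_on A UNIV (\<lambda>x X. \<kappa> (dbar \<phi> x X))"
    "\<kappa> (dbar \<phi> x (\<i> * X)) = N x * \<kappa> (dbar \<phi> x X)"
proof -
  have K: "dbar \<phi> \<in> Kbar_forms A L J" using qh_Kbar assms by blast
  then have sm: "(\<forall>x X. proj L (dbar \<phi> x X) = x) \<and> smooth_form_on A UNIV (\<lambda>x X. \<kappa> (dbar \<phi> x X))"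
    unfolding Kbar_forms_def by (simp add: smooth_lform_iff)
  then show "proj L (dbar \<phi> x X) = x" "smooth_form_on A UNIV (\<lambda>x X. \<kappa> (dbar \<phi> x X))" by blast+
  have "dbar \<phi> x (\<i> * X) = fscale L (J (dbar \<phi> x X)) (- 1)" using K unfolding Kbar_forms_def by blast
  then show "\<kappa> (dbar \<phi> x (\<i> * X)) = N x * \<kappa> (dbar \<phi> x X)" using sm by simp
qed

lemma kappa_part01:
  "\<kappa> (part01 L J (\<lambda>x X. fscale L (\<phi> x) (\<mu> x X)) x X) =
    (\<kappa> (\<phi> x) * \<mu> x X - N (proj L (\<phi> x)) * (\<kappa> (\<phi> x) * \<mu> x (\<i> * X))) * (1 / 2)"
  by (simp add: part01_def)

lemma proj_part01:
  "proj L (part01 L J (\<lambda>x X. fscale L (\<phi> x) (\<mu> x X)) x X) = proj L (\<phi> x)"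
  by (simp add: part01_def)

lemma dbar_leibniz:
  assumes "\<phi> \<in> sections A L" "smooth_map_on A UNIV q"
  shows "dbar (\<lambda>x. fscale L (\<phi> x) (q x)) x X = fadd L (fscale L (dbar \<phi> x X) (q x))
               (part01 L J (\<lambda>x X. fscale L (\<phi> x) (differential A q x X)) x X)"
  by (rule qh_leibniz[OF assms])

text \<open>Every section is the frame times its coordinate, so by the Leibniz rule the operator is
  known once \<alpha>, its value on the frame, is known.\<close>

lemma kappa_dbar:
  assumes "\<phi> \<in> sections A L"
  defines "b \<equiv> \<lambda>x. \<kappa> (\<phi> x)"
  shows "\<kappa> (dbar \<phi> x X) = \<alpha> x X * b x + (differential A b x X - N x * differential A b x (\<i> * X)) * (1 / 2)"
proof -
  have pr: "\<forall>x. proj L (\<phi> x) = x" and sm: "smooth_map_on A UNIV b"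
    using assms(1) by (simp_all add: sections_iff b_def)
  have "\<phi> = (\<lambda>x. fscale L (\<psi> x) (b x))"
    by (rule ext, rule kappa_eqI) (simp_all add: pr b_def)
  then have "dbar \<phi> x X = fadd L (fscale L (dbar \<psi> x X) (b x))
               (part01 L J (\<lambda>x X. fscale L (\<psi> x) (differential A b x X)) x X)"
    using dbar_leibniz[OF psi sm, of x X] by simp
  then show ?thesis
    by (simp add: dbar_Kbar(1)[OF psi] proj_part01 kappa_part01 \<alpha>_def)
qed

lemma alpha_star: "\<alpha> x (\<i> * X) = N x * \<alpha> x X"
  unfolding \<alpha>_def by (rule dbar_Kbar(3)[OF psi])

lemma ext_deriv_omega:
  "ext_deriv A \<omega> x X Y = qcnj (\<alpha> x X) * \<omega> x Y - qcnj (\<alpha> x Y) * \<omega> x X + (\<omega> x Y * \<alpha> x X - \<omega> x X * \<alpha> x Y)"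
proof -
  have "ext_deriv A (\<lambda>x. pairing L (\<psi> x) (\<psi> x)) x X Y =
        form_pairing L (dbar \<psi>) \<psi> x X Y + pairing_form L \<psi> (dbar \<psi>) x X Y"
    by (rule qh_pairing[OF psi psi])
  then show ?thesis
    by (simp add: form_pairing_def pairing_form_def pairing_kappa[of _ x] dbar_Kbar(1)[OF psi]
        \<alpha>_def \<omega>_def[abs_def, symmetric])
qed

lemma nonlinear_dirac_iff:
  "nonlinear_dirac_equation L J dbar H \<psi> \<longleftrightarrow> (\<forall>x X. \<alpha> x X = (H x / 2) *\<^sub>R (N x * \<omega> x X))"
  unfolding nonlinear_dirac_equation_def dirac_potential_def fzero_iff
  by (simp add: dbar_Kbar(1)[OF psi] \<alpha>_def \<omega>_def)

text \<open>Since qcnj (N\<omega>) = \<omega>N, inserting \<alpha> = 1/2 H N\<omega> makes the four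
  terms of \<open>ext_deriv_omega\<close> cancel in pairs, for any two tangent vectors.\<close>

lemma dirac_imp_closed:
  assumes "nonlinear_dirac_equation L J dbar H \<psi>"
  shows "closed_form A \<omega>"
  unfolding closed_form_def ext_deriv_omega
  using assms unfolding nonlinear_dirac_iff by (simp add: mult.assoc[symmetric])

lemma closed_imp_dirac:
  assumes cl: "closed_form A \<omega>"
  shows "\<exists>H. smooth_map_on A UNIV H \<and> nonlinear_dirac_equation L J dbar H \<psi>"
proof -
  \<comment> \<open>The coefficient of N\<omega>(1) in \<alpha>(1) as given by
    \<open>quat_eq_scaleR_of_real_product\<close>; the norm of N does not show because it is
    1.\<close>
  define h where "h x = qr (qcnj (\<alpha> x 1) * (N x * \<omega> x 1)) / (norm (\<omega> x 1))\<^sup>2" for x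
  define H where "H x = 2 * h x" for x
  have Hh: "H x / 2 = h x" for x by (simp add: H_def)
  have a1: "\<alpha> x 1 = (H x / 2) *\<^sub>R (N x * \<omega> x 1)" for x
  proof -
    have si: "\<alpha> x \<i> = N x * \<alpha> x 1" "\<omega> x \<i> = N x * \<omega> x 1"
      using alpha_star[of x 1] omega_star(1)[of x 1] by simp_all
    \<comment> \<open>With q = qcnj (\<alpha> 1) N \<omega>(1) the left-hand side is twice q minus
      twice the conjugate of q, so q is real.\<close>
    have "qcnj (\<alpha> x 1) * \<omega> x \<i> - qcnj (\<alpha> x \<i>) * \<omega> x 1 + (\<omega> x \<i> * \<alpha> x 1 - \<omega> x 1 * \<alpha> x \<i>) = 0"
      using cl ext_deriv_omega[of x 1 \<i>] unfolding closed_form_def by simp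
    moreover have "qcnj (\<alpha> x \<i>) * \<omega> x 1 = - (qcnj (\<alpha> x 1) * (N x * \<omega> x 1))"
      by (simp add: si mult.assoc)
    moreover have "\<omega> x \<i> * \<alpha> x 1 = - (\<omega> x 1 * (N x * \<alpha> x 1))"
      using omega_star(2)[of x 1] by (simp add: mult.assoc)
    ultimately have "qcnj (\<alpha> x 1) * (N x * \<omega> x 1) - - (qcnj (\<alpha> x 1) * (N x * \<omega> x 1))
        + (- (\<omega> x 1 * (N x * \<alpha> x 1)) - \<omega> x 1 * (N x * \<alpha> x 1)) = 0"
      by (simp only: si)
    moreover have "q = r" if "q - - q + (- r - r) = 0" for q r :: quat
      using that by (simp add: quat_eq_iff)
    ultimately have "qcnj (\<alpha> x 1) * (N x * \<omega> x 1) = \<omega> x 1 * (N x * \<alpha> x 1)" by blast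
    moreover have "qcnj (qcnj (\<alpha> x 1) * (N x * \<omega> x 1)) = \<omega> x 1 * (N x * \<alpha> x 1)"
      by (simp add: mult.assoc)
    ultimately have "qcnj (qcnj (\<alpha> x 1) * (N x * \<omega> x 1)) = qcnj (\<alpha> x 1) * (N x * \<omega> x 1)"
      by (simp only:)
    moreover have "N x * \<omega> x 1 \<noteq> 0" using omega_nonzero[of 1 x] N_norm[of x] by auto
    ultimately have "\<alpha> x 1 = (qr (qcnj (\<alpha> x 1) * (N x * \<omega> x 1)) / (norm (N x * \<omega> x 1))\<^sup>2) *\<^sub>R (N x * \<omega> x 1)"
      by (rule quat_eq_scaleR_of_real_product)
    then show ?thesis unfolding Hh h_def norm_mult N_norm mult_1 .
  qed
  have \<alpha>_lin: "linear (\<alpha> x)" for x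
    using smooth_form_onD(1)[OF dbar_Kbar(2)[OF psi], of x] by (simp add: \<alpha>_def[abs_def])
  have \<alpha>_eq: "\<alpha> x X = (H x / 2) *\<^sub>R (N x * \<omega> x X)" for x X
  proof -
    have "\<alpha> x \<i> = (H x / 2) *\<^sub>R (N x * \<omega> x \<i>)"
      using alpha_star[of x 1] omega_star(1)[of x 1] a1[of x] by simp
    then show ?thesis
      unfolding linear_complex_expand[OF \<alpha>_lin, of x X] linear_complex_expand[OF omega_linear, of x X] a1
      by (simp add: distrib_left scaleR_add_right mult.commute)
  qed
  \<comment> \<open>The definition of \<open>h\<close> uses the tangent vector \<open>1\<close> of
    the chart selected at \<open>x\<close>, and this selection need not vary continuously. The
    quotient is the same for every nonzero \<open>X\<close>, so smoothness can be read off from a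
    coordinate field of a fixed chart.\<close>
  have H: "H x = 2 * (qr (qcnj (\<alpha> x X) * (N x * \<omega> x X)) * inverse (inner (\<omega> x X) (\<omega> x X)))" if "X \<noteq> 0" for x X
  proof -
    have "qcnj (\<alpha> x X) * (N x * \<omega> x X) = (H x / 2) *\<^sub>R (qcnj (N x * \<omega> x X) * (N x * \<omega> x X))"
      unfolding \<alpha>_eq by (simp del: qcnj_simps add: qcnj_simps(6))
    also have "\<dots> = (H x / 2 * (norm (\<omega> x X))\<^sup>2) *\<^sub>R 1"
      unfolding mult_qcnj by (simp add: norm_mult N_norm)
    finally show ?thesis using omega_nonzero[OF that, of x] by (simp add: power2_norm_eq_inner)
  qed
  have "smooth_map_on A UNIV H"
  proof (rule smooth_map_onI)
    fix c assume c: "c \<in> A"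
    let ?S = "snd c ` (UNIV \<inter> fst c)"
    have op: "open ?S" by (rule open_chart_image_Int[OF c open_UNIV])
    define a w n where "a z = form_coord A c \<alpha> z 1" and "w z = form_coord A c \<omega> z 1" and "n z = N (chart_inv c z)" for z
    have sm: "smooth_on ?S a" "smooth_on ?S w" "smooth_on ?S n"
      unfolding a_def w_def n_def
      using smooth_form_onD(2)[OF dbar_Kbar(2)[OF psi] c] smooth_form_onD(2)[OF omega_smooth c] smooth_map_onD[OF N_smooth c]
      by (simp_all add: \<alpha>_def[abs_def])
    have pt: "\<exists>x X. X \<noteq> 0 \<and> chart_inv c z = x \<and> a z = \<alpha> x X \<and> w z = \<omega> x X" if "z \<in> ?S" for z
    proof -
      obtain x where x: "x \<in> fst c" "z = snd c x" using \<open>z \<in> ?S\<close> by blast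
      then show ?thesis using c tr_nonzero[OF c chart_at(1) x(1) chart_at(2)]
        by (intro exI[of _ x] exI[of _ "tr c (chart_at A x) x"]) (simp add: a_def w_def form_coord_def chart_vector_eq)
    qed
    have nz: "inner (w z) (w z) \<noteq> 0" if "z \<in> ?S" for z
      using pt[OF that] omega_nonzero by force
    have 1: "smooth_on ?S (\<lambda>z. qcnj (a z) * (n z * w z))"
      by (intro bounded_bilinear.smooth_on_bilinear[OF bounded_bilinear_mult op]
          bounded_linear.smooth_on_linear[OF bounded_linear_quat(5) op] sm)
    have 2: "smooth_on ?S (\<lambda>z. inverse (inner (w z) (w z)))"
      by (rule smooth_on_inverse[OF op bounded_bilinear.smooth_on_bilinear[OF bounded_bilinear_inner op sm(2) sm(2)] nz])
    have "smooth_on ?S (\<lambda>z. 2 * (qr (qcnj (a z) * (n z * w z)) * inverse (inner (w z) (w z))))"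
      by (rule bounded_bilinear.smooth_on_bilinear[OF bounded_bilinear_mult op smooth_on_const[OF op]
          bounded_bilinear.smooth_on_bilinear[OF bounded_bilinear_mult op
            bounded_linear.smooth_on_linear[OF bounded_linear_quat(1) op 1] 2]])
    moreover have "2 * (qr (qcnj (a z) * (n z * w z)) * inverse (inner (w z) (w z))) = H (chart_inv c z)" if z: "z \<in> ?S" for z
    proof -
      obtain x X where X: "X \<noteq> 0" "chart_inv c z = x" "a z = \<alpha> x X" "w z = \<omega> x X" using pt[OF z] by blast
      show ?thesis unfolding n_def X(2-4) by (rule H[OF X(1), symmetric])
    qed
    ultimately show "smooth_on ?S (\<lambda>z. H (chart_inv c z))" 
      by (rule smooth_on_cong[OF op, THEN iffD1, rotated])
  qed
  then show ?thesis using \<alpha>_eq nonlinear_dirac_iff by blast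
qed

end

lemma quat_half: "q * (1 / 2) = (1 / 2) *\<^sub>R (q :: quat)" "q / 2 = (1 / 2) *\<^sub>R q"
proof -
  have "(1 / 2 :: quat) = (1 / 2) *\<^sub>R 1" by (metis of_real_def of_real_divide of_real_1 of_real_numeral)
  then show "q * (1 / 2) = (1 / 2) *\<^sub>R q" by (metis mult_scaleR_right mult.right_neutral)
  then show "q / 2 = (1 / 2) *\<^sub>R q" by simp
qed

section \<open>The Dirac operator with potential, and the derivative of the Gauss map\<close>

context spinor
begin

lemma proj_potential [simp]:
  assumes "\<phi> \<in> sections A L"
  shows "proj L (dirac_potential L J dbar H \<psi> \<phi> x X) = x"
  by (simp add: dirac_potential_def dbar_Kbar(1)[OF assms])

lemma kappa_potential:
  assumes "\<phi> \<in> sections A L"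
  shows "\<kappa> (dirac_potential L J dbar H \<psi> \<phi> x X) =
    \<kappa> (dbar \<phi> x X) + (- (H x / 2) *\<^sub>R N x) * (\<omega> x X * \<kappa> (\<phi> x))"
proof -
  have "proj L (\<phi> x) = x" using assms by (simp add: sections_iff)
  then show ?thesis by (simp add: dirac_potential_def dbar_Kbar(1)[OF assms] pairing_kappa[of _ x])
qed

lemma sections_add:
  assumes "\<phi> \<in> sections A L" "\<phi>' \<in> sections A L"
  shows "(\<lambda>x. fadd L (\<phi> x) (\<phi>' x)) \<in> sections A L"
  using assms smooth_map_on_add[OF open_UNIV, of "\<lambda>x. \<kappa> (\<phi> x)" "\<lambda>x. \<kappa> (\<phi>' x)"] by (simp add: sections_iff)

lemma sections_scale:
  assumes "\<phi> \<in> sections A L" "smooth_map_on A UNIV q"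
  shows "(\<lambda>x. fscale L (\<phi> x) (q x)) \<in> sections A L"
  using assms smooth_map_on_bilinear[OF bounded_bilinear_mult open_UNIV, of "\<lambda>x. \<kappa> (\<phi> x)" q] by (simp add: sections_iff)

text \<open>The potential term is tensorial and drops out of \<open>(D\<psi>,\<phi>) + (\<psi>,D\<phi>)\<close> by skew-symmetry.\<close>

lemma potential_qh:
  assumes H: "smooth_map_on A UNIV H"
  shows "qh_spin_structure A L J (dirac_potential L J dbar H \<psi>)"
proof -
  let ?D = "dirac_potential L J dbar H \<psi>"
  have kbar: "?D \<phi> \<in> Kbar_forms A L J" if \<phi>: "\<phi> \<in> sections A L" for \<phi>
  proof -
    have b: "smooth_map_on A UNIV (\<lambda>x. \<kappa> (\<phi> x))" using \<phi> by (simp add: sections_iff)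
    have 1: "smooth_form_on A UNIV (\<lambda>x X. \<omega> x X * \<kappa> (\<phi> x))"
      by (rule smooth_form_on_bilinear[OF bounded_bilinear.flip[OF bounded_bilinear_mult] open_UNIV b omega_smooth])
    have "smooth_map_on A UNIV (\<lambda>x. - (H x / 2))"
      by (rule smooth_map_on_linear[of "\<lambda>r. - (r / 2)", OF _ open_UNIV H])
        (intro bounded_linear_minus bounded_linear_divide)
    then have 2: "smooth_map_on A UNIV (\<lambda>x. - (H x / 2) *\<^sub>R N x)"
      by (rule smooth_map_on_bilinear[OF bounded_bilinear_scaleR open_UNIV _ N_smooth])
    have "smooth_form_on A UNIV (\<lambda>x X. \<kappa> (dbar \<phi> x X) + (- (H x / 2) *\<^sub>R N x) * (\<omega> x X * \<kappa> (\<phi> x)))"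
      by (rule smooth_form_on_add[OF open_UNIV dbar_Kbar(2)[OF \<phi>]
            smooth_form_on_bilinear[OF bounded_bilinear_mult open_UNIV 2 1]])
    then have sm: "smooth_lform A L (?D \<phi>)"
      unfolding smooth_lform_iff kappa_potential[OF \<phi>] using proj_potential[OF \<phi>] by blast
    have "?D \<phi> x (\<i> * X) = fscale L (J (?D \<phi> x X)) (- 1)" for x X
    proof (rule kappa_eqI)
      \<comment> \<open>The coefficient of the potential term is a real multiple of N and commutes
        with N, so this term inherits its type from \<omega>.\<close>
      have "\<kappa> (?D \<phi> x (\<i> * X)) = N x * \<kappa> (?D \<phi> x X)"
        unfolding kappa_potential[OF \<phi>] dbar_Kbar(3)[OF \<phi>] omega_star(1)
        by (simp add: right_diff_distrib mult.assoc)
      then show "\<kappa> (?D \<phi> x (\<i> * X)) = \<kappa> (fscale L (J (?D \<phi> x X)) (- 1))"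
        by (simp add: proj_potential[OF \<phi>])
    qed (simp add: proj_potential[OF \<phi>])
    then show ?thesis using sm unfolding Kbar_forms_def by blast
  qed
  have add: "?D (\<lambda>x. fadd L (\<phi> x) (\<phi>' x)) x X = fadd L (?D \<phi> x X) (?D \<phi>' x X)"
    if \<phi>: "\<phi> \<in> sections A L" and \<phi>': "\<phi>' \<in> sections A L" for \<phi> \<phi>' x X
  proof (rule kappa_eqI)
    have pr: "proj L (\<phi> x) = x" "proj L (\<phi>' x) = x" using \<phi> \<phi>' by (simp_all add: sections_iff)
    show "\<kappa> (?D (\<lambda>x. fadd L (\<phi> x) (\<phi>' x)) x X) = \<kappa> (fadd L (?D \<phi> x X) (?D \<phi>' x X))"
      using pr by (simp add: kappa_potential sections_add \<phi> \<phi>' qh_add dbar_Kbar(1) distrib_left)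
  qed (simp add: sections_add \<phi> \<phi>')
  have leib: "?D (\<lambda>x. fscale L (\<phi> x) (q x)) x X = fadd L (fscale L (?D \<phi> x X) (q x))
               (part01 L J (\<lambda>x X. fscale L (\<phi> x) (differential A q x X)) x X)"
    if \<phi>: "\<phi> \<in> sections A L" and q: "smooth_map_on A UNIV q" for \<phi> q x X
  proof (rule kappa_eqI)
    have pr: "proj L (\<phi> x) = x" using \<phi> by (simp add: sections_iff)
    show "\<kappa> (?D (\<lambda>x. fscale L (\<phi> x) (q x)) x X) = \<kappa> (fadd L (fscale L (?D \<phi> x X) (q x))
               (part01 L J (\<lambda>x X. fscale L (\<phi> x) (differential A q x X)) x X))"
      using pr by (simp add: kappa_potential[OF sections_scale[OF \<phi> q]] kappa_potential[OF \<phi>] dbar_leibniz[OF \<phi> q]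
          dbar_Kbar(1)[OF \<phi>] proj_potential[OF \<phi>] proj_part01 left_diff_distrib mult.assoc)
  qed (use \<phi> in \<open>simp add: sections_scale[OF \<phi> q] proj_part01 sections_iff\<close>)
  have scale: "?D (\<lambda>x. fscale L (\<phi> x) (of_real r)) x X = fscale L (?D \<phi> x X) (of_real r)"
    if \<phi>: "\<phi> \<in> sections A L" for \<phi> r x X
  proof (rule kappa_eqI)
    show "\<kappa> (?D (\<lambda>x. fscale L (\<phi> x) (of_real r)) x X) = \<kappa> (fscale L (?D \<phi> x X) (of_real r))"
      by (simp add: kappa_potential[OF sections_scale[OF \<phi> smooth_map_on_const[OF open_UNIV]]] kappa_potential[OF \<phi>]
          qh_scale[OF \<phi>] left_diff_distrib mult.assoc)
  qed (simp add: sections_scale[OF \<phi> smooth_map_on_const[OF open_UNIV]] \<phi>)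
  have pair: "ext_deriv A (\<lambda>x. pairing L (\<phi> x) (\<phi>' x)) x X Y =
        form_pairing L (?D \<phi>) \<phi>' x X Y + pairing_form L \<phi> (?D \<phi>') x X Y"
    if \<phi>: "\<phi> \<in> sections A L" and \<phi>': "\<phi>' \<in> sections A L" for \<phi> \<phi>' x X Y
  proof -
    have pr: "proj L (\<phi> x) = x" "proj L (\<phi>' x) = x" using \<phi> \<phi>' by (simp_all add: sections_iff)
    show ?thesis
      unfolding qh_pairing[OF \<phi> \<phi>'] form_pairing_def pairing_form_def
      by (simp add: pairing_kappa[of _ x] pr dbar_Kbar(1)[OF \<phi>] dbar_Kbar(1)[OF \<phi>'] proj_potential[OF \<phi>]
          proj_potential[OF \<phi>'] kappa_potential[OF \<phi>] kappa_potential[OF \<phi>'] algebra_simps)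
  qed
  show ?thesis
    unfolding qh_spin_structure_def
    by (intro conjI ballI allI impI kbar add scale leib pair)
qed

text \<open>Applying \<open>dbar\<close> to \<open>J\<psi> = -\<psi>N\<close> turns the Dirac equation into an equation for the Gauss map.\<close>

lemma dN_eq:
  assumes "nonlinear_dirac_equation L J dbar H \<psi>"
  shows "differential A N x X - N x * differential A N x (\<i> * X) = (- 2 * H x) *\<^sub>R \<omega> x X"
proof -
  have \<alpha>: "\<alpha> x X = (H x / 2) *\<^sub>R (N x * \<omega> x X)" using assms nonlinear_dirac_iff by blast
  have sec: "(J \<circ> \<psi>) \<in> sections A L"
    using J_smooth psi unfolding sections_def by blast
  have b: "(\<lambda>x. \<kappa> ((J \<circ> \<psi>) x)) = (\<lambda>x. - N x)" by simp
  have dN: "differential A (\<lambda>x. - N x) x = (\<lambda>X. - differential A N x X)"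
    using has_diff_linear[OF smooth_map_has_diff[OF N_smooth open_UNIV UNIV_I] bounded_linear_minus[OF bounded_linear_ident]]
    by (rule differential_eq)
  let ?D = "differential A N x X - N x * differential A N x (\<i> * X)" and ?h = "(H x / 2) *\<^sub>R \<omega> x X"
  have "\<kappa> (dbar (J \<circ> \<psi>) x X) = - (N x * \<alpha> x X)"
    by (simp add: dbar_J[OF psi] dbar_Kbar(1)[OF psi] \<alpha>_def)
  \<comment> \<open>The same quantity computed from the Leibniz rule, with coordinate -N for
    J\<psi>; the preceding value came from commutation with J.\<close>
  moreover have "\<kappa> (dbar (J \<circ> \<psi>) x X) = - (\<alpha> x X * N x) - (1 / 2) *\<^sub>R ?D"
    unfolding kappa_dbar[OF sec] b dN quat_half by (simp add: algebra_simps)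
  moreover have "N x * \<alpha> x X = - ?h" by (simp add: \<alpha> N_square_mult)
  moreover have "\<alpha> x X * N x = ?h" by (simp add: \<alpha> mult.assoc omega_N N_square_mult)
  ultimately have "- ?h - (1 / 2) *\<^sub>R ?D = ?h" by (simp only: minus_minus)
  moreover have "q = (- 2 * H x) *\<^sub>R w" if "- ((H x / 2) *\<^sub>R w) - (1 / 2) *\<^sub>R q = (H x / 2) *\<^sub>R w" for q w :: quat
    using that by (auto simp: quat_eq_iff algebra_simps)
  ultimately show ?thesis by blast
qed

end

section \<open>The immersion, its induced spin bundle and its mean curvature\<close>

locale spinor_cover = spinor A L J dbar \<psi> + covered_atlas A p
  for A :: "'m::topological_space chart set" and L :: "('m, 'l) pairing_bundle"
    and J dbar \<psi> and p :: "'u::topological_space \<Rightarrow> 'm" +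
  fixes H :: "'m \<Rightarrow> real" and f :: "'u \<Rightarrow> quat"
  assumes H_smooth: "smooth_map_on A UNIV H"
    and nde: "nonlinear_dirac_equation L J dbar H \<psi>"
    and df: "differential (cover_atlas A p) f = pullback_form A p \<omega>"
begin

lemma df_eq: "differential B f y X = \<omega> (p y) (tangent_map B A p y X)"
  by (simp add: df pullback_form_def)

text \<open>The tangent map of the covering is onto, so a value exists; as the differential of
  \<open>f\<close> is pulled back from M, all points of the fibre give the same one.\<close>

lemma descended_eq: "descended_differential A p f x X = \<omega> x X"
  unfolding descended_differential_def
proof (rule the_equality)
  obtain y where y: "p y = x" using p_surj by blast
  obtain a where a: "a \<noteq> 0" "\<And>X. tangent_map B A p y X = a * X" using tangent_map_complex_linear[of y] by blast
  then have t: "tangent_map B A p y (X / a) = X" by simp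
  then have "\<omega> x X = differential B f y (X / a)" by (simp only: df_eq y t)
  then show "\<exists>y Y. p y = x \<and> tangent_map B A p y Y = X \<and> \<omega> x X = differential B f y Y" using y t by blast
next
  fix q assume "\<exists>y Y. p y = x \<and> tangent_map B A p y Y = X \<and> q = differential B f y Y"
  then show "q = \<omega> x X" by (auto simp: df_eq)
qed

lemma gauss: "gauss_normal_map A p f N"
  unfolding gauss_normal_map_def Let_def
proof (intro conjI allI)
  fix x y X
  show "N x \<in> Im_quat" using qcnj_eq_uminus_iff[THEN iffD1, OF N_cnj] by (simp add: Im_quat_def)
  obtain a where a: "a \<noteq> 0" "\<And>X. tangent_map B A p y X = a * X" using tangent_map_complex_linear[of y] by blast
  have star: "differential B f y (\<i> * X) = \<omega> (p y) (\<i> * (a * X))" by (simp add: df_eq a(2) mult.left_commute)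
  show "differential B f y (\<i> * X) = N (p y) * differential B f y X"
    unfolding star omega_star(1) by (simp add: df_eq a(2))
  show "differential B f y (\<i> * X) = - (differential B f y X * N (p y))"
    unfolding star omega_star(2) by (simp add: df_eq a(2))
  let ?w = "\<omega> (p y) (a * X)"
  \<comment> \<open>Exchanging the factors preserves the real part of a product but here reverses
    the sign of the product, since N and \<omega> anticommute. The real part is thus zero, which is
    orthogonality.\<close>
  have "qr (N (p y) * ?w) = qr (- (N (p y) * ?w))" using omega_N[of "p y" "a * X"] qr_mult_commute by metis
  then have "qr (N (p y) * ?w) = 0" unfolding quat_sel_uminus(1) by linarith
  then show "inner (N (p y)) (differential B f y X) = 0"
    unfolding inner_quat_qcnj df_eq a(2) N_cnj mult_minus_left quat_sel_uminus(1) by linarith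
qed (rule N_smooth, rule N_norm)

abbreviation "K \<equiv> induced_bundle A p f"

lemma K_simps [simp]:
  "proj K = fst" "fadd K a b = (fst a, snd a + snd b)" "fscale K a q = (fst a, snd a * q)" "trivs K = {(UNIV, snd)}"
  "pairing K a b X = qcnj (snd a) * \<omega> (fst a) X * snd b"
  by (simp_all add: induced_bundle_def descended_eq)

lemma smooth_section_K:
  "smooth_section_on A K U s \<longleftrightarrow> (\<forall>x\<in>U. fst (s x) = x) \<and> smooth_map_on A U (\<lambda>x. snd (s x))"
  by (simp add: smooth_section_on_def comp_def)

lemma fzero_K: "fzero K a \<longleftrightarrow> snd a = 0"
  by (cases a) (auto simp: fzero_def)

text \<open>The pairing of the induced bundle is the coordinate expression of the pairing of
  \<open>L\<close>, so the axioms reduce to linearity, skewness and conformality of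
  \<omega>.\<close>

lemma spin_bundle_K: "spin_bundle A K"
  unfolding spin_bundle_def
proof (intro conjI allI impI)
  have "bij_betw snd {a. fst a = x} (UNIV :: quat set)" for x :: 'm
    unfolding bij_betw_def by (auto simp: inj_on_def prod_eq_iff image_iff)
  moreover have "\<exists>g :: 'm \<Rightarrow> quat. smooth_map_on A UNIV g \<and> (\<forall>a. snd a = g (fst a) * snd a)"
    by (rule exI[of _ "\<lambda>x. 1"]) (simp add: smooth_map_on_const)
  ultimately show "qline_bundle A K" by (simp add: qline_bundle_def)
next
  fix U s t assume st: "open U \<and> smooth_section_on A K U s \<and> smooth_section_on A K U t"
  then have U: "open U" and s: "\<And>x. x \<in> U \<Longrightarrow> fst (s x) = x" "smooth_map_on A U (\<lambda>x. snd (s x))"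
    and t: "smooth_map_on A U (\<lambda>x. snd (t x))" unfolding smooth_section_K by blast+
  have w: "smooth_form_on A U \<omega>" by (rule smooth_form_on_subset[OF omega_smooth]) simp
  have "smooth_form_on A U (\<lambda>x X. qcnj (snd (s x)) * \<omega> x X * snd (t x))"
    by (rule smooth_form_on_bilinear[OF bounded_bilinear.flip[OF bounded_bilinear_mult] U t
          smooth_form_on_bilinear[OF bounded_bilinear_mult U smooth_map_on_linear[OF bounded_linear_quat(5) U s(2)] w]])
  then show "smooth_form_on A U (\<lambda>x. pairing K (s x) (t x))"
    by (rule smooth_form_on_cong[OF U, rotated]) (simp add: s(1))
next
  fix a b :: "'m \<times> quat"
  have "linear (\<lambda>X. qcnj (snd a) * \<omega> (fst a) X * snd b)"
    by (rule linearI) (simp_all add: linear_add[OF omega_linear] linear_scale[OF omega_linear] algebra_simps)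
  moreover have "pairing K a b = (\<lambda>X. qcnj (snd a) * \<omega> (fst a) X * snd b)" by (rule ext) simp
  ultimately show "linear (pairing K a b)" by simp
next
  fix a b c :: "'m \<times> quat" and \<alpha> \<beta> X
  show "pairing K (fadd K a b) c X = pairing K a c X + pairing K b c X"
    if "proj K a = proj K b \<and> proj K b = proj K c"
    using that by (simp add: algebra_simps)
  show "pairing K c (fadd K a b) X = pairing K c a X + pairing K c b X" by (simp add: algebra_simps)
  show "pairing K (fscale K a \<alpha>) (fscale K b \<beta>) X = qcnj \<alpha> * pairing K a b X * \<beta>" by (simp add: mult.assoc)
  show "qcnj (pairing K a b X) = - pairing K b a X" if "proj K a = proj K b"
    using that by (simp add: mult.assoc)
next
  fix a :: "'m \<times> quat" and X
  show "pairing K a a X \<noteq> 0" if "\<not> fzero K a \<and> X \<noteq> 0"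
  proof -
    have "norm (pairing K a a X) = norm (snd a) * norm (\<omega> (fst a) X) * norm (snd a)" by (simp add: norm_mult)
    then show ?thesis using that omega_nonzero[of X "fst a"] by (auto simp: fzero_K)
  qed
  show "\<exists>r>0. \<forall>X. (norm (pairing K a a X))\<^sup>2 = r * (norm X)\<^sup>2" if "\<not> fzero K a"
  proof -
    obtain r where r: "r > 0" "\<And>X. (norm (\<omega> (fst a) X))\<^sup>2 = r * (norm X)\<^sup>2" using omega_norm by blast
    have "(norm (pairing K a a X))\<^sup>2 = ((norm (snd a))\<^sup>2 * (norm (snd a))\<^sup>2 * r) * (norm X)\<^sup>2" for X
      by (simp add: norm_mult power_mult_distrib r(2))
    moreover have "(norm (snd a))\<^sup>2 * (norm (snd a))\<^sup>2 * r > 0" using r(1) that by (simp add: fzero_K)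
    ultimately show ?thesis by blast
  qed
qed

lemma complex_structure_K: "spin_complex_structure A K (induced_J N)"
  unfolding spin_complex_structure_def
proof (intro conjI allI impI)
  fix U s assume st: "open U \<and> smooth_section_on A K U s"
  then have U: "open U" and s: "\<And>x. x \<in> U \<Longrightarrow> fst (s x) = x" "smooth_map_on A U (\<lambda>x. snd (s x))"
    unfolding smooth_section_K by blast+
  have "smooth_map_on A U (\<lambda>x. - (N x * snd (s x)))"
    by (intro smooth_map_on_linear[OF bounded_linear_minus[OF bounded_linear_ident] U]
        smooth_map_on_bilinear[OF bounded_bilinear_mult U] s(2) smooth_map_on_subset[OF N_smooth]) simp
  then have "smooth_map_on A U (\<lambda>x. snd ((induced_J N \<circ> s) x))"
    by (rule smooth_map_on_cong[OF U, rotated]) (simp add: induced_J_def s(1))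
  then show "smooth_section_on A K U (induced_J N \<circ> s)"
    unfolding smooth_section_K using s(1) by (simp add: induced_J_def)
next
  fix a b :: "'m \<times> quat" and X
  show "pairing K a b (\<i> * X) = pairing K (induced_J N a) b X"
    by (simp add: induced_J_def omega_star(1) mult.assoc)
  show "pairing K a b (\<i> * X) = pairing K a (induced_J N b) X" if "proj K a = proj K b"
    using that by (simp add: induced_J_def omega_star(2) mult.assoc)
qed (auto simp: induced_J_def algebra_simps N_square_mult)

text \<open>The isomorphism that sends the constant section 1 of the trivial bundle to the frame
  \<psi>; its inverse is \<open>(proj L a, \<kappa> a)\<close>.\<close>

definition \<Phi> :: "'m \<times> quat \<Rightarrow> 'l" where "\<Phi> a = fscale L (\<psi> (fst a)) (snd a)"

lemma Phi_simps [simp]: "proj L (\<Phi> a) = fst a" "\<kappa> (\<Phi> a) = snd a"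
  by (simp_all add: \<Phi>_def)

lemma Phi_eqI: "proj L a = fst b \<Longrightarrow> \<kappa> a = snd b \<Longrightarrow> \<Phi> b = a"
  by (rule kappa_eqI) simp_all

lemma Phi_iso: "spin_bundle_iso A K L \<Phi>"
  unfolding spin_bundle_iso_def
proof (intro conjI allI impI)
  show "bij \<Phi>"
  proof (rule bijI)
    show "inj \<Phi>" by (rule injI) (metis Phi_simps prod_eqI)
    show "surj \<Phi>" by (rule surjI[of _ "\<lambda>a. (proj L a, \<kappa> a)"]) (rule Phi_eqI, simp_all)
  qed
  fix U :: "'m set" and s :: "'m \<Rightarrow> 'm \<times> quat" assume "open U"
  show "smooth_section_on A K U s = smooth_section_on A L U (\<Phi> \<circ> s)"
    unfolding smooth_section_iff[OF \<open>open U\<close>] smooth_section_K by simp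
next
  fix a b :: "'m \<times> quat" and X q
  show "\<Phi> (fadd K a b) = fadd L (\<Phi> a) (\<Phi> b)" if "proj K a = proj K b"
    using that by (intro Phi_eqI) simp_all
  show "\<Phi> (fscale K a q) = fscale L (\<Phi> a) q" by (intro Phi_eqI) simp_all
  show "pairing L (\<Phi> a) (\<Phi> b) X = pairing K a b X" if "proj K a = proj K b"
    using that by (simp add: pairing_kappa[of _ "fst a"])
qed simp

lemma sections_K: "\<phi> \<in> sections A K \<longleftrightarrow> \<Phi> \<circ> \<phi> \<in> sections A L"
  using Phi_iso unfolding spin_bundle_iso_def sections_def by blast

lemma induced_structure_eq:
  "induced_structure A p f N \<phi> x X =
    (x, (differential A (\<lambda>x. snd (\<phi> x)) x X - N x * differential A (\<lambda>x. snd (\<phi> x)) x (\<i> * X)) * (1 / 2))"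
  by (simp add: induced_structure_def part01_def induced_J_def comp_def)

text \<open>In coordinates the term \<alpha> b of \<open>kappa_dbar\<close> is cancelled by the
  potential term, and what remains is the (0,1)-part of db.\<close>

lemma Phi_intertwines:
  assumes "\<phi> \<in> sections A K"
  shows "\<Phi> (induced_structure A p f N \<phi> x X) = dirac_potential L J dbar H \<psi> (\<Phi> \<circ> \<phi>) x X"
proof (rule Phi_eqI)
  have s: "\<Phi> \<circ> \<phi> \<in> sections A L" using assms sections_K by blast
  show "proj L (dirac_potential L J dbar H \<psi> (\<Phi> \<circ> \<phi>) x X) = fst (induced_structure A p f N \<phi> x X)"
    by (simp add: proj_potential[OF s] induced_structure_eq)
  have "\<alpha> x X = (H x / 2) *\<^sub>R (N x * \<omega> x X)" using nde nonlinear_dirac_iff by blast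
  then show "\<kappa> (dirac_potential L J dbar H \<psi> (\<Phi> \<circ> \<phi>) x X) = snd (induced_structure A p f N \<phi> x X)"
    unfolding kappa_potential[OF s] kappa_dbar[OF s] induced_structure_eq by (simp add: mult.assoc)
qed

lemma snd_induced_structure:
  assumes "\<phi> \<in> sections A K"
  shows "snd (induced_structure A p f N \<phi> x X) = \<kappa> (dirac_potential L J dbar H \<psi> (\<Phi> \<circ> \<phi>) x X)"
  using Phi_intertwines[OF assms, of x X] Phi_simps(2) by metis

text \<open>Additivity and the Leibniz rules are ordinary calculus for the explicit operator. The
  smoothness and type of its values and the product rule for the pairing are transported from
  \<open>L\<close> by \<open>\<Phi>\<close>.\<close>

lemma induced_qh: "qh_spin_structure A K (induced_J N) (induced_structure A p f N)"
proof -
  let ?D = "induced_structure A p f N" and ?E = "dirac_potential L J dbar H \<psi>"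
  note qhL = potential_qh[OF H_smooth, unfolded qh_spin_structure_def]
  have sec: "\<Phi> \<circ> \<phi> \<in> sections A L" "fst (\<phi> x) = x" "smooth_map_on A UNIV (\<lambda>x. snd (\<phi> x))" if "\<phi> \<in> sections A K" for \<phi> x
    using that sections_K unfolding sections_def smooth_section_K by blast+
  have fstD: "fst (?D \<phi> x X) = x" for \<phi> x X by (simp add: induced_structure_eq)
  have kbar: "?D \<phi> \<in> Kbar_forms A K (induced_J N)" if \<phi>: "\<phi> \<in> sections A K" for \<phi>
  proof -
    have E: "?E (\<Phi> \<circ> \<phi>) \<in> Kbar_forms A L J" using qhL[THEN conjunct1] sec(1)[OF \<phi>] by blast
    then have "smooth_form_on A UNIV (\<lambda>x X. \<kappa> (?E (\<Phi> \<circ> \<phi>) x X))"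
      unfolding Kbar_forms_def smooth_lform_iff by blast
    then have "smooth_lform A K (?D \<phi>)"
      unfolding smooth_lform_def by (simp add: fstD snd_induced_structure[OF \<phi>])
    moreover have "?D \<phi> x (\<i> * X) = fscale K (induced_J N (?D \<phi> x X)) (- 1)" for x X
    proof -
      have "?E (\<Phi> \<circ> \<phi>) x (\<i> * X) = fscale L (J (?E (\<Phi> \<circ> \<phi>) x X)) (- 1)"
        using E unfolding Kbar_forms_def by blast
      then have "snd (?D \<phi> x (\<i> * X)) = N x * snd (?D \<phi> x X)"
        unfolding snd_induced_structure[OF \<phi>] by (simp add: proj_potential[OF sec(1)[OF \<phi>]])
      then show ?thesis by (simp add: prod_eq_iff fstD induced_J_def)
    qed
    ultimately show ?thesis unfolding Kbar_forms_def by blast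
  qed
  have add: "?D (\<lambda>x. fadd K (\<phi> x) (\<phi>' x)) x X = fadd K (?D \<phi> x X) (?D \<phi>' x X)"
    if \<phi>: "\<phi> \<in> sections A K" and \<phi>': "\<phi>' \<in> sections A K" for \<phi> \<phi>' x X
  proof -
    have "differential A (\<lambda>x. snd (\<phi> x) + snd (\<phi>' x)) x = (\<lambda>X. differential A (\<lambda>x. snd (\<phi> x)) x X + differential A (\<lambda>x. snd (\<phi>' x)) x X)"
      by (intro differential_eq has_diff_add smooth_map_has_diff[OF _ open_UNIV UNIV_I] sec(3) \<phi> \<phi>')
    then show ?thesis by (simp add: induced_structure_eq quat_half algebra_simps)
  qed
  have leib: "?D (\<lambda>x. fscale K (\<phi> x) (q x)) x X = fadd K (fscale K (?D \<phi> x X) (q x))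
               (part01 K (induced_J N) (\<lambda>x X. fscale K (\<phi> x) (differential A q x X)) x X)"
    if \<phi>: "\<phi> \<in> sections A K" and q: "smooth_map_on A UNIV q" for \<phi> q x X
  proof -
    have "differential A (\<lambda>x. snd (\<phi> x) * q x) x = (\<lambda>X. snd (\<phi> x) * differential A q x X + differential A (\<lambda>x. snd (\<phi> x)) x X * q x)"
      by (intro differential_eq has_diff_bilinear[OF bounded_bilinear_mult] smooth_map_has_diff[OF _ open_UNIV UNIV_I] sec(3) \<phi> q)
    then show ?thesis
      unfolding induced_structure_eq part01_def
      by (simp add: sec(2)[OF \<phi>] induced_J_def quat_half algebra_simps)
  qed
  have scale: "?D (\<lambda>x. fscale K (\<phi> x) (of_real r)) x X = fscale K (?D \<phi> x X) (of_real r)"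
    if \<phi>: "\<phi> \<in> sections A K" for \<phi> r x X
  proof -
    have "differential A (\<lambda>x. snd (\<phi> x) * of_real r) x = (\<lambda>X. differential A (\<lambda>x. snd (\<phi> x)) x X * of_real r)"
      by (intro differential_eq has_diff_linear[OF _ bounded_linear_mult_left] smooth_map_has_diff[OF _ open_UNIV UNIV_I] sec(3) \<phi>)
    then show ?thesis by (simp add: induced_structure_eq quat_half algebra_simps)
  qed
  have pair: "ext_deriv A (\<lambda>x. pairing K (\<phi> x) (\<phi>' x)) x X Y =
        form_pairing K (?D \<phi>) \<phi>' x X Y + pairing_form K \<phi> (?D \<phi>') x X Y"
    if \<phi>: "\<phi> \<in> sections A K" and \<phi>': "\<phi>' \<in> sections A K" for \<phi> \<phi>' x X Y
  proof -
    have K_L: "pairing K a b = pairing L (\<Phi> a) (\<Phi> b)" if "fst a = fst b" for a b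
      using Phi_iso that unfolding spin_bundle_iso_def by (intro ext) (simp only: K_simps(1))
    have "(\<lambda>x. pairing K (\<phi> x) (\<phi>' x)) = (\<lambda>x. pairing L ((\<Phi> \<circ> \<phi>) x) ((\<Phi> \<circ> \<phi>') x))"
      by (rule ext) (simp only: K_L sec(2)[OF \<phi>] sec(2)[OF \<phi>'] comp_apply)
    then have "ext_deriv A (\<lambda>x. pairing K (\<phi> x) (\<phi>' x)) x X Y =
        form_pairing L (?E (\<Phi> \<circ> \<phi>)) (\<Phi> \<circ> \<phi>') x X Y + pairing_form L (\<Phi> \<circ> \<phi>) (?E (\<Phi> \<circ> \<phi>')) x X Y"
      using qhL[THEN conjunct2, THEN conjunct2, THEN conjunct2, THEN conjunct2, rule_format, OF sec(1)[OF \<phi>] sec(1)[OF \<phi>']]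
      by simp
    also have "form_pairing L (?E (\<Phi> \<circ> \<phi>)) (\<Phi> \<circ> \<phi>') x X Y = form_pairing K (?D \<phi>) \<phi>' x X Y"
      unfolding form_pairing_def comp_apply
      by (simp only: K_L fstD sec(2)[OF \<phi>'] Phi_intertwines[OF \<phi>, unfolded comp_def] comp_def)
    also have "pairing_form L (\<Phi> \<circ> \<phi>) (?E (\<Phi> \<circ> \<phi>')) x X Y = pairing_form K \<phi> (?D \<phi>') x X Y"
      unfolding pairing_form_def comp_apply
      by (simp only: K_L fstD sec(2)[OF \<phi>] Phi_intertwines[OF \<phi>', unfolded comp_def] comp_def)
    finally show ?thesis .
  qed
  show ?thesis
    unfolding qh_spin_structure_def
    by (intro conjI ballI allI impI kbar add scale leib pair)
qed

lemma mean_curvature_eq: "mean_curvature B f (N \<circ> p) y = H (p y)"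
proof -
  obtain a where a: "a \<noteq> 0" "\<And>X. tangent_map B A p y X = a * X" using tangent_map_complex_linear[of y] by blast
  let ?T = "\<lambda>X. \<omega> (p y) (a * X)" and ?S = "\<lambda>X. differential A N (p y) (a * X)"
  have N': "has_diff N (p y) (differential A N (p y))" by (rule smooth_map_has_diff[OF N_smooth open_UNIV UNIV_I])
  have lin: "linear (differential A N (p y))"
    using N' unfolding has_diff_def by (intro bounded_linear.linear has_derivative_bounded_linear)
  show ?thesis
  proof (rule mean_curvature_conformal[where T = ?T and S = ?S and N = "N (p y)"])
    show "differential B f y = ?T" by (rule ext) (simp add: df_eq a(2))
    show "differential B (N \<circ> p) y = ?S" using C.differential_eq[OF has_diff_cover[OF N']] by (simp add: a(2))
    have "linear (\<lambda>X. a * X)" by (simp add: bounded_linear.linear bounded_linear_mult_right)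
    then show "linear ?S" by (rule linear_compose[OF _ lin, unfolded comp_def])
    show "conformal_linear ?T" by (rule conformal_linear_rotate[OF omega_conformal a(1)])
    show "\<omega> (p y) (a * \<i>) = N (p y) * \<omega> (p y) (a * 1)" using omega_star(1)[of "p y" a] by (simp add: mult.commute)
    \<comment> \<open>The equation for the Gauss map on M, evaluated at the tangent vector
      \<open>a\<close> that the covering assigns to \<open>1\<close>.\<close>
    show "differential A N (p y) (a * 1) - N (p y) * differential A N (p y) (a * \<i>) = (- 2 * H (p y)) *\<^sub>R \<omega> (p y) (a * 1)"
      using dN_eq[OF nde, of "p y" a] by (simp add: mult.commute)
  qed (rule N_cnj)
qed

lemma first_fundamental_form_eq:
  "first_fundamental_form B f y X X = (norm (pullback_form A p \<omega> y X))\<^sup>2"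
  by (simp add: first_fundamental_form_def df power2_norm_eq_inner)

end

theorem lemma4:
  fixes A :: "'m::t2_space chart set"
    and L :: "('m, 'l) pairing_bundle"
    and J :: "'l \<Rightarrow> 'l"
    and dbar :: "('m \<Rightarrow> 'l) \<Rightarrow> 'm \<Rightarrow> complex \<Rightarrow> 'l"
    and \<psi> :: "'m \<Rightarrow> 'l"
  assumes "riemann_surface A"
    and "spin_bundle A L"
    and "spin_complex_structure A L J"
    and "dirac_structure A L J dbar"
    and "\<psi> \<in> sections A L"
    and "\<forall>x. \<not> fzero L (\<psi> x)"
  shows
    "(\<lambda>x. pairing L (\<psi> x) (\<psi> x)) \<in> conformal_forms A \<and>
     (closed_form A (\<lambda>x. pairing L (\<psi> x) (\<psi> x)) \<longleftrightarrow>
        (\<exists>H::'m \<Rightarrow> real. smooth_map_on A UNIV H \<and> nonlinear_dirac_equation L J dbar H \<psi>)) \<and>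
     (\<forall>(H::'m \<Rightarrow> real) (p::'u::topological_space \<Rightarrow> 'm).
        smooth_map_on A UNIV H \<and> nonlinear_dirac_equation L J dbar H \<psi> \<and> universal_cover p \<longrightarrow>
        (\<exists>f. conformal_immersion_with_periods A p f \<and>
             differential (cover_atlas A p) f = pullback_form A p (\<lambda>x. pairing L (\<psi> x) (\<psi> x))) \<and>
        (\<forall>f. conformal_immersion_with_periods A p f \<and>
             differential (cover_atlas A p) f = pullback_form A p (\<lambda>x. pairing L (\<psi> x) (\<psi> x)) \<longrightarrow>
             (\<exists>N. gauss_normal_map A p f N \<and>
                  (\<forall>x. J (\<psi> x) = fscale L (\<psi> x) (- N x)) \<and>
                  spin_bundle A (induced_bundle A p f) \<and>
                  spin_complex_structure A (induced_bundle A p f) (induced_J N) \<and>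
                  qh_spin_structure A (induced_bundle A p f) (induced_J N) (induced_structure A p f N) \<and>
                  qh_spin_structure A L J (dirac_potential L J dbar H \<psi>) \<and>
                  (\<exists>\<Phi>. spin_bundle_iso A (induced_bundle A p f) L \<Phi> \<and>
                       (\<forall>\<phi>\<in>sections A (induced_bundle A p f). \<forall>x X.
                          \<Phi> (induced_structure A p f N \<phi> x X) =
                          dirac_potential L J dbar H \<psi> (\<Phi> \<circ> \<phi>) x X)) \<and>
                  (\<forall>y X. first_fundamental_form (cover_atlas A p) f y X X =
                         (norm (pullback_form A p (\<lambda>x. pairing L (\<psi> x) (\<psi> x)) y X))\<^sup>2) \<and>
                  (\<forall>y. mean_curvature (cover_atlas A p) f (N \<circ> p) y = H (p y)))))"
proof -
  interpret spinor A L J dbar \<psi>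
    using assms(2-6) riemann_surface_atlas[OF assms(1)] unfolding spinor_def spinor_axioms_def by blast
  have \<omega>: "(\<lambda>x. pairing L (\<psi> x) (\<psi> x)) = \<omega>" by (rule ext) (simp add: \<omega>_def)
  show ?thesis
    unfolding \<omega>
  proof (intro conjI allI impI)
    show "\<omega> \<in> conformal_forms A" by (rule omega_conformal_forms)
    show "closed_form A \<omega> \<longleftrightarrow> (\<exists>H. smooth_map_on A UNIV H \<and> nonlinear_dirac_equation L J dbar H \<psi>)"
      using closed_imp_dirac dirac_imp_closed by blast
  next
    fix H :: "'m \<Rightarrow> real" and p :: "'u \<Rightarrow> 'm"
    assume *: "smooth_map_on A UNIV H \<and> nonlinear_dirac_equation L J dbar H \<psi> \<and> universal_cover p"
    then interpret covered_atlas A p by unfold_locales (simp add: universal_cover_def)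
    show "\<exists>f. conformal_immersion_with_periods A p f \<and> differential (cover_atlas A p) f = pullback_form A p \<omega>"
      by (rule closed_form_integrates) (use * dirac_imp_closed omega_conformal_forms in \<open>auto simp: universal_cover_def\<close>)
    fix f
    assume f: "conformal_immersion_with_periods A p f \<and> differential (cover_atlas A p) f = pullback_form A p \<omega>"
    interpret spinor_cover A L J dbar \<psi> p H f
      by unfold_locales (use * f in simp_all)
    show "\<exists>N. gauss_normal_map A p f N \<and>
                  (\<forall>x. J (\<psi> x) = fscale L (\<psi> x) (- N x)) \<and>
                  spin_bundle A (induced_bundle A p f) \<and>
                  spin_complex_structure A (induced_bundle A p f) (induced_J N) \<and>
                  qh_spin_structure A (induced_bundle A p f) (induced_J N) (induced_structure A p f N) \<and>
                  qh_spin_structure A L J (dirac_potential L J dbar H \<psi>) \<and>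
                  (\<exists>\<Phi>. spin_bundle_iso A (induced_bundle A p f) L \<Phi> \<and>
                       (\<forall>\<phi>\<in>sections A (induced_bundle A p f). \<forall>x X.
                          \<Phi> (induced_structure A p f N \<phi> x X) =
                          dirac_potential L J dbar H \<psi> (\<Phi> \<circ> \<phi>) x X)) \<and>
                  (\<forall>y X. first_fundamental_form (cover_atlas A p) f y X X =
                         (norm (pullback_form A p \<omega> y X))\<^sup>2) \<and>
                  (\<forall>y. mean_curvature (cover_atlas A p) f (N \<circ> p) y = H (p y))"
      by (intro exI[of _ N] exI[of _ \<Phi>] conjI allI ballI gauss J_psi spin_bundle_K complex_structure_K induced_qh
          potential_qh[OF H_smooth] Phi_iso Phi_intertwines first_fundamental_form_eq mean_curvature_eq)
  qed
qed

end
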